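(* Up to isomorphism, the four-dimensional solvable real Lie algebras $\mathfrak g$ that admit invariant complex structures but no compatible invariant SKT metric (that is, $\mathfrak g$ admits an integrable $J$, but no pair $(g,J)$ on $\mathfrak g$ is SKT) are exactly: $\mathbb R\times\mathfrak r_{3,1}$; $\mathbb R\times\mathfrak r'_{3,\lambda}$ with $\lambda>0$; $\mathfrak{aff}_{\mathbb C}$; $\mathfrak r_{4,1}$; $\mathfrak r_{4,\mu,\lambda}$ with $\mu=\lambda\neq-\tfrac12$ or $\mu\le\lambda=1$; $\mathfrak r'_{4,\mu,\lambda}$ with $\lambda\ne 0,-\mu/2$; $\mathfrak d_{4,\lambda}$ with $\lambda\ne\tfrac12,2$; $\mathfrak h_4$. Here the stated constraints on the parameters are in addition to the defining constraints for the algebras.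
   Context: SKT structures. On a real Lie algebra $\mathfrak g$ let $d$ be the exterior derivative on $\Lambda^*\mathfrak g^*$ determined by $d\alpha(X,Y)=-\alpha([X,Y])$ for $\alpha\in\mathfrak g^*$. An invariant complex structure on $\mathfrak g$ is a linear endomorphism $J$ with $J^2=-1$ whose associated left-invariant almost complex structure on the simply-connected Lie group of $\mathfrak g$ is integrable. An inner product $g$ on $\mathfrak g$ is compatible with $J$ if $g(JX,JY)=g(X,Y)$; put $\omega(X,Y)=g(JX,Y)$. The pair $(g,J)$ is SKT if $J$ is integrable, $g$ is compatible with $J$ and $d(Jd\omega)=0$, where $Jd\omega=-d\omega(J\cdot,J\cdot,J\cdot)$. Notation for Lie algebras. A Lie algebra with basis $E_1,\dots,E_n$ and dual basis $e_1,\dots,e_n$ is written as the list $(de_1,\dots,de_n)$, where $ij$ stands for $e_i\wedge e_j$ (for example, $(0,0,21)$ means $de_1=de_2=0$, $de_3=e_2\wedge e_1$) and coefficients multiply these two-forms (a dot separates a coefficient from a two-form). Then, with their defining constraints: $\mathfrak r_{3,\lambda}=(0,21,\lambda.31)$, $|\lambda|\le 1$; $\mathfrak r'_{3,\lambda}=(0,\lambda.21+31,-21+\lambda.31)$, $\lambda\ge 0$; $\mathfrak{aff}_{\mathbb C}=(0,0,31-42,41+32)$; $\mathfrak r_{4,\lambda}=(0,21,\lambda.31+41,\lambda.41)$; $\mathfrak r_{4,\mu,\lambda}=(0,21,\mu.31,\lambda.41)$ with $(\mu,\lambda)\in[-1,1]^2$, $\lambda\ge\mu$, $\mu,\lambda\ne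 0$, and $\lambda<0$ if $\mu=-1$; $\mathfrak r'_{4,\mu,\lambda}=(0,\mu.21,\lambda.31+41,-31+\lambda.41)$, $\mu>0$; $\mathfrak d_{4,\lambda}=(0,\lambda.21,(1-\lambda).31,41+32)$, $\lambda\ge\tfrac12$; $\mathfrak h_4=(0,21+31,31,2.41+32)$. *)

theory Defs
  imports "HOL-Analysis.Analysis"
begin

section \<open>Real Lie algebras\<close>

text \<open>A Lie algebra is given by its bracket, a binary operation on a real vector space \<open>'a\<close>.\<close>

definition lie_algebra :: "('a::real_vector \<Rightarrow> 'a \<Rightarrow> 'a) \<Rightarrow> bool" where
  "lie_algebra br \<longleftrightarrow> bilinear br \<and> (\<forall>x. br x x = 0) \<and>
     (\<forall>x y z. br x (br y z) + br y (br z x) + br z (br x y) = 0)"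

fun derived_series :: "('a::real_vector \<Rightarrow> 'a \<Rightarrow> 'a) \<Rightarrow> nat \<Rightarrow> 'a set" where
  "derived_series br 0 = UNIV"
| "derived_series br (Suc k) =
     span {br x y | x y. x \<in> derived_series br k \<and> y \<in> derived_series br k}"

definition solvable_lie :: "('a::real_vector \<Rightarrow> 'a \<Rightarrow> 'a) \<Rightarrow> bool" where
  "solvable_lie br \<longleftrightarrow> (\<exists>k. derived_series br k = {0})"

definition lie_isomorphic ::
    "('a::real_vector \<Rightarrow> 'a \<Rightarrow> 'a) \<Rightarrow> ('b::real_vector \<Rightarrow> 'b \<Rightarrow> 'b) \<Rightarrow> bool" where
  "lie_isomorphic br br' \<longleftrightarrow>
     (\<exists>f. linear f \<and> bij f \<and> (\<forall>x y. f (br x y) = br' (f x) (f y)))"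

definition lie_prod ::
    "('a \<Rightarrow> 'a \<Rightarrow> 'a) \<Rightarrow> ('b \<Rightarrow> 'b \<Rightarrow> 'b) \<Rightarrow> 'a \<times> 'b \<Rightarrow> 'a \<times> 'b \<Rightarrow> 'a \<times> 'b" where
  "lie_prod br br' x y = (br (fst x) (fst y), br' (snd x) (snd y))"

definition lie_R :: "real \<Rightarrow> real \<Rightarrow> real" where
  "lie_R x y = 0"


section \<open>The exterior derivative\<close>

text \<open>
  A \<open>k\<close>-form on the Lie algebra is a function of the list \<open>[X\<^sub>0, \<dots>, X\<^sub>k\<^sub>-\<^sub>1]\<close> of its arguments; its
  values on lists of other lengths are irrelevant. The derivative is given by the
  Chevalley--Eilenberg formula
  \<open>d\<alpha>(X\<^sub>0,\<dots>,X\<^sub>k) = \<Sum>i<j. (-1)^(i+j) \<alpha>([X\<^sub>i,X\<^sub>j], X\<^sub>0,\<dots>,X\<^sub>k)\<close>,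
  where \<open>X\<^sub>i\<close> and \<open>X\<^sub>j\<close> are omitted from the tail. This is the extension of
  \<open>d\<alpha>(X,Y) = -\<alpha>([X,Y])\<close> from one-forms to an antiderivation of the exterior algebra, for the
  wedge product normalised by \<open>(\<alpha> \<and> \<beta>)(X,Y) = \<alpha>(X)\<beta>(Y) - \<alpha>(Y)\<beta>(X)\<close>.
\<close>

definition ext_d :: "('a \<Rightarrow> 'a \<Rightarrow> 'a) \<Rightarrow> ('a list \<Rightarrow> real) \<Rightarrow> 'a list \<Rightarrow> real" where
  "ext_d br \<alpha> Xs =
     (\<Sum>j<length Xs. \<Sum>i<j. (-1) ^ (i + j) * \<alpha> (br (Xs ! i) (Xs ! j) # nths Xs (- {i, j})))"

lemma ext_d_1: "ext_d br \<alpha> [X, Y] = - \<alpha> [br X Y]"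
  by (simp add: ext_d_def nths_Cons lessThan_Suc)

lemma ext_d_2:
  "ext_d br \<alpha> [X, Y, Z] = - \<alpha> [br X Y, Z] + \<alpha> [br X Z, Y] - \<alpha> [br Y Z, X]"
  by (simp add: ext_d_def nths_Cons lessThan_Suc)

lemma ext_d_3:
  "ext_d br \<alpha> [X, Y, Z, W] =
     - \<alpha> [br X Y, Z, W] + \<alpha> [br X Z, Y, W] - \<alpha> [br X W, Y, Z]
     - \<alpha> [br Y Z, X, W] + \<alpha> [br Y W, X, Z] - \<alpha> [br Z W, X, Y]"
  by (simp add: ext_d_def nths_Cons lessThan_Suc)


section \<open>SKT structures\<close>

text \<open>
  Integrability of the left-invariant almost complex structure determined by \<open>J\<close> is the vanishing
  of its Nijenhuis tensor. This tensor is left-invariant, so it is enough to evaluate it on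
  left-invariant vector fields, that is, on elements of the Lie algebra.
\<close>

definition nijenhuis :: "('a::real_vector \<Rightarrow> 'a \<Rightarrow> 'a) \<Rightarrow> ('a \<Rightarrow> 'a) \<Rightarrow> 'a \<Rightarrow> 'a \<Rightarrow> 'a" where
  "nijenhuis br J X Y = br (J X) (J Y) - J (br (J X) Y) - J (br X (J Y)) - br X Y"

definition invariant_complex_structure ::
    "('a::real_vector \<Rightarrow> 'a \<Rightarrow> 'a) \<Rightarrow> ('a \<Rightarrow> 'a) \<Rightarrow> bool" where
  "invariant_complex_structure br J \<longleftrightarrow>
     linear J \<and> (\<forall>X. J (J X) = - X) \<and> (\<forall>X Y. nijenhuis br J X Y = 0)"

definition inner_product :: "('a::real_vector \<Rightarrow> 'a \<Rightarrow> real) \<Rightarrow> bool" where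
  "inner_product g \<longleftrightarrow> bilinear g \<and> (\<forall>X Y. g X Y = g Y X) \<and> (\<forall>X. X \<noteq> 0 \<longrightarrow> g X X > 0)"

definition compatible :: "('a \<Rightarrow> 'a \<Rightarrow> real) \<Rightarrow> ('a \<Rightarrow> 'a) \<Rightarrow> bool" where
  "compatible g J \<longleftrightarrow> (\<forall>X Y. g (J X) (J Y) = g X Y)"

definition fundamental_form :: "('a \<Rightarrow> 'a \<Rightarrow> real) \<Rightarrow> ('a \<Rightarrow> 'a) \<Rightarrow> 'a list \<Rightarrow> real" where
  "fundamental_form g J Xs = g (J (Xs ! 0)) (Xs ! 1)"

definition J_d_omega ::
    "('a \<Rightarrow> 'a \<Rightarrow> 'a) \<Rightarrow> ('a \<Rightarrow> 'a \<Rightarrow> real) \<Rightarrow> ('a \<Rightarrow> 'a) \<Rightarrow> 'a list \<Rightarrow> real" where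
  "J_d_omega br g J Xs = - ext_d br (fundamental_form g J) (map J Xs)"

definition skt ::
    "('a::real_vector \<Rightarrow> 'a \<Rightarrow> 'a) \<Rightarrow> ('a \<Rightarrow> 'a \<Rightarrow> real) \<Rightarrow> ('a \<Rightarrow> 'a) \<Rightarrow> bool" where
  "skt br g J \<longleftrightarrow> invariant_complex_structure br J \<and> inner_product g \<and> compatible g J \<and>
     (\<forall>X Y Z W. ext_d br (J_d_omega br g J) [X, Y, Z, W] = 0)"


section \<open>Lie algebras given by structure equations\<close>

text \<open>\<open>wedge i j\<close> is the two-form \<open>e\<^sub>i \<and> e\<^sub>j\<close> in the dual of the standard basis.\<close>

definition wedge :: "'n::finite \<Rightarrow> 'n \<Rightarrow> real ^ 'n \<Rightarrow> real ^ 'n \<Rightarrow> real" where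
  "wedge i j X Y = X $ i * Y $ j - X $ j * Y $ i"

text \<open>
  The Lie algebra \<open>(de\<^sub>1, \<dots>, de\<^sub>n)\<close>: the \<open>i\<close>-th entry of \<open>D X Y\<close> is \<open>de\<^sub>i(X,Y) = -e\<^sub>i([X,Y])\<close>, so
  the bracket has components \<open>-de\<^sub>i(X,Y)\<close>. The families below are defined for all real parameters;
  the constraints on the parameters are imposed where the algebras are used.
\<close>

definition lie_of_eqs ::
    "((real,'n::{finite,one,plus}) vec \<Rightarrow> (real,'n) vec \<Rightarrow> real list) \<Rightarrow>
      (real,'n) vec \<Rightarrow> (real,'n) vec \<Rightarrow> (real,'n) vec" where
  "lie_of_eqs D X Y = vector (map uminus (D X Y))"

definition r3 :: "real \<Rightarrow> real ^ 3 \<Rightarrow> real ^ 3 \<Rightarrow> real ^ 3" where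
  "r3 l = lie_of_eqs (\<lambda>X Y. [0, wedge 2 1 X Y, l * wedge 3 1 X Y])"

definition r3' :: "real \<Rightarrow> real ^ 3 \<Rightarrow> real ^ 3 \<Rightarrow> real ^ 3" where
  "r3' l = lie_of_eqs (\<lambda>X Y.
     [0, l * wedge 2 1 X Y + wedge 3 1 X Y, - wedge 2 1 X Y + l * wedge 3 1 X Y])"

definition aff_C :: "real ^ 4 \<Rightarrow> real ^ 4 \<Rightarrow> real ^ 4" where
  "aff_C = lie_of_eqs (\<lambda>X Y.
     [0, 0, wedge 3 1 X Y - wedge 4 2 X Y, wedge 4 1 X Y + wedge 3 2 X Y])"

definition r4 :: "real \<Rightarrow> real ^ 4 \<Rightarrow> real ^ 4 \<Rightarrow> real ^ 4" where
  "r4 l = lie_of_eqs (\<lambda>X Y.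
     [0, wedge 2 1 X Y, l * wedge 3 1 X Y + wedge 4 1 X Y, l * wedge 4 1 X Y])"

definition r4_diag :: "real \<Rightarrow> real \<Rightarrow> real ^ 4 \<Rightarrow> real ^ 4 \<Rightarrow> real ^ 4" where
  "r4_diag m l = lie_of_eqs (\<lambda>X Y.
     [0, wedge 2 1 X Y, m * wedge 3 1 X Y, l * wedge 4 1 X Y])"

definition r4_diag_params :: "real \<Rightarrow> real \<Rightarrow> bool" where
  "r4_diag_params m l \<longleftrightarrow> m \<in> {-1..1} \<and> l \<in> {-1..1} \<and> l \<ge> m \<and> m \<noteq> 0 \<and> l \<noteq> 0 \<and>
     (m = -1 \<longrightarrow> l < 0)"

definition r4' :: "real \<Rightarrow> real \<Rightarrow> real ^ 4 \<Rightarrow> real ^ 4 \<Rightarrow> real ^ 4" where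
  "r4' m l = lie_of_eqs (\<lambda>X Y.
     [0, m * wedge 2 1 X Y, l * wedge 3 1 X Y + wedge 4 1 X Y,
      - wedge 3 1 X Y + l * wedge 4 1 X Y])"

definition d4 :: "real \<Rightarrow> real ^ 4 \<Rightarrow> real ^ 4 \<Rightarrow> real ^ 4" where
  "d4 l = lie_of_eqs (\<lambda>X Y.
     [0, l * wedge 2 1 X Y, (1 - l) * wedge 3 1 X Y, wedge 4 1 X Y + wedge 3 2 X Y])"

definition h4 :: "real ^ 4 \<Rightarrow> real ^ 4 \<Rightarrow> real ^ 4" where
  "h4 = lie_of_eqs (\<lambda>X Y.
     [0, wedge 2 1 X Y + wedge 3 1 X Y, wedge 3 1 X Y, 2 * wedge 4 1 X Y + wedge 3 2 X Y])"

end

theory Submission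
  imports Defs
begin

text \<open>
  A solvable four-dimensional algebra either has an abelian ideal \<open>V\<close> of codimension one, or is
  \<open>\<real>\<^sup>2 \<ltimes> \<real>\<^sup>2\<close> with the identity among the acting operators, or is an extension \<open>\<real> \<ltimes> \<hh>\<^sub>3\<close> of the
  Heisenberg algebra. Given \<open>J\<close>, put \<open>U = V \<inter> J V\<close> (with \<open>V = \<hh>\<^sub>3\<close> in the last case), choose
  \<open>x \<in> V\<close> outside \<open>U\<close> and \<open>0 \<noteq> u \<in> U\<close>; then \<open>(x, J x, u, J u)\<close> is a basis. Since
  \<open>d(J d\<omega>)\<close> is a four-form, the SKT condition is the vanishing of its value on this single basis, and
  this value does not change when multiples of \<open>u\<close> and \<open>J u\<close> are added to \<open>x\<close>, so no orthogonality
  has to be arranged. If \<open>V\<close> is abelian, integrability says that \<open>ad (J x)\<close> acts on \<open>U\<close> as a complex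
  number \<open>p + q i\<close>, and the value is \<open>2 p |u|\<^sup>2\<close> times the trace of \<open>ad (J x)\<close> on \<open>V\<close>. If \<open>V = \<hh>\<^sub>3\<close> has
  its centre inside \<open>U\<close>, one eigenvalue \<open>\<alpha>\<close> of \<open>ad (J x)\<close> on \<open>V\<close> modulo the centre belongs to \<open>J z\<close>,
  \<open>z\<close> being central, and the value is proportional to \<open>(\<alpha> + \<beta>) (2 \<alpha> + \<beta>)\<close>, where \<open>\<beta>\<close> is the other
  eigenvalue; if the centre is not in \<open>U\<close>, the action modulo the centre is complex linear.
\<close>

section \<open>Bases of four-dimensional spaces\<close>

text \<open>Existence is settled on one convenient basis, but non-existence has to defeat every
  \<open>J\<close>, so what is read off a basis adapted to \<open>J\<close> must be tied to the
  algebra alone. With an abelian ideal, \<open>p\<close> and \<open>r\<close> depend only on the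
  ideal and the scale of \<open>e\<close>, although the plane \<open>U\<close> may move with
  \<open>J\<close>. With a Heisenberg ideal either eigenvalue may be the one belonging to
  \<open>J z\<close>; there only a condition on the matrix of the action modulo the centre is
  extracted.

  \<open>aff_C\<close> fits neither scheme. Its plane ideal \<open>W\<close> replaces the
  hyperplane: either \<open>J\<close> maps some nonzero vector of \<open>W\<close> into
  \<open>W\<close>, or \<open>J W\<close> is a complement of \<open>W\<close>. In both cases the
  value of the four-form on a suitable basis is strictly positive.

  Isomorphisms are not built one by one: an algebra is recorded as a table of coefficients on a
  basis, and equal tables give isomorphic algebras. The excluded parameters -1/2,
  \<open>- m / 2\<close> and 2 are zeros of \<open>p (2 p + r)\<close> and of
  \<open>(\<alpha> + \<beta>) (2 \<alpha> + \<beta>)\<close>, whereas 1/2 for \<open>d4\<close>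
  comes from a complex linear action modulo the centre.\<close>

definition lc :: "'a::real_vector \<Rightarrow> 'a \<Rightarrow> 'a \<Rightarrow> 'a \<Rightarrow> real \<times> real \<times> real \<times> real \<Rightarrow> 'a" where
  "lc a b c d = (\<lambda>(p, q, r, s). p *\<^sub>R a + q *\<^sub>R b + r *\<^sub>R c + s *\<^sub>R d)"

lemma lc_simp: "lc a b c d (p, q, r, s) = p *\<^sub>R a + q *\<^sub>R b + r *\<^sub>R c + s *\<^sub>R d"
  by (simp add: lc_def)

text \<open>Unique expansion is required of four vectors in a fixed order, so repetitions are
  excluded without a separate distinctness condition.\<close>

definition basis4 :: "'a::real_vector \<Rightarrow> 'a \<Rightarrow> 'a \<Rightarrow> 'a \<Rightarrow> bool" where
  "basis4 a b c d \<longleftrightarrow>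
     (\<forall>p q r s. p *\<^sub>R a + q *\<^sub>R b + r *\<^sub>R c + s *\<^sub>R d = 0 \<longrightarrow> p = 0 \<and> q = 0 \<and> r = 0 \<and> s = 0) \<and>
     (\<forall>x. \<exists>p q r s. x = p *\<^sub>R a + q *\<^sub>R b + r *\<^sub>R c + s *\<^sub>R d)"

lemma basis4_zeroD:
  assumes "basis4 a b c d" "p *\<^sub>R a + q *\<^sub>R b + r *\<^sub>R c + s *\<^sub>R d = 0"
  shows "p = 0" "q = 0" "r = 0" "s = 0"
  using assms unfolding basis4_def by blast+

lemma basis4_eqD:
  assumes "basis4 a b c d"
    "p *\<^sub>R a + q *\<^sub>R b + r *\<^sub>R c + s *\<^sub>R d = p' *\<^sub>R a + q' *\<^sub>R b + r' *\<^sub>R c + s' *\<^sub>R d"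
  shows "p = p'" "q = q'" "r = r'" "s = s'"
proof -
  have "(p - p') *\<^sub>R a + (q - q') *\<^sub>R b + (r - r') *\<^sub>R c + (s - s') *\<^sub>R d = 0"
    using assms(2) by (simp add: algebra_simps)
  from basis4_zeroD[OF assms(1) this] show "p = p'" "q = q'" "r = r'" "s = s'" by auto
qed

lemma basis4_obtain:
  assumes "basis4 a b c d"
  obtains p q r s where "x = p *\<^sub>R a + q *\<^sub>R b + r *\<^sub>R c + s *\<^sub>R d"
  using assms unfolding basis4_def by blast

lemma basis4_coords:
  assumes B: "basis4 a b c d"
  obtains k1 k2 k3 k4 :: "'a::real_vector \<Rightarrow> real" where
    "linear k1" "linear k2" "linear k3" "linear k4"
    "\<And>x. x = k1 x *\<^sub>R a + k2 x *\<^sub>R b + k3 x *\<^sub>R c + k4 x *\<^sub>R d"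
    "k1 a = 1" "k1 b = 0" "k1 c = 0" "k1 d = 0"
    "k2 a = 0" "k2 b = 1" "k2 c = 0" "k2 d = 0"
    "k3 a = 0" "k3 b = 0" "k3 c = 1" "k3 d = 0"
    "k4 a = 0" "k4 b = 0" "k4 c = 0" "k4 d = 1"
proof -
  have "\<exists>f. \<forall>x. x = lc a b c d (f x)"
    by (rule choice) (metis B basis4_obtain lc_simp)
  then obtain f where f: "\<And>x. x = lc a b c d (f x)" by blast
  define k1 where "k1 x = fst (f x)" for x
  define k2 where "k2 x = fst (snd (f x))" for x
  define k3 where "k3 x = fst (snd (snd (f x)))" for x
  define k4 where "k4 x = snd (snd (snd (f x)))" for x
  have x: "x = k1 x *\<^sub>R a + k2 x *\<^sub>R b + k3 x *\<^sub>R c + k4 x *\<^sub>R d" for x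
    using f[of x] by (simp add: lc_def k1_def k2_def k3_def k4_def split_def)
  have u: "k1 x = p \<and> k2 x = q \<and> k3 x = r \<and> k4 x = s"
    if "x = p *\<^sub>R a + q *\<^sub>R b + r *\<^sub>R c + s *\<^sub>R d" for x p q r s
    using basis4_eqD[OF B] x[of x] that by metis
  have add: "k1 (x + y) = k1 x + k1 y \<and> k2 (x + y) = k2 x + k2 y \<and>
      k3 (x + y) = k3 x + k3 y \<and> k4 (x + y) = k4 x + k4 y" for x y
    by (rule u, subst (1) x[of x], subst (1) x[of y]) (simp add: algebra_simps)
  have scale: "k1 (t *\<^sub>R x) = t * k1 x \<and> k2 (t *\<^sub>R x) = t * k2 x \<and>
      k3 (t *\<^sub>R x) = t * k3 x \<and> k4 (t *\<^sub>R x) = t * k4 x" for t x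
    by (rule u, subst (1) x[of x]) (simp add: algebra_simps)
  have lin: "linear k1" "linear k2" "linear k3" "linear k4"
    using add scale by (auto intro!: linearI)
  show thesis
    using that[OF lin x] u[of a 1 0 0 0] u[of b 0 1 0 0] u[of c 0 0 1 0] u[of d 0 0 0 1] by simp
qed

lemma linear_lc:
  assumes "linear k1" "linear k2" "linear k3" "linear k4"
  shows "linear (\<lambda>x. k1 x *\<^sub>R a + k2 x *\<^sub>R b + k3 x *\<^sub>R c + k4 x *\<^sub>R d)"
  by (rule linearI)
    (simp_all add: linear_add[OF assms(1)] linear_add[OF assms(2)] linear_add[OF assms(3)]
      linear_add[OF assms(4)] linear_scale[OF assms(1)] linear_scale[OF assms(2)]
      linear_scale[OF assms(3)] linear_scale[OF assms(4)] algebra_simps)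

lemma span_pair_iff: "x \<in> span {a, b} \<longleftrightarrow> (\<exists>p q. x = p *\<^sub>R a + q *\<^sub>R b)"
  by (auto simp: span_breakdown_eq diff_diff_eq)

lemma span_triple_iff: "x \<in> span {a, b, c} \<longleftrightarrow> (\<exists>p q r. x = p *\<^sub>R a + q *\<^sub>R b + r *\<^sub>R c)"
  by (auto simp: span_breakdown_eq diff_diff_eq add.assoc)

lemma span_quadruple_iff:
  "x \<in> span {a, b, c, d} \<longleftrightarrow> (\<exists>p q r s. x = p *\<^sub>R a + q *\<^sub>R b + r *\<^sub>R c + s *\<^sub>R d)"
  by (auto simp: span_breakdown_eq diff_diff_eq add.assoc)

lemma indep4_distinct:
  assumes "\<And>p q r s. p *\<^sub>R a + q *\<^sub>R b + r *\<^sub>R c + s *\<^sub>R d = 0 \<Longrightarrow>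
    p = 0 \<and> q = 0 \<and> r = 0 \<and> s = (0::real)"
  shows "distinct [a, b, c, d]" "independent {a, b, c, d}"
proof -
  show D: "distinct [a, b, c, d]"
    using assms[of 1 "-1" 0 0] assms[of 1 0 "-1" 0] assms[of 1 0 0 "-1"]
      assms[of 0 1 "-1" 0] assms[of 0 1 0 "-1"] assms[of 0 0 1 "-1"] by auto
  show "independent {a, b, c, d}"
  proof (rule independent_if_scalars_zero)
    fix f x
    assume "(\<Sum>x\<in>{a, b, c, d}. f x *\<^sub>R x) = 0" and x: "x \<in> {a, b, c, d}"
    with D have "f a *\<^sub>R a + f b *\<^sub>R b + f c *\<^sub>R c + f d *\<^sub>R d = 0"
      by (simp add: add.assoc)
    from assms[OF this] x show "f x = 0" by auto
  qed simp
qed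

lemma basis4_distinct:
  assumes "basis4 (a::'a::real_vector) b c d"
  shows "distinct [a, b, c, d]" "independent {a, b, c, d}"
  using basis4_zeroD[OF assms] indep4_distinct[of a b c d] by blast+

lemma basis4_dim:
  assumes "basis4 (a::'a::real_vector) b c d"
  shows "dim (UNIV :: 'a set) = 4"
proof -
  note i = basis4_distinct[OF assms]
  have "x \<in> span {a, b, c, d}" for x
    using assms unfolding span_quadruple_iff basis4_def by blast
  then have "dim (UNIV :: 'a set) = card {a, b, c, d}"
    using i(2) by (intro dim_unique) auto
  with i(1) show ?thesis by simp
qed

lemma basis4I_dim:
  assumes dim: "dim (UNIV :: 'a::real_vector set) = 4"
    and ind: "\<And>p q r s. p *\<^sub>R a + q *\<^sub>R b + r *\<^sub>R c + s *\<^sub>R (d::'a) = 0 \<Longrightarrow>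
    p = 0 \<and> q = 0 \<and> r = 0 \<and> s = 0"
  shows "basis4 a b c d"
proof -
  note i = indep4_distinct[of a b c d, OF ind]
  obtain B where B: "{a, b, c, d} \<subseteq> B" "independent B" "UNIV \<subseteq> span B"
    by (rule maximal_independent_subset_extend[OF subset_UNIV i(2)])
  have "card B = 4" using dim_unique[of B UNIV] B dim by auto
  \<comment> \<open>Infinite sets have cardinality 0, so dimension 4 also makes the basis
    finite.\<close>
  then have "finite B" by (simp add: card_ge_0_finite)
  then have "B = {a, b, c, d}"
    using card_subset_eq[OF \<open>finite B\<close> B(1)] i(1) \<open>card B = 4\<close> by simp
  with B(3) have "x \<in> span {a, b, c, d}" for x by auto
  then show ?thesis unfolding basis4_def span_quadruple_iff using ind by blast
qed

lemma basis4_perm: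
  assumes "basis4 a b c d"
  shows "basis4 b a c d" "basis4 a c b d" "basis4 a b d c"
proof -
  have dim: "dim (UNIV :: 'a set) = 4" using assms by (rule basis4_dim)
  show "basis4 b a c d"
  proof (rule basis4I_dim[OF dim])
    fix p q r s assume "p *\<^sub>R b + q *\<^sub>R a + r *\<^sub>R c + s *\<^sub>R d = 0"
    then have "q *\<^sub>R a + p *\<^sub>R b + r *\<^sub>R c + s *\<^sub>R d = 0" by (simp add: algebra_simps)
    from basis4_zeroD[OF assms this] show "p = 0 \<and> q = 0 \<and> r = 0 \<and> s = 0" by simp
  qed
  show "basis4 a c b d"
  proof (rule basis4I_dim[OF dim])
    fix p q r s assume "p *\<^sub>R a + q *\<^sub>R c + r *\<^sub>R b + s *\<^sub>R d = 0"
    then have "p *\<^sub>R a + r *\<^sub>R b + q *\<^sub>R c + s *\<^sub>R d = 0" by (simp add: algebra_simps)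
    from basis4_zeroD[OF assms this] show "p = 0 \<and> q = 0 \<and> r = 0 \<and> s = 0" by simp
  qed
  show "basis4 a b d c"
  proof (rule basis4I_dim[OF dim])
    fix p q r s assume "p *\<^sub>R a + q *\<^sub>R b + r *\<^sub>R d + s *\<^sub>R c = 0"
    then have "p *\<^sub>R a + q *\<^sub>R b + s *\<^sub>R c + r *\<^sub>R d = 0" by (simp add: algebra_simps)
    from basis4_zeroD[OF assms this] show "p = 0 \<and> q = 0 \<and> r = 0 \<and> s = 0" by simp
  qed
qed

text \<open>A block triangular change of basis is invertible as soon as its two diagonal blocks are,
  whatever \<open>p\<close>, \<open>q\<close>, \<open>r\<close>, \<open>s\<close>. This covers the
  rescalings, rotations and shears that lead to normal forms.\<close>

lemma basis4_block:
  assumes B: "basis4 a b c d" and nz: "k * n - l * m \<noteq> 0" "k' * n' - l' * m' \<noteq> (0::real)"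
  shows "basis4 (k *\<^sub>R a + l *\<^sub>R b + p *\<^sub>R c + q *\<^sub>R d) (m *\<^sub>R a + n *\<^sub>R b + r *\<^sub>R c + s *\<^sub>R d)
    (k' *\<^sub>R c + l' *\<^sub>R d) (m' *\<^sub>R c + n' *\<^sub>R d)"
proof (rule basis4I_dim)
  show "dim (UNIV :: 'a set) = 4" using B by (rule basis4_dim)
  have two: "x = 0 \<and> y = 0" if "x * k + y * m = 0" "x * l + y * n = 0" "k * n - l * m \<noteq> 0"
    for x y k l m n :: real
  proof -
    have "x * (k * n - l * m) = (x * k + y * m) * n - (x * l + y * n) * m"
      "y * (k * n - l * m) = (x * l + y * n) * k - (x * k + y * m) * l"
      by (simp_all add: algebra_simps)
    then have "x * (k * n - l * m) = 0" "y * (k * n - l * m) = 0" unfolding that(1,2) by simp_all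
    then show ?thesis using that(3) by simp
  qed
  fix x y z t :: real
  assume *: "x *\<^sub>R (k *\<^sub>R a + l *\<^sub>R b + p *\<^sub>R c + q *\<^sub>R d) + y *\<^sub>R (m *\<^sub>R a + n *\<^sub>R b + r *\<^sub>R c
    + s *\<^sub>R d)
     + z *\<^sub>R (k' *\<^sub>R c + l' *\<^sub>R d) + t *\<^sub>R (m' *\<^sub>R c + n' *\<^sub>R d) = 0"
  have "(x * k + y * m) *\<^sub>R a + (x * l + y * n) *\<^sub>R b
    + (x * p + y * r + z * k' + t * m') *\<^sub>R c + (x * q + y * s + z * l' + t * n') *\<^sub>R d = 0"
    using * by (simp add: algebra_simps)
  note e = basis4_zeroD[OF B this]
  have "x = 0 \<and> y = 0" using two e(1,2) nz(1) by blast
  moreover from this have "z = 0 \<and> t = 0" using two[of z k' t m' l' n'] e(3,4) nz(2) by simp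
  ultimately show "x = 0 \<and> y = 0 \<and> z = 0 \<and> t = 0" by simp
qed

text \<open>Recording both subspaces as tails of one list turns the dimensions of the derived
  algebras into the numbers \<open>m\<close> and \<open>n\<close>, on which cases can be
  made.\<close>

lemma subspace_flag_basis:
  assumes dim: "dim (UNIV :: 'a::real_vector set) = 4"
    and S: "subspace S" "subspace (T :: 'a set)" "T \<subseteq> S"
  obtains bs m n where "length bs = 4" "basis4 (bs ! 0) (bs ! 1) (bs ! 2) (bs ! 3)"
    "m \<le> n" "n \<le> 4" "S = span (set (drop m bs))" "T = span (set (drop n bs))"
proof -
  obtain B2 where B2: "B2 \<subseteq> T" "independent B2" "T \<subseteq> span B2"
    using maximal_independent_subset[of T] by blast
  obtain B1 where B1: "B2 \<subseteq> B1" "B1 \<subseteq> S" "independent B1" "S \<subseteq> span B1"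
    by (rule maximal_independent_subset_extend[OF order_trans[OF B2(1) S(3)] B2(2)])
  obtain B where B: "B1 \<subseteq> B" "independent B" "UNIV \<subseteq> span B"
    by (rule maximal_independent_subset_extend[OF subset_UNIV B1(3)])
  have card: "card B = 4" using dim_unique[of B UNIV] B dim by auto
  then have fin: "finite B" by (simp add: card_ge_0_finite)
  have fin1: "finite B1" "finite B2" using fin B(1) B1(1) by (auto intro: finite_subset)
  obtain l2 where l2: "set l2 = B2" "distinct l2" using finite_distinct_list[OF fin1(2)] by blast
  obtain l1 where l1: "set l1 = B1 - B2" "distinct l1"
    using finite_distinct_list[OF finite_Diff[OF fin1(1)]] by blast
  obtain l0 where l0: "set l0 = B - B1" "distinct l0"
    using finite_distinct_list[OF finite_Diff[OF fin]] by blast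
  define bs where "bs = l0 @ l1 @ l2"
  have set: "set bs = B" using B(1) B1(1) l0 l1 l2 by (auto simp: bs_def)
  have dist: "distinct bs" using B(1) B1(1) l0 l1 l2 by (auto simp: bs_def)
  have len: "length bs = 4" using distinct_card[OF dist] card set by simp
  then obtain a b c d where abcd: "bs = [a, b, c, d]"
    by (auto simp: length_Suc_conv numeral_eq_Suc)
  have "basis4 a b c d"
    unfolding basis4_def
  proof (intro conjI allI impI)
    fix p q r s assume eq: "p *\<^sub>R a + q *\<^sub>R b + r *\<^sub>R c + s *\<^sub>R d = 0"
    define f where "f = (\<lambda>x. if x = a then p else if x = b then q else if x = c then r else s)"
    have "(\<Sum>x\<in>B. f x *\<^sub>R x) = 0"
      using eq dist unfolding set[symmetric] abcd by (auto simp: f_def add.assoc)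
    then have "\<forall>x\<in>B. f x = 0" using B(2) fin unfolding dependent_finite[OF fin] by blast
    then have "f a = 0" "f b = 0" "f c = 0" "f d = 0" using set abcd by auto
    then show "p = 0" "q = 0" "r = 0" "s = 0" using dist abcd by (auto simp: f_def)
  next
    fix x
    show "\<exists>p q r s. x = p *\<^sub>R a + q *\<^sub>R b + r *\<^sub>R c + s *\<^sub>R d"
      using B(3) set abcd unfolding span_quadruple_iff[symmetric] by auto
  qed
  then have bas: "basis4 (bs ! 0) (bs ! 1) (bs ! 2) (bs ! 3)" by (simp add: abcd)
  show thesis
  proof (rule that[of bs "length l0" "length l0 + length l1", OF len bas])
    have "set (drop (length l0) bs) = B1" "set (drop (length l0 + length l1) bs) = B2"
      using B1(1) l1 l2 by (auto simp: bs_def)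
    then show "S = span (set (drop (length l0) bs))"
      "T = span (set (drop (length l0 + length l1) bs))"
      using B1 B2 S span_minimal by (metis subset_antisym)+
    show "length l0 + length l1 \<le> 4" using len by (simp add: bs_def)
  qed simp
qed

section \<open>Lie algebras given by bracket tables\<close>

locale lie_bracket =
  fixes br :: "'a::real_vector \<Rightarrow> 'a \<Rightarrow> 'a"
  assumes lie: "lie_algebra br"
begin

lemma bil: "bilinear br" and self [simp]: "br x x = 0"
  and jacobi: "br x (br y z) + br y (br z x) + br z (br x y) = 0"
  using lie unfolding lie_algebra_def by auto

lemmas lin = bilinear_ladd[OF bil] bilinear_radd[OF bil] bilinear_lmul[OF bil] bilinear_rmul[OF bil]
  bilinear_lneg[OF bil] bilinear_rneg[OF bil] bilinear_lzero[OF bil] bilinear_rzero[OF bil]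
  bilinear_lsub[OF bil] bilinear_rsub[OF bil]

lemma swap: "br x y = - br y x"
proof -
  have "br (x + y) (x + y) = 0" by (rule self)
  then show ?thesis by (simp add: lin add_eq_0_iff2 del: self) (simp add: add_eq_0_iff)
qed

lemma derivation: "br x (br y z) = br (br x y) z + br y (br x z)"
  using jacobi[of x y z] swap[of z "br x y"] swap[of z x] by (simp add: lin algebra_simps)

end

text \<open>The tuples mention neither the vectors nor their type, so a table can be carried from
  one algebra to another and compared by equality.\<close>

definition brackets :: "('a::real_vector \<Rightarrow> 'a \<Rightarrow> 'a) \<Rightarrow> 'a \<Rightarrow> 'a \<Rightarrow> 'a \<Rightarrow> 'a \<Rightarrow>
    real \<times> real \<times> real \<times> real \<Rightarrow> real \<times> real \<times> real \<times> real \<Rightarrow> real \<times> real \<times> real \<times> real \<Rightarrow>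
    real \<times> real \<times> real \<times> real \<Rightarrow> real \<times> real \<times> real \<times> real \<Rightarrow> real \<times> real \<times> real \<times> real \<Rightarrow> bool" where
  "brackets br a b c d ab ac ad bc bd cd \<longleftrightarrow> basis4 a b c d \<and>
     br a b = lc a b c d ab \<and> br a c = lc a b c d ac \<and> br a d = lc a b c d ad \<and>
     br b c = lc a b c d bc \<and> br b d = lc a b c d bd \<and> br c d = lc a b c d cd"

lemma (in lie_bracket) brackets_table:
  assumes "brackets br a b c d ab ac ad bc bd cd"
  shows "br a b = lc a b c d ab" "br a c = lc a b c d ac" "br a d = lc a b c d ad"
    "br b c = lc a b c d bc" "br b d = lc a b c d bd" "br c d = lc a b c d cd"
    "br b a = - lc a b c d ab" "br c a = - lc a b c d ac" "br d a = - lc a b c d ad"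
    "br c b = - lc a b c d bc" "br d b = - lc a b c d bd" "br d c = - lc a b c d cd"
  using assms swap[of b a] swap[of c a] swap[of d a] swap[of c b] swap[of d b] swap[of d c]
  unfolding brackets_def by simp_all

lemma linear_image_lc: "linear f \<Longrightarrow> f (lc a b c d t) = lc (f a) (f b) (f c) (f d) t"
  by (cases t) (simp add: lc_simp linear_add linear_scale)

lemma basis4_image:
  assumes "linear f" "bij f" "basis4 a b c d"
  shows "basis4 (f a) (f b) (f c) (f d)"
proof -
  note l = linear_add[OF assms(1), symmetric] linear_scale[OF assms(1), symmetric]
  have z: "f x = 0 \<longleftrightarrow> x = 0" for x
    using assms(1,2) by (metis bij_is_inj injD linear_0)
  have "\<exists>p q r s. x = f (p *\<^sub>R a + q *\<^sub>R b + r *\<^sub>R c + s *\<^sub>R d)" for x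
    using assms(2,3) unfolding basis4_def by (metis bij_pointE)
  then show ?thesis
    using assms(3) unfolding basis4_def l z by blast
qed

lemma lie_algebra_iso:
  assumes "lie_isomorphic br br'" "lie_algebra br'"
  shows "lie_algebra br"
proof -
  obtain f where f: "linear f" "bij f" "\<And>x y. f (br x y) = br' (f x) (f y)"
    using assms(1) unfolding lie_isomorphic_def by blast
  interpret L: lie_bracket br' by unfold_locales (rule assms)
  have inj: "x = y" if "f x = f y" for x y using f(2) that by (meson bij_is_inj injD)
  note l = linear_add[OF f(1)] linear_scale[OF f(1)] linear_0[OF f(1)] f(3) L.lin
  show ?thesis
    unfolding lie_algebra_def bilinear_def
    by (auto intro!: linearI inj simp: l L.jacobi)
qed

lemma brackets_iso:
  assumes "lie_isomorphic br br'" "brackets br' a b c d ab ac ad bc bd cd"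
  obtains a' b' c' d' where "brackets br a' b' c' d' ab ac ad bc bd cd"
proof -
  obtain f where f: "linear f" "bij f" "\<And>x y. f (br x y) = br' (f x) (f y)"
    using assms(1) unfolding lie_isomorphic_def by blast
  let ?g = "inv f"
  have g: "linear ?g" "bij ?g" 
  proof -
    show "bij ?g" using f(2) by (rule bij_imp_bij_inv)
    have fg: "f (?g x) = x" for x using f(2) by (simp add: bij_is_surj surj_f_inv_f)
    have gf: "?g (f x) = x" for x using f(2) by (simp add: bij_is_inj inv_f_f)
    show "linear ?g"
      by (rule linearI) (metis fg gf linear_add[OF f(1)], metis fg gf linear_scale[OF f(1)])
  qed
  have gb: "br (?g x) (?g y) = ?g (br' x y)" for x y
    using f(2,3) by (metis bij_inv_eq_iff)
  have "brackets br (?g a) (?g b) (?g c) (?g d) ab ac ad bc bd cd"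
    using assms(2) basis4_image[OF g] unfolding brackets_def
    by (simp add: gb linear_image_lc[OF g(1)])
  then show thesis by (rule that)
qed

lemma lie_isomorphic_brackets:
  assumes l: "lie_algebra br" "lie_algebra br'"
    and b: "brackets br a b c d ab ac ad bc bd cd" "brackets br' a' b' c' d' ab ac ad bc bd cd"
  shows "lie_isomorphic br br'"
proof -
  interpret L: lie_bracket br by unfold_locales (rule l)
  interpret L': lie_bracket br' by unfold_locales (rule l)
  have B: "basis4 a b c d" "basis4 a' b' c' d'" using b unfolding brackets_def by auto
  obtain k1 k2 k3 k4 where k: "linear k1" "linear k2" "linear k3" "linear k4"
    "\<And>x. x = k1 x *\<^sub>R a + k2 x *\<^sub>R b + k3 x *\<^sub>R c + k4 x *\<^sub>R d"
    "k1 a = 1" "k1 b = 0" "k1 c = 0" "k1 d = 0"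
    "k2 a = 0" "k2 b = 1" "k2 c = 0" "k2 d = 0"
    "k3 a = 0" "k3 b = 0" "k3 c = 1" "k3 d = 0"
    "k4 a = 0" "k4 b = 0" "k4 c = 0" "k4 d = (1::real)"
    using basis4_coords[OF B(1)] by metis
  define f where "f x = k1 x *\<^sub>R a' + k2 x *\<^sub>R b' + k3 x *\<^sub>R c' + k4 x *\<^sub>R d'" for x
  have f: "linear f" unfolding f_def by (rule linear_lc[OF k(1-4)])
  have fv: "f a = a'" "f b = b'" "f c = c'" "f d = d'" by (simp_all add: f_def k)
  have flc: "f (lc a b c d t) = lc a' b' c' d' t" for t
    by (simp add: linear_image_lc[OF f] fv)
  have "inj f"
    unfolding linear_injective_0[OF f]
  proof (intro allI impI)
    fix x assume "f x = 0"
    from basis4_zeroD[OF B(2) this[unfolded f_def]] show "x = 0" using k(5)[of x] by simp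
  qed
  moreover have "surj f"
    unfolding surj_def
  proof
    fix y
    obtain p q r s where "y = lc a' b' c' d' (p, q, r, s)"
      using basis4_obtain[OF B(2), of y] by (metis lc_simp)
    then have "y = f (lc a b c d (p, q, r, s))" by (simp only: flc)
    then show "\<exists>x. y = f x" ..
  qed
  moreover have "f (br x y) = br' (f x) (f y)" for x y
  proof -
    obtain p q r s where x: "x = p *\<^sub>R a + q *\<^sub>R b + r *\<^sub>R c + s *\<^sub>R d"
      using basis4_obtain[OF B(1)] .
    obtain p' q' r' s' where y: "y = p' *\<^sub>R a + q' *\<^sub>R b + r' *\<^sub>R c + s' *\<^sub>R d"
      using basis4_obtain[OF B(1)] .
    note t = L.brackets_table[OF b(1)] and t' = L'.brackets_table[OF b(2)]
    note fl = linear_add[OF f] linear_scale[OF f] linear_neg[OF f] linear_diff[OF f] linear_0[OF f]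
    show ?thesis
      unfolding x y by (simp add: L.lin L'.lin fl fv t t' flc)
  qed
  ultimately show ?thesis using f unfolding lie_isomorphic_def bij_def by blast
qed

text \<open>The leading zeros put the first derived algebra into the span of \<open>b\<close>,
  \<open>c\<close>, \<open>d\<close> and the second into that of \<open>c\<close>, \<open>d\<close>,
  which commute. All three families of tables below have this shape.\<close>

lemma solvable_brackets:
  assumes l: "lie_algebra br"
    and b: "brackets br a b c d (0, ab) (0, ac) (0, ad) (0, 0, bc) (0, 0, bd) (0, 0, 0, 0)"
  shows "solvable_lie br"
proof -
  interpret L: lie_bracket br by unfold_locales (rule l)
  have B: "basis4 a b c d" using b unfolding brackets_def by auto
  obtain ab1 ab2 ab3 where p1: "ab = (ab1, ab2, ab3)" by (cases ab)
  obtain ac1 ac2 ac3 where p2: "ac = (ac1, ac2, ac3)" by (cases ac)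
  obtain ad1 ad2 ad3 where p3: "ad = (ad1, ad2, ad3)" by (cases ad)
  obtain bc1 bc2 where p4: "bc = (bc1, bc2)" by (cases bc)
  obtain bd1 bd2 where p5: "bd = (bd1, bd2)" by (cases bd)
  note p = p1 p2 p3 p4 p5
  note t = L.brackets_table[OF b[unfolded p], unfolded lc_simp]
  have chain: "derived_series br (Suc k) \<subseteq> span T"
    if "derived_series br k \<subseteq> S" "\<And>x y. x \<in> S \<Longrightarrow> y \<in> S \<Longrightarrow> br x y \<in> span T" for S T k
  proof -
    have "{br x y |x y. x \<in> derived_series br k \<and> y \<in> derived_series br k} \<subseteq> span T"
      using that by blast
    then show ?thesis by (simp add: span_minimal)
  qed
  have 1: "derived_series br (Suc 0) \<subseteq> span {b, c, d}"
  proof (rule chain[of 0 UNIV])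
    fix x y
    obtain p q r s where x: "x = p *\<^sub>R a + q *\<^sub>R b + r *\<^sub>R c + s *\<^sub>R d" using basis4_obtain[OF B] .
    obtain p' q' r' s' where y: "y = p' *\<^sub>R a + q' *\<^sub>R b + r' *\<^sub>R c + s' *\<^sub>R d"
      using basis4_obtain[OF B] .
    show "br x y \<in> span {b, c, d}"
      unfolding x y
      by (simp add: L.lin t span_add span_scale span_neg span_base span_diff span_zero)
  qed simp
  have 2: "derived_series br (Suc (Suc 0)) \<subseteq> span {c, d}"
  proof (rule chain[OF 1])
    fix x y assume "x \<in> span {b, c, d}" "y \<in> span {b, c, d}"
    then obtain q r s q' r' s' where x: "x = q *\<^sub>R b + r *\<^sub>R c + s *\<^sub>R d"
      and y: "y = q' *\<^sub>R b + r' *\<^sub>R c + s' *\<^sub>R d" unfolding span_triple_iff by auto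
    show "br x y \<in> span {c, d}"
      unfolding x y
      by (simp add: L.lin t span_add span_scale span_neg span_base span_diff span_zero)
  qed
  have "derived_series br (Suc (Suc (Suc 0))) \<subseteq> span {}"
  proof (rule chain[OF 2])
    fix x y assume "x \<in> span {c, d}" "y \<in> span {c, d}"
    then obtain r s r' s' where x: "x = r *\<^sub>R c + s *\<^sub>R d"
      and y: "y = r' *\<^sub>R c + s' *\<^sub>R d" unfolding span_pair_iff by auto
    show "br x y \<in> span {}"
      unfolding x y by (simp add: L.lin t span_add span_scale span_neg span_base span_diff
        span_zero)
  qed
  moreover have "0 \<in> derived_series br (Suc (Suc (Suc 0)))" by (simp add: span_zero)
  ultimately have "derived_series br (Suc (Suc (Suc 0))) = {0}"
    unfolding span_empty by blast
  then show ?thesis unfolding solvable_lie_def by blast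
qed

section \<open>Criteria for SKT and complex structures\<close>

text \<open>The arguments are freed from the right to the left by expanding them in the basis;
  alternation kills every term except those already treated.\<close>

lemma alternating4_zero:
  fixes F :: "'a::real_vector \<Rightarrow> 'a \<Rightarrow> 'a \<Rightarrow> 'a \<Rightarrow> real"
  assumes B: "basis4 a b c d"
    and lin: "\<And>y z w. linear (\<lambda>x. F x y z w)" "\<And>x z w. linear (\<lambda>y. F x y z w)"
      "\<And>x y w. linear (\<lambda>z. F x y z w)" "\<And>x y z. linear (\<lambda>w. F x y z w)"
    and alt: "\<And>x z w. F x x z w = 0" "\<And>x y w. F x y y w = 0" "\<And>x y z. F x y z z = 0"
    and zero: "F a b c d = 0"
  shows "F x y z w = 0"
proof -
  have l: "F (x + x') y z w = F x y z w + F x' y z w" "F (t *\<^sub>R x) y z w = t * F x y z w"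
    "F x (y + y') z w = F x y z w + F x y' z w" "F x (t *\<^sub>R y) z w = t * F x y z w"
    "F x y (z + z') w = F x y z w + F x y z' w" "F x y (t *\<^sub>R z) w = t * F x y z w"
    "F x y z (w + w') = F x y z w + F x y z w'" "F x y z (t *\<^sub>R w) = t * F x y z w"
    for x x' y y' z z' w w' t
    using linear_add[OF lin(1)] linear_add[OF lin(2)] linear_add[OF lin(3)] linear_add[OF lin(4)]
      linear_scale[OF lin(1)] linear_scale[OF lin(2)] linear_scale[OF lin(3)]
      linear_scale[OF lin(4)] by simp_all
  have s1: "F x y z w = - F y x z w" for x y z w
    using alt(1)[of "x + y" z w] unfolding l by (simp add: alt)
  have s2: "F x y z w = - F x z y w" for x y z w
    using alt(2)[of x "y + z" w] unfolding l by (simp add: alt)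
  have s3: "F x y z w = - F x y w z" for x y z w
    using alt(3)[of x y "z + w"] unfolding l by (simp add: alt)
  have alt': "F x y x w = 0" "F x y z x = 0" "F x y z y = 0" for x y z w
    using s2[of x y x w] s3[of x y z x] s2[of x y x z] s3[of x y z y]
    by (simp_all add: alt)
  have z1: "F a b c w = 0" for w
  proof -
    obtain p q r s where w: "w = p *\<^sub>R a + q *\<^sub>R b + r *\<^sub>R c + s *\<^sub>R d" using basis4_obtain[OF B] .
    show ?thesis unfolding w by (simp add: l alt alt' zero)
  qed
  have z1': "F a b w c = 0" for w using z1[of w] s3[of a b w c] by simp
  have z2: "F a b z w = 0" for z w
  proof -
    obtain p q r s where z: "z = p *\<^sub>R a + q *\<^sub>R b + r *\<^sub>R c + s *\<^sub>R d" using basis4_obtain[OF B] .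
    obtain p' q' r' s' where w: "w = p' *\<^sub>R a + q' *\<^sub>R b + r' *\<^sub>R c + s' *\<^sub>R d"
      using basis4_obtain[OF B] .
    show ?thesis unfolding z w by (simp add: l alt alt' z1 z1')
  qed
  have z2': "F a z b w = 0" for z w using s2[of a z b w] by (simp add: z2)
  have z2'': "F a z w b = 0" for z w using s3[of a z w b] by (simp add: z2')
  have z3: "F a y z w = 0" for y z w
  proof -
    obtain p q r s where y: "y = p *\<^sub>R a + q *\<^sub>R b + r *\<^sub>R c + s *\<^sub>R d" using basis4_obtain[OF B] .
    obtain p' q' r' s' where z: "z = p' *\<^sub>R a + q' *\<^sub>R b + r' *\<^sub>R c + s' *\<^sub>R d"
      using basis4_obtain[OF B] .
    obtain p'' q'' r'' s'' where w: "w = p'' *\<^sub>R a + q'' *\<^sub>R b + r'' *\<^sub>R c + s'' *\<^sub>R d"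
      using basis4_obtain[OF B] .
    show ?thesis unfolding y z w by (simp add: l alt alt' z2 z2' z2'')
  qed
  have z3': "F x a z w = 0" for x z w using s1[of x a z w] by (simp add: z3)
  have z3'': "F x y a w = 0" for x y w using s2[of x y a w] by (simp add: z3')
  have z3a: "F x y z a = 0" for x y z using s3[of x y z a] by (simp add: z3'')
  obtain p q r s where x: "x = p *\<^sub>R a + q *\<^sub>R b + r *\<^sub>R c + s *\<^sub>R d" using basis4_obtain[OF B] .
  obtain p' q' r' s' where y: "y = p' *\<^sub>R a + q' *\<^sub>R b + r' *\<^sub>R c + s' *\<^sub>R d"
    using basis4_obtain[OF B] .
  obtain p'' q'' r'' s'' where z: "z = p'' *\<^sub>R a + q'' *\<^sub>R b + r'' *\<^sub>R c + s'' *\<^sub>R d"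
    using basis4_obtain[OF B] .
  obtain p3 q3 r3 s3 where w: "w = p3 *\<^sub>R a + q3 *\<^sub>R b + r3 *\<^sub>R c + s3 *\<^sub>R d"
    using basis4_obtain[OF B] .
  show ?thesis unfolding x y z w by (simp add: l alt alt' z3 z3' z3'' z3a)
qed

text \<open>Compatibility cancels the \<open>J\<close> in the fundamental form against the
  \<open>J\<close> on its second argument, so \<open>J\<close> survives only inside the
  brackets.\<close>

lemma J_d_omega_3:
  assumes "compatible g J"
  shows "J_d_omega br g J [A, B, C] =
    g (br (J A) (J B)) C - g (br (J A) (J C)) B + g (br (J B) (J C)) A"
  using assms by (simp add: J_d_omega_def ext_d_2 fundamental_form_def compatible_def)

text \<open>Both structures are recorded by their complete tables on the four vectors, symmetric
  entries included, so that rewriting alone evaluates the Nijenhuis tensor and the four-form on the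
  frame.\<close>

definition unitary_frame ::
    "('a::real_vector \<Rightarrow> 'a \<Rightarrow> real) \<Rightarrow> ('a \<Rightarrow> 'a) \<Rightarrow> 'a \<Rightarrow> 'a \<Rightarrow> 'a \<Rightarrow> 'a \<Rightarrow> bool" where
  "unitary_frame g J x x' y y' \<longleftrightarrow> linear J \<and> bilinear g \<and> compatible g J \<and>
     J x = x' \<and> J x' = - x \<and> J y = y' \<and> J y' = - y \<and>
     g x x = 1 \<and> g x x' = 0 \<and> g x y = 0 \<and> g x y' = 0 \<and>
     g x' x = 0 \<and> g x' x' = 1 \<and> g x' y = 0 \<and> g x' y' = 0 \<and>
     g y x = 0 \<and> g y x' = 0 \<and> g y y = 1 \<and> g y y' = 0 \<and>
     g y' x = 0 \<and> g y' x' = 0 \<and> g y' y = 0 \<and> g y' y' = 1"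

lemma unitary_frame_exists:
  assumes "basis4 x x' y y'"
  obtains g J where "unitary_frame g J x x' y y'" "inner_product g" "\<And>v. J (J v) = - v"
proof -
  obtain k1 k2 k3 k4 where k: "linear k1" "linear k2" "linear k3" "linear k4"
    and e: "\<And>v. v = k1 v *\<^sub>R x + k2 v *\<^sub>R x' + k3 v *\<^sub>R y + k4 v *\<^sub>R y'"
    and t: "k1 x = 1" "k1 x' = 0" "k1 y = 0" "k1 y' = 0"
    "k2 x = 0" "k2 x' = 1" "k2 y = 0" "k2 y' = 0"
    "k3 x = 0" "k3 x' = 0" "k3 y = 1" "k3 y' = 0"
    "k4 x = 0" "k4 x' = 0" "k4 y = 0" "k4 y' = (1::real)"
    using basis4_coords[OF assms] by metis
  note l = linear_add[OF k(1)] linear_add[OF k(2)] linear_add[OF k(3)] linear_add[OF k(4)]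
    linear_scale[OF k(1)] linear_scale[OF k(2)] linear_scale[OF k(3)] linear_scale[OF k(4)]
    linear_neg[OF k(1)] linear_neg[OF k(2)] linear_neg[OF k(3)] linear_neg[OF k(4)]
    linear_diff[OF k(1)] linear_diff[OF k(2)] linear_diff[OF k(3)] linear_diff[OF k(4)]
  define J where "J v = (- k2 v) *\<^sub>R x + k1 v *\<^sub>R x' + (- k4 v) *\<^sub>R y + k3 v *\<^sub>R y'" for v
  define g where "g v w = k1 v * k1 w + k2 v * k2 w + k3 v * k3 w + k4 v * k4 w" for v w
  have J: "linear J"
    by (rule linearI) (simp_all add: J_def l algebra_simps)
  have kJ: "k1 (J v) = - k2 v" "k2 (J v) = k1 v" "k3 (J v) = - k4 v" "k4 (J v) = k3 v" for v
    by (simp_all add: J_def l t)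
  have Jt: "J x = x'" "J x' = - x" "J y = y'" "J y' = - y" by (simp_all add: J_def t)
  have JJ: "J (J v) = - v" for v
    using arg_cong[OF e[of v], of uminus] by (simp add: J_def[of "J v"] kJ)
  have bil: "bilinear g"
    unfolding bilinear_def by (auto intro!: linearI simp: g_def l algebra_simps)
  have "inner_product g"
    unfolding inner_product_def
  proof (intro conjI allI impI)
    fix v :: 'a assume "v \<noteq> 0"
    then have "k1 v \<noteq> 0 \<or> k2 v \<noteq> 0 \<or> k3 v \<noteq> 0 \<or> k4 v \<noteq> 0" using e[of v] by auto
    then have "(k1 v)\<^sup>2 > 0 \<or> (k2 v)\<^sup>2 > 0 \<or> (k3 v)\<^sup>2 > 0 \<or> (k4 v)\<^sup>2 > 0" by simp
    moreover have "(k1 v)\<^sup>2 \<ge> 0" "(k2 v)\<^sup>2 \<ge> 0" "(k3 v)\<^sup>2 \<ge> 0" "(k4 v)\<^sup>2 \<ge> 0" by simp_all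
    ultimately show "g v v > 0" unfolding g_def power2_eq_square by linarith
  qed (simp_all add: bil, simp add: g_def mult.commute)
  moreover have "unitary_frame g J x x' y y'"
    unfolding unitary_frame_def using J bil
    by (simp add: Jt compatible_def g_def kJ t algebra_simps)
  ultimately show thesis using that JJ by blast
qed

context lie_bracket
begin

text \<open>The tensor is antisymmetric and satisfies \<open>N(J X, Y) = - J N(X, Y)\<close>, so on
  such a frame its value at \<open>x\<close>, \<open>y\<close> determines all others.\<close>

lemma nijenhuis_zero_of_frame:
  assumes B: "basis4 x (J x) y (J y)" and J: "linear J" "\<And>v. J (J v) = - v"
    and N: "nijenhuis br J x y = 0"
  shows "nijenhuis br J v w = 0"
proof -
  note Jl = linear_add[OF J(1)] linear_scale[OF J(1)] linear_neg[OF J(1)] linear_diff[OF J(1)]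
  have e: "br (J x) (J y) = J (br (J x) y) + J (br x (J y)) + br x y"
    using N by (simp add: nijenhuis_def algebra_simps)
  have N1: "nijenhuis br J (a + b) c = nijenhuis br J a c + nijenhuis br J b c"
    "nijenhuis br J (t *\<^sub>R a) c = t *\<^sub>R nijenhuis br J a c"
    "nijenhuis br J c (a + b) = nijenhuis br J c a + nijenhuis br J c b"
    "nijenhuis br J c (t *\<^sub>R a) = t *\<^sub>R nijenhuis br J c a" for a b c t
    by (simp_all add: nijenhuis_def lin Jl algebra_simps)
  have Nself: "nijenhuis br J a a = 0" for a
    using swap[of "J a" a] by (simp add: nijenhuis_def Jl)
  have Nswap: "nijenhuis br J a b = - nijenhuis br J b a" for a b
    using swap[of a b] swap[of "J a" b] swap[of a "J b"] swap[of "J a" "J b"]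
    by (simp add: nijenhuis_def Jl)
  have NJ: "nijenhuis br J (J a) b = - J (nijenhuis br J a b)" for a b
    by (simp add: nijenhuis_def Jl J(2) lin)
  have NJ': "nijenhuis br J a (J b) = - J (nijenhuis br J a b)" for a b
    by (simp add: nijenhuis_def Jl J(2) lin)
  have Nyx: "nijenhuis br J y x = 0" using N Nswap[of y x] by simp
  obtain p q r s where v: "v = p *\<^sub>R x + q *\<^sub>R J x + r *\<^sub>R y + s *\<^sub>R J y"
    using basis4_obtain[OF B] .
  obtain p' q' r' s' where w: "w = p' *\<^sub>R x + q' *\<^sub>R J x + r' *\<^sub>R y + s' *\<^sub>R J y"
    using basis4_obtain[OF B] .
  show ?thesis
    unfolding v w by (simp add: N1 NJ NJ' Nself N Nyx linear_0[OF J(1)])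
qed

lemma ddc_zero_of_basis:
  assumes B: "basis4 a b c d" and J: "linear J" and g: "bilinear g" "compatible g J"
    and zero: "ext_d br (J_d_omega br g J) [a, b, c, d] = 0"
  shows "ext_d br (J_d_omega br g J) [x, y, z, w] = 0"
proof -
  note Jl = linear_add[OF J(1)] linear_scale[OF J(1)] linear_neg[OF J(1)] linear_diff[OF J(1)]
    linear_0[OF J(1)]
  note gl = bilinear_ladd[OF g(1)] bilinear_radd[OF g(1)] bilinear_lmul[OF g(1)]
    bilinear_rmul[OF g(1)] bilinear_lneg[OF g(1)] bilinear_rneg[OF g(1)] bilinear_lzero[OF g(1)]
    bilinear_rzero[OF g(1)]
  define \<tau> where "\<tau> A B C = J_d_omega br g J [A, B, C]" for A B C
  have \<tau>: "\<tau> A B C = g (br (J A) (J B)) C - g (br (J A) (J C)) B + g (br (J B) (J C)) A" for A B C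
    unfolding \<tau>_def by (rule J_d_omega_3[OF g(2)])
  have tl: "\<tau> (A + A') B C = \<tau> A B C + \<tau> A' B C" "\<tau> (t *\<^sub>R A) B C = t * \<tau> A B C"
    "\<tau> A (B + B') C = \<tau> A B C + \<tau> A B' C" "\<tau> A (t *\<^sub>R B) C = t * \<tau> A B C"
    "\<tau> A B (C + C') = \<tau> A B C + \<tau> A B C'" "\<tau> A B (t *\<^sub>R C) = t * \<tau> A B C"
    "\<tau> 0 B C = 0" "\<tau> A B B = 0"
    for A A' B B' C C' t
    by (simp_all add: \<tau> Jl gl lin algebra_simps)
  have d: "ext_d br (J_d_omega br g J) [x, y, z, w] = - \<tau> (br x y) z w + \<tau> (br x z) y w
     - \<tau> (br x w) y z - \<tau> (br y z) x w + \<tau> (br y w) x z - \<tau> (br z w) x y" for x y z w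
    unfolding \<tau>_def by (rule ext_d_3)
  show ?thesis
    by (rule alternating4_zero[where F =
      "\<lambda>x y z w. ext_d br (J_d_omega br g J) [x, y, z, w]", OF B])
      (use zero in \<open>auto intro!: linearI simp: d tl lin algebra_simps\<close>)
qed

text \<open>The hypotheses range over every pair with the given frame, so applications compute from
  the tables of \<open>g\<close> and \<open>J\<close> and never see their construction.\<close>

lemma skt_exists:
  assumes B: "basis4 x x' y y'"
    and N: "\<And>g J. unitary_frame g J x x' y y' \<Longrightarrow> nijenhuis br J x y = 0"
    and T: "\<And>g J. unitary_frame g J x x' y y' \<Longrightarrow>
      ext_d br (J_d_omega br g J) [x, x', y, y'] = 0"
  shows "\<exists>g J. skt br g J"
proof -
  obtain g J where f: "unitary_frame g J x x' y y'" and ip: "inner_product g"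
    and JJ: "\<And>v. J (J v) = - v"
    using unitary_frame_exists[OF B] by metis
  note f' = f[unfolded unitary_frame_def]
  have Jv: "J x = x'" "J y = y'" using f' by simp_all
  have "nijenhuis br J v w = 0" for v w
    by (rule nijenhuis_zero_of_frame[of x J y]) (use B Jv JJ f' N[OF f] in simp_all)
  then have "skt br g J"
    unfolding skt_def invariant_complex_structure_def
    using f' ip JJ ddc_zero_of_basis[OF B _ _ _ T[OF f]] by simp
  then show ?thesis by blast
qed

lemma complex_structure_exists:
  assumes B: "basis4 x x' y y'"
    and N: "\<And>g J. unitary_frame g J x x' y y' \<Longrightarrow> nijenhuis br J x y = 0"
  shows "\<exists>J. invariant_complex_structure br J"
proof -
  obtain g J where f: "unitary_frame g J x x' y y'" and ip: "inner_product g"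
    and JJ: "\<And>v. J (J v) = - v"
    using unitary_frame_exists[OF B] by metis
  note f' = f[unfolded unitary_frame_def]
  have Jv: "J x = x'" "J y = y'" using f' by simp_all
  have "nijenhuis br J v w = 0" for v w
    by (rule nijenhuis_zero_of_frame[of x J y]) (use B Jv JJ f' N[OF f] in simp_all)
  then show ?thesis
    unfolding invariant_complex_structure_def using f' JJ by blast
qed

end

section \<open>The families of algebras\<close>

text \<open>Here \<open>ad e\<close> acts on the span of \<open>u\<close>, \<open>v\<close>, with complex structure \<open>u \<mapsto> v\<close>, as \<open>p + q i\<close>.\<close>

definition abelian_ext ::
    "('a::real_vector \<Rightarrow> 'a \<Rightarrow> 'a) \<Rightarrow> 'a \<Rightarrow> 'a \<Rightarrow> 'a \<Rightarrow> 'a \<Rightarrow>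
      real \<Rightarrow> real \<Rightarrow> real \<Rightarrow> real \<Rightarrow> real \<Rightarrow> bool" where
  "abelian_ext br e x u v p q r s t \<longleftrightarrow>
     brackets br e x u v (0, r, s, t) (0, 0, p, q) (0, 0,
       - q, p) (0, 0, 0, 0) (0, 0, 0, 0) (0, 0, 0, 0)"

text \<open>A derivation of the Heisenberg algebra with rows \<open>(a, b)\<close> and
  \<open>(c, d)\<close> on \<open>x\<close>, \<open>y\<close> scales \<open>z = [x, y]\<close> by
  its trace.\<close>

definition heisenberg_ext ::
    "('a::real_vector \<Rightarrow> 'a \<Rightarrow> 'a) \<Rightarrow> 'a \<Rightarrow> 'a \<Rightarrow> 'a \<Rightarrow> 'a \<Rightarrow>
      real \<Rightarrow> real \<Rightarrow> real \<Rightarrow> real \<Rightarrow> bool" where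
  "heisenberg_ext br e x y z a b c d \<longleftrightarrow>
     brackets br e x y z (0, a, b, 0) (0, c, d, 0) (0, 0, 0, a
       + d) (0, 0, 0, 1) (0, 0, 0, 0) (0, 0, 0, 0)"

text \<open>\<open>e'\<close> squares to \<delta> on the plane, so the span of \<open>e\<close>,
  \<open>e'\<close> acts as the commutative algebra R[t]/(t^2 - \<delta>) acts on itself: as R x R,
  C or the dual numbers, according to the sign of \<delta>.\<close>

definition plane_ext ::
    "('a::real_vector \<Rightarrow> 'a \<Rightarrow> 'a) \<Rightarrow> 'a \<Rightarrow> 'a \<Rightarrow> 'a \<Rightarrow> 'a \<Rightarrow> real \<Rightarrow> bool" where
  "plane_ext br e e' w w' \<delta> \<longleftrightarrow>
     brackets br e e' w w' (0, 0, 0, 0) (0, 0, 1, 0) (0, 0, 0, 1) (0, 0, 0, 1) (0, 0, \<delta>, 0) (0, 0,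
       0, 0)"

lemma basis4_axis:
  "basis4 (axis 1 1) (axis 2 1) (axis 3 1) (axis 4 1 :: real ^ 4)"
  by (rule basis4I_dim) (auto simp: vec_eq_iff forall_4 axis_def)

lemma basis4_prod_axis:
  "basis4 (0, axis 1 1) (1 :: real, 0) (0, axis 2 1) (0, axis 3 1 :: real ^ 3)"
  by (rule basis4I_dim) (auto simp: vec_eq_iff forall_3 axis_def prod_eq_iff)

lemma vector_4:
  "(vector [a, b, c, d] :: real ^ 4) $ 1 = a" "(vector [a, b, c, d] :: real ^ 4) $ 2 = b"
  "(vector [a, b, c, d] :: real ^ 4) $ 3 = c" "(vector [a, b, c, d] :: real ^ 4) $ 4 = d"
  unfolding vector_def by simp_all

lemmas coordinate_defs = lie_of_eqs_def wedge_def vec_eq_iff forall_4 forall_3 axis_def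
  aff_C_def r4_def r4_diag_def r4'_def d4_def h4_def r3_def r3'_def lie_prod_def lie_R_def
  prod_eq_iff

lemma lie_algebra_aff_C: "lie_algebra aff_C"
  unfolding lie_algebra_def bilinear_def
  by (auto intro!: linearI simp: coordinate_defs vector_4 algebra_simps)

lemma lie_algebra_r4: "lie_algebra (r4 l)"
  unfolding lie_algebra_def bilinear_def
  by (auto intro!: linearI simp: coordinate_defs vector_4 algebra_simps)

lemma lie_algebra_r4_diag: "lie_algebra (r4_diag m l)"
  unfolding lie_algebra_def bilinear_def
  by (auto intro!: linearI simp: coordinate_defs vector_4 algebra_simps)

lemma lie_algebra_r4': "lie_algebra (r4' m l)"
  unfolding lie_algebra_def bilinear_def
  by (auto intro!: linearI simp: coordinate_defs vector_4 algebra_simps)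

lemma lie_algebra_d4: "lie_algebra (d4 l)"
  unfolding lie_algebra_def bilinear_def
  by (auto intro!: linearI simp: coordinate_defs vector_4 algebra_simps)

lemma lie_algebra_h4: "lie_algebra h4"
  unfolding lie_algebra_def bilinear_def
  by (auto intro!: linearI simp: coordinate_defs vector_4 algebra_simps)

lemma lie_algebra_prod_r3: "lie_algebra (lie_prod lie_R (r3 l))"
  unfolding lie_algebra_def bilinear_def
  by (auto intro!: linearI simp: coordinate_defs vector_3 algebra_simps)

lemma lie_algebra_prod_r3': "lie_algebra (lie_prod lie_R (r3' l))"
  unfolding lie_algebra_def bilinear_def
  by (auto intro!: linearI simp: coordinate_defs vector_3 algebra_simps)

section \<open>Tables of the listed algebras\<close>

lemma plane_ext_aff_C:
  "plane_ext aff_C (axis 1 1) (axis 2 1) (axis 3 1) (axis 4 1) (- 1)"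
  unfolding plane_ext_def brackets_def using basis4_axis
  by (auto simp: lc_simp coordinate_defs vector_4)

text \<open>\<open>x\<close> is the generator of the Jordan block, so its nilpotent part lands in
  the plane, on which \<open>e\<close> acts as the identity.\<close>

lemma abelian_ext_r4: "abelian_ext (r4 1) (axis 1 1) (axis 4 1) (axis 3 1) (axis 2 1) 1 0 1 1 0"
  unfolding abelian_ext_def brackets_def
  using basis4_perm(2)[OF basis4_perm(3)[OF basis4_perm(2)[OF basis4_axis]]]
  by (auto simp: lc_simp coordinate_defs vector_4)

text \<open>The plane carries a complex linear action, so its real eigenvalue is double. For
  \<open>m = l\<close> it is \<open>l\<close>, and \<open>x\<close> has eigenvalue 1; for
  \<open>l = 1\<close> it is 1, and \<open>m\<close> is left for \<open>x\<close>.\<close>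

lemma abelian_ext_r4_diag_eq:
  "abelian_ext (r4_diag l l) (axis 1 1) (axis 2 1) (axis 3 1) (axis 4 1) l 0 1 0 0"
  unfolding abelian_ext_def brackets_def using basis4_axis
  by (auto simp: lc_simp coordinate_defs vector_4)

lemma abelian_ext_r4_diag_1:
  "abelian_ext (r4_diag m 1) (axis 1 1) (axis 3 1) (axis 2 1) (axis 4 1) 1 0 m 0 0"
  unfolding abelian_ext_def brackets_def using basis4_perm(2)[OF basis4_axis]
  by (auto simp: lc_simp coordinate_defs vector_4)

lemma abelian_ext_r4':
  "abelian_ext (r4' m l) (axis 1 1) (axis 2 1) (axis 4 1) (axis 3 1) l 1 m 0 0"
  unfolding abelian_ext_def brackets_def using basis4_perm(3)[OF basis4_axis]
  by (auto simp: lc_simp coordinate_defs vector_4)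

lemma abelian_ext_prod_r3:
  "abelian_ext (lie_prod lie_R (r3 1)) (0, axis 1 1) (1, 0) (0, axis 2 1) (0, axis 3 1) 1 0 0 0 0"
  unfolding abelian_ext_def brackets_def using basis4_prod_axis
  by (auto simp: lc_simp coordinate_defs vector_3)

lemma abelian_ext_prod_r3':
  "abelian_ext (lie_prod lie_R (r3' l)) (0, axis 1 1) (1, 0) (0, axis 3 1) (0, axis 2 1) l 1 0 0 0"
  unfolding abelian_ext_def brackets_def using basis4_perm(3)[OF basis4_prod_axis]
  by (auto simp: lc_simp coordinate_defs vector_3)

lemma heisenberg_ext_d4:
  "heisenberg_ext (d4 l) (axis 1 1) (axis 2 1) (axis 3 1) (axis 4 1) l 0 0 (1 - l)"
  unfolding heisenberg_ext_def brackets_def using basis4_axis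
  by (auto simp: lc_simp coordinate_defs vector_4)

lemma heisenberg_ext_h4:
  "heisenberg_ext h4 (axis 1 1) (axis 2 1) (axis 3 1) (axis 4 1) 1 0 1 1"
  unfolding heisenberg_ext_def brackets_def using basis4_axis
  by (auto simp: lc_simp coordinate_defs vector_4)

context lie_bracket
begin

lemma abelian_ext_table:
  assumes "abelian_ext br e x u v p q r s t"
  shows "br e x = r *\<^sub>R x + s *\<^sub>R u + t *\<^sub>R v" "br e u = p *\<^sub>R u + q *\<^sub>R v"
    "br e v = (- q) *\<^sub>R u + p *\<^sub>R v" "br x u = 0" "br x v = 0" "br u v = 0"
    "br x e = - (r *\<^sub>R x + s *\<^sub>R u + t *\<^sub>R v)" "br u e = - (p *\<^sub>R u + q *\<^sub>R v)"
    "br v e = - ((- q) *\<^sub>R u + p *\<^sub>R v)" "br u x = 0" "br v x = 0" "br v u = 0"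
  using brackets_table[OF assms[unfolded abelian_ext_def]] by (simp_all add: lc_simp)

lemma heisenberg_ext_table:
  assumes "heisenberg_ext br e x y z a b c d"
  shows "br e x = a *\<^sub>R x + b *\<^sub>R y" "br e y = c *\<^sub>R x + d *\<^sub>R y" "br e z = (a + d) *\<^sub>R z"
    "br x y = z" "br x z = 0" "br y z = 0"
    "br x e = - (a *\<^sub>R x + b *\<^sub>R y)" "br y e = - (c *\<^sub>R x + d *\<^sub>R y)" "br z e = - ((a + d) *\<^sub>R z)"
    "br y x = - z" "br z x = 0" "br z y = 0"
  using brackets_table[OF assms[unfolded heisenberg_ext_def]] by (simp_all add: lc_simp)

lemma plane_ext_table:
  assumes "plane_ext br e e' w w' \<delta>"
  shows "br e e' = 0" "br e w = w" "br e w' = w'" "br e' w = w'" "br e' w' = \<delta> *\<^sub>R w" "br w w' = 0"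
    "br e' e = 0" "br w e = - w" "br w' e = - w'" "br w e' = - w'" "br w' e' = - (\<delta> *\<^sub>R w)"
    "br w' w = 0"
  using brackets_table[OF assms[unfolded plane_ext_def]] by (simp_all add: lc_simp)

lemma abelian_ext_basis: "abelian_ext br e x u v p q r s t \<Longrightarrow> basis4 e x u v"
  and heisenberg_ext_basis: "heisenberg_ext br e x y z a b c d \<Longrightarrow> basis4 e x y z"
  and plane_ext_basis: "plane_ext br e e' w w' \<delta> \<Longrightarrow> basis4 e e' w w'"
  by (simp_all add: abelian_ext_def heisenberg_ext_def plane_ext_def brackets_def)

lemma abelian_extI:
  assumes "basis4 e x u v" "br e x = r *\<^sub>R x + s *\<^sub>R u + t *\<^sub>R v" "br e u = p *\<^sub>R u + q *\<^sub>R v"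
    "br e v = (- q) *\<^sub>R u + p *\<^sub>R v" "br x u = 0" "br x v = 0" "br u v = 0"
  shows "abelian_ext br e x u v p q r s t"
  using assms by (simp add: abelian_ext_def brackets_def lc_simp)

lemma heisenberg_extI:
  assumes "basis4 e x y z" "br e x = a *\<^sub>R x + b *\<^sub>R y" "br e y = c *\<^sub>R x + d *\<^sub>R y"
    "br e z = (a + d) *\<^sub>R z" "br x y = z" "br x z = 0" "br y z = 0"
  shows "heisenberg_ext br e x y z a b c d"
  using assms by (simp add: heisenberg_ext_def brackets_def lc_simp)

lemma plane_extI:
  assumes "basis4 e e' w w'" "br e e' = 0" "br e w = w" "br e w' = w'"
    "br e' w = w'" "br e' w' = \<delta> *\<^sub>R w" "br w w' = 0"
  shows "plane_ext br e e' w w' \<delta>"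
  using assms by (simp add: plane_ext_def brackets_def lc_simp)

lemma solvable_abelian_ext: "abelian_ext br e x u v p q r s t \<Longrightarrow> solvable_lie br"
  unfolding abelian_ext_def by (rule solvable_brackets[OF lie])

lemma solvable_heisenberg_ext: "heisenberg_ext br e x y z a b c d \<Longrightarrow> solvable_lie br"
  unfolding heisenberg_ext_def by (rule solvable_brackets[OF lie])

lemma solvable_plane_ext: "plane_ext br e e' w w' \<delta> \<Longrightarrow> solvable_lie br"
  unfolding plane_ext_def by (rule solvable_brackets[OF lie])

section \<open>Normal forms of extensions of an abelian ideal\<close>

lemma abelian_ext_scale:
  assumes A: "abelian_ext br e x u v p q r s t" and k: "k \<noteq> 0"
  shows "abelian_ext br (k *\<^sub>R e) x u v (k * p) (k * q) (k * r) (k * s) (k * t)"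
proof (rule abelian_extI)
  show "basis4 (k *\<^sub>R e) x u v"
    using basis4_block[OF abelian_ext_basis[OF A], of k 1 0 0 1 1 0 0 0 0 0 0] k by simp
qed (simp_all add: lin abelian_ext_table[OF A] algebra_simps)

lemma abelian_ext_conj:
  assumes A: "abelian_ext br e x u v p q r s t"
  shows "abelian_ext br e x u (- v) p (- q) r s (- t)"
proof (rule abelian_extI)
  show "basis4 e x u (- v)"
    using basis4_block[OF abelian_ext_basis[OF A], of 1 1 0 0 1 "-1" 0 0 0 0 0 0] by simp
qed (simp_all add: lin abelian_ext_table[OF A] algebra_simps)

text \<open>Shifting \<open>x\<close> by a vector of the plane changes the plane component of
  \<open>[e, x] - r x\<close> by the action of \<open>p - r + q i\<close>, which is invertible
  here.\<close>

lemma abelian_ext_split: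
  assumes A: "abelian_ext br e x u v p q r s t" and k: "q \<noteq> 0 \<or> p \<noteq> r"
  obtains x' where "abelian_ext br e x' u v p q r 0 0"
proof -
  define N where "N = (p - r)\<^sup>2 + q\<^sup>2"
  have N: "N \<noteq> 0" using k unfolding N_def by (metis eq_iff_diff_eq_0 sum_power2_eq_zero_iff)
  \<comment> \<open>\<alpha> + \<beta> i solves
    \<open>(p - r + q i) (\<alpha> + \<beta> i) = - (s + t i)\<close>, and \<open>N\<close> is the
    squared modulus of the first factor.\<close>
  define \<alpha> where "\<alpha> = - (s * (p - r) + q * t) / N"
  define \<beta> where "\<beta> = (q * s - (p - r) * t) / N"
  have 1: "s + \<alpha> * p - \<beta> * q = r * \<alpha>" "t + \<alpha> * q + \<beta> * p = r * \<beta>"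
    using N by (simp_all add: \<alpha>_def \<beta>_def field_simps) (simp_all add: N_def power2_eq_square
      algebra_simps)
  have "abelian_ext br e (x + \<alpha> *\<^sub>R u + \<beta> *\<^sub>R v) u v p q r 0 0"
  proof (rule abelian_extI)
    show "basis4 e (x + \<alpha> *\<^sub>R u + \<beta> *\<^sub>R v) u v"
      using basis4_block[OF abelian_ext_basis[OF A], of 1 1 0 0 1 1 0 0 0 0 \<alpha> \<beta>] by simp
    have "br e (x + \<alpha> *\<^sub>R u + \<beta> *\<^sub>R v) =
        r *\<^sub>R x + (s + \<alpha> * p - \<beta> * q) *\<^sub>R u + (t + \<alpha> * q + \<beta> * p) *\<^sub>R v"
      by (simp add: lin abelian_ext_table[OF A] algebra_simps)
    then show "br e (x + \<alpha> *\<^sub>R u + \<beta> *\<^sub>R v) = r *\<^sub>R (x + \<alpha> *\<^sub>R u + \<beta> *\<^sub>R v) + 0 *\<^sub>R u + 0 *\<^sub>R v"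
      unfolding 1 by (simp add: algebra_simps)
  qed (simp_all add: lin abelian_ext_table[OF A] algebra_simps)
  then show thesis by (rule that)
qed

lemma abelian_ext_listed:
  assumes A: "abelian_ext br e x u v p q r s t" and ne: "p \<noteq> 0" "2 * p + r \<noteq> 0"
  shows "lie_isomorphic br (lie_prod lie_R (r3 1)) \<or>
          (\<exists>l. l \<ge> 0 \<and> l > 0 \<and> lie_isomorphic br (lie_prod lie_R (r3' l))) \<or>
          lie_isomorphic br (r4 1) \<or>
          (\<exists>m l. r4_diag_params m l \<and> ((m = l \<and> l \<noteq> - (1/2)) \<or> (m \<le> l \<and> l = 1)) \<and>
             lie_isomorphic br (r4_diag m l)) \<or>
          (\<exists>m l. m > 0 \<and> l \<noteq> 0 \<and> l \<noteq> - m / 2 \<and> lie_isomorphic br (r4' m l))"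
proof (cases "q = 0")
  case False
  \<comment> \<open>Negating both \<open>e\<close> and \<open>v\<close> keeps \<open>q = 1\<close>
    and changes the signs of \<open>p\<close> and \<open>r\<close>, which leaves one representative
    in each pair.\<close>
  have *: "\<exists>e' x' u' v' p' r'. abelian_ext br e' x' u' v' p' 1 r' 0 0 \<and> p' \<noteq> 0 \<and> 2 * p' + r' \<noteq> 0 \<and>
    (r' > 0 \<or> r' = 0 \<and> p' > 0)"
  proof -
    obtain x' where A1: "abelian_ext br e x' u v p q r 0 0" using abelian_ext_split[OF A] False
      by blast
    have A2: "abelian_ext br ((1 / q) *\<^sub>R e) x' u v (p / q) 1 (r / q) 0 0"
      using abelian_ext_scale[OF A1, of "1 / q"] False by simp
    have A3: "abelian_ext br ((- 1) *\<^sub>R (1 / q) *\<^sub>R e) x' u (- v) (- (p / q)) 1 (- (r / q)) 0 0"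
      using abelian_ext_conj[OF abelian_ext_scale[OF A2, of "- 1"]] by simp
    have n: "p / q \<noteq> 0" "2 * (p / q) + r / q \<noteq> 0"
      using False ne by (simp_all add: field_simps)
    show ?thesis
    proof (cases "r / q > 0 \<or> r / q = 0 \<and> p / q > 0")
      case True
      with A2 n show ?thesis by blast
    next
      case False
      then have "- (r / q) > 0 \<or> - (r / q) = 0 \<and> - (p / q) > 0" using n(1) by linarith
      moreover have "- (p / q) \<noteq> 0" "2 * (- (p / q)) + - (r / q) \<noteq> 0" using n by linarith+
      ultimately show ?thesis using A3 by blast
    qed
  qed
  then obtain e' x' u' v' p' r' where B: "abelian_ext br e' x' u' v' p' 1 r' 0 0"
    and n: "p' \<noteq> 0" "2 * p' + r' \<noteq> 0" "r' > 0 \<or> r' = 0 \<and> p' > 0" by blast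
  show ?thesis
  proof (cases "r' = 0")
    case True
    with n have "p' > 0" by simp
    moreover have "lie_isomorphic br (lie_prod lie_R (r3' p'))"
      by (rule lie_isomorphic_brackets[OF lie lie_algebra_prod_r3' B[unfolded True abelian_ext_def]
            abelian_ext_prod_r3'[unfolded abelian_ext_def]])
    ultimately show ?thesis by (meson less_imp_le)
  next
    case False
    have "lie_isomorphic br (r4' r' p')"
      by (rule lie_isomorphic_brackets[OF lie lie_algebra_r4' B[unfolded abelian_ext_def]
            abelian_ext_r4'[unfolded abelian_ext_def]])
    moreover have "r' > 0" "p' \<noteq> - r' / 2" using n False by auto
    ultimately show ?thesis using n(1) by blast
  qed
next
  case True
  define r' e' where "r' = r / p" and "e' = (1 / p) *\<^sub>R e"
  have A2: "abelian_ext br e' x u v 1 0 r' (s / p) (t / p)"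
    using abelian_ext_scale[OF A, of "1 / p"] ne True by (simp add: r'_def e'_def)
  have n: "r' \<noteq> - 2" using ne by (auto simp: r'_def field_simps)
  have diag: "lie_isomorphic br (r4_diag l l)" if "abelian_ext br e x u v l 0 1 0 0" for e x u v l
    by (rule lie_isomorphic_brackets[OF lie lie_algebra_r4_diag that[unfolded abelian_ext_def]
            abelian_ext_r4_diag_eq[unfolded abelian_ext_def]])
  have diag1: "lie_isomorphic br (r4_diag m 1)" if "abelian_ext br e x u v 1 0 m 0 0" for e x u v m
    by (rule lie_isomorphic_brackets[OF lie lie_algebra_r4_diag that[unfolded abelian_ext_def]
            abelian_ext_r4_diag_1[unfolded abelian_ext_def]])
  show ?thesis
  proof (cases "r' = 1")
    case False
    then obtain x' where A3: "abelian_ext br e' x' u v 1 0 r' 0 0"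
      using abelian_ext_split[OF A2] by metis
    \<comment> \<open>The eigenvalue of larger modulus is scaled to 1. The value -1 is separate: the
      constraints exclude \<open>m = - 1\<close>, \<open>l = 1\<close>, and reversing
      \<open>e\<close> gives \<open>m = l = - 1\<close> instead.\<close>
    consider "r' = 0" | "r' = - 1" | "r' \<noteq> 0" "- 1 < r'" "r' \<le> 1" | "\<bar>r'\<bar> > 1" by linarith
    then show ?thesis
    proof cases
      case 1
      have "lie_isomorphic br (lie_prod lie_R (r3 1))"
        by (rule lie_isomorphic_brackets[OF lie lie_algebra_prod_r3 A3[unfolded 1 abelian_ext_def]
              abelian_ext_prod_r3[unfolded abelian_ext_def]])
      then show ?thesis by blast
    next
      case 2
      have "lie_isomorphic br (r4_diag (- 1) (- 1))"
        by (rule diag) (use abelian_ext_scale[OF A3, of "- 1"] 2 in simp)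
      moreover have "r4_diag_params (- 1) (- 1)" by (simp add: r4_diag_params_def)
      moreover have "(- 1 :: real) \<noteq> - (1 / 2)" by simp
      ultimately show ?thesis by blast
    next
      case 3
      then have "r4_diag_params r' 1" by (simp add: r4_diag_params_def)
      then show ?thesis using diag1[OF A3] 3 by blast
    next
      case 4
      then have r0: "r' \<noteq> 0" by auto
      have "abelian_ext br ((1 / r') *\<^sub>R e') x' u v (1 / r') 0 1 0 0"
        using abelian_ext_scale[OF A3, of "1 / r'"] r0 by simp
      then have "lie_isomorphic br (r4_diag (1 / r') (1 / r'))" by (rule diag)
      moreover have "r4_diag_params (1 / r') (1 / r')"
      proof -
        have "\<bar>1 / r'\<bar> < 1" using 4 by (simp add: abs_divide divide_less_eq)
        moreover have "1 / r' \<noteq> 0" using r0 by simp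
        ultimately show ?thesis unfolding r4_diag_params_def atLeastAtMost_iff by linarith
      qed
      moreover have "1 / r' \<noteq> - (1 / 2)" using n 4 by (auto simp: field_simps)
      ultimately show ?thesis by blast
    qed
  next
    case one: True
    show ?thesis
    proof (cases "s = 0 \<and> t = 0")
      case True
      have "lie_isomorphic br (r4_diag 1 1)" by (rule diag) (use A2 one True in simp)
      moreover have "r4_diag_params 1 1" by (simp add: r4_diag_params_def)
      ultimately show ?thesis by (metis order_refl)
    next
      case False
      then have "s * s + t * t \<noteq> 0" by (simp add: sum_squares_eq_zero_iff)
      then have nz: "s / p * (s / p) - t / p * (- (t / p)) \<noteq> 0"
        using ne by (simp add: add_divide_distrib[symmetric])
      \<comment> \<open>The plane component of \<open>[e', x]\<close> becomes the new
        \<open>u\<close>; the action on the plane is scalar, so turning \<open>u\<close> and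
        \<open>v\<close> changes nothing else.\<close>
      have "abelian_ext br e' x ((s / p) *\<^sub>R u + (t / p) *\<^sub>R v)
          ((- (t / p)) *\<^sub>R u + (s / p) *\<^sub>R v) 1 0 1 1 0"
      proof (rule abelian_extI)
        show "basis4 e' x ((s / p) *\<^sub>R u + (t / p) *\<^sub>R v)
          ((- (t / p)) *\<^sub>R u + (s / p) *\<^sub>R v)"
          using basis4_block[OF abelian_ext_basis[OF A2], of 1 1 0 0 "s / p" "s / p" "t / p"
              "- (t / p)" 0 0 0 0] nz by simp
      qed (simp_all only: lin abelian_ext_table[OF A2] one, simp_all)
      then have "lie_isomorphic br (r4 1)"
        unfolding abelian_ext_def
        by (rule lie_isomorphic_brackets[OF lie lie_algebra_r4 _ abelian_ext_r4[unfolded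
          abelian_ext_def]])
      then show ?thesis by blast
    qed
  qed
qed

end

section \<open>Algebras with SKT metrics\<close>

lemma unitary_frame_table:
  assumes "unitary_frame g J x x' y y'"
  shows "linear J" "bilinear g" "compatible g J"
    "J x = x'" "J x' = - x" "J y = y'" "J y' = - y"
    "g x x = 1" "g x x' = 0" "g x y = 0" "g x y' = 0"
    "g x' x = 0" "g x' x' = 1" "g x' y = 0" "g x' y' = 0"
    "g y x = 0" "g y x' = 0" "g y y = 1" "g y y' = 0"
    "g y' x = 0" "g y' x' = 0" "g y' y = 0" "g y' y' = 1"
  using assms unfolding unitary_frame_def by simp_all

lemma linear_simps:
  assumes "linear f"
  shows "f (x + y) = f x + f y" "f (x - y) = f x - f y" "f (- x) = - f x"
    "f (c *\<^sub>R x) = c *\<^sub>R f x" "f 0 = 0"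
  using assms by (simp_all add: linear_add linear_diff linear_neg linear_scale linear_0)

lemma bilinear_simps:
  assumes "bilinear g"
  shows "g (x + y) z = g x z + g y z" "g z (x + y) = g z x + g z y"
    "g (x - y) z = g x z - g y z" "g z (x - y) = g z x - g z y"
    "g (- x) z = - g x z" "g z (- x) = - g z x"
    "g (c *\<^sub>R x) z = c *\<^sub>R g x z" "g z (c *\<^sub>R x) = c *\<^sub>R g z x"
    "g 0 z = 0" "g z 0 = 0"
  using assms
  by (simp_all add: bilinear_ladd bilinear_radd bilinear_lsub bilinear_rsub bilinear_lneg
      bilinear_rneg bilinear_lmul bilinear_rmul bilinear_lzero bilinear_rzero)

context lie_bracket
begin

lemma nijenhuis_abelian_frame:
  assumes A: "abelian_ext br e x u v p q r s t" and f: "unitary_frame g J x e u v"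
  shows "nijenhuis br J x u = 0"
  by (simp add: nijenhuis_def abelian_ext_table[OF A] unitary_frame_table[OF f]
      linear_simps[OF unitary_frame_table(1)[OF f]] algebra_simps)

lemma complex_structure_abelian_ext:
  assumes A: "abelian_ext br e x u v p q r s t"
  shows "\<exists>J. invariant_complex_structure br J"
  using basis4_perm(1)[OF abelian_ext_basis[OF A]] nijenhuis_abelian_frame[OF A]
  by (rule complex_structure_exists)

lemma skt_abelian_ext:
  assumes A: "abelian_ext br e x u v p q r s t" and pr: "p = 0 \<or> 2 * p + r = 0"
  shows "\<exists>g J. skt br g J"
  using basis4_perm(1)[OF abelian_ext_basis[OF A]] nijenhuis_abelian_frame[OF A]
proof (rule skt_exists)
  fix g J assume f: "unitary_frame g J x e u v"
  note t = unitary_frame_table[OF f]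
  have "ext_d br (J_d_omega br g J) [x, e, u, v] = 2 * (p * (2 * p + r))"
    by (simp add: t abelian_ext_table[OF A] ext_d_3 J_d_omega_3[OF t(3)] linear_simps[OF t(1)]
      bilinear_simps[OF t(2)] lin
        algebra_simps)
  then show "ext_d br (J_d_omega br g J) [x, e, u, v] = 0" using pr by auto
qed

text \<open>\<open>[y, - x] = z\<close>, so the centre vector stays, while the two eigenvalues of a
  diagonal table are exchanged.\<close>

lemma heisenberg_ext_swap:
  assumes A: "heisenberg_ext br e x y z a b c d"
  shows "heisenberg_ext br e y (- x) z d (- c) (- b) a"
proof (rule heisenberg_extI)
  show "basis4 e y (- x) z"
  proof (rule basis4_perm(2))
    show "basis4 e (- x) y z"
      using basis4_block[OF heisenberg_ext_basis[OF A], of 1 "- 1" 0 0 1 1 0 0 0 0 0 0] by simp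
  qed
qed (simp_all add: lin heisenberg_ext_table[OF A] algebra_simps)

text \<open>The frame is meant for \<open>J y' = e\<close>, \<open>J z = x\<close>. For
  \<open>y' = k y\<close> the Nijenhuis tensor at \<open>y'\<close>, \<open>z\<close> is
  \<open>a - (a + d) + k\<close> times \<open>x\<close>, whence \<open>k = d\<close>.\<close>

lemma heisenberg_frame:
  assumes A: "heisenberg_ext br e x y z a 0 c d" and d: "d \<noteq> 0"
  obtains y' where "basis4 y' e z x"
    "br e y' = (d * c) *\<^sub>R x + d *\<^sub>R y'" "br y' e = - ((d * c) *\<^sub>R x + d *\<^sub>R y')"
    "br y' x = - (d *\<^sub>R z)" "br x y' = d *\<^sub>R z" "br y' z = 0" "br z y' = 0"
    "br e x = a *\<^sub>R x" "br x e = - (a *\<^sub>R x)" "br e z = (a + d) *\<^sub>R z" "br z e = - ((a + d) *\<^sub>R z)"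
    "br x z = 0" "br z x = 0"
proof (rule that[of "d *\<^sub>R y"])
  show "basis4 (d *\<^sub>R y) e z x"
    using basis4_block[OF basis4_perm(3)[OF basis4_perm(1)[OF basis4_perm(2)[OF
      heisenberg_ext_basis[OF A]]]], of d 1 0 0 1 1 0 0 0 0 0 0] d by simp
qed (simp_all add: lin heisenberg_ext_table[OF A] algebra_simps)

lemma complex_structure_heisenberg_ext:
  assumes A: "heisenberg_ext br e x y z a 0 c d" and d: "d \<noteq> 0"
  shows "\<exists>J. invariant_complex_structure br J"
proof -
  obtain y' where B: "basis4 y' e z x"
    and tab: "br e y' = (d * c) *\<^sub>R x + d *\<^sub>R y'" "br y' e = - ((d * c) *\<^sub>R x + d *\<^sub>R y')"
    "br y' x = - (d *\<^sub>R z)" "br x y' = d *\<^sub>R z" "br y' z = 0" "br z y' = 0"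
    "br e x = a *\<^sub>R x" "br x e = - (a *\<^sub>R x)" "br e z = (a + d) *\<^sub>R z" "br z e = - ((a + d) *\<^sub>R z)"
    "br x z = 0" "br z x = 0"
    by (rule heisenberg_frame[OF A d])
  show ?thesis
    using B
  proof (rule complex_structure_exists)
    fix g J assume f: "unitary_frame g J y' e z x"
    note t = unitary_frame_table[OF f]
    show "nijenhuis br J y' z = 0"
      by (simp add: nijenhuis_def t tab linear_simps[OF t(1)] lin algebra_simps)
  qed
qed

lemma skt_heisenberg_ext:
  assumes A: "heisenberg_ext br e x y z a 0 c d" and d: "d \<noteq> 0" "(a + d) * (2 * a + d) = 0"
  shows "\<exists>g J. skt br g J"
proof -
  obtain y' where B: "basis4 y' e z x"
    and tab: "br e y' = (d * c) *\<^sub>R x + d *\<^sub>R y'" "br y' e = - ((d * c) *\<^sub>R x + d *\<^sub>R y')"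
    "br y' x = - (d *\<^sub>R z)" "br x y' = d *\<^sub>R z" "br y' z = 0" "br z y' = 0"
    "br e x = a *\<^sub>R x" "br x e = - (a *\<^sub>R x)" "br e z = (a + d) *\<^sub>R z" "br z e = - ((a + d) *\<^sub>R z)"
    "br x z = 0" "br z x = 0"
    by (rule heisenberg_frame[OF A d(1)])
  show ?thesis
    using B
  proof (rule skt_exists)
    fix g J assume f: "unitary_frame g J y' e z x"
    note t = unitary_frame_table[OF f]
    show "nijenhuis br J y' z = 0"
      by (simp add: nijenhuis_def t tab linear_simps[OF t(1)] lin algebra_simps)
    have "ext_d br (J_d_omega br g J) [y', e, z, x] = 2 * ((a + d) * (2 * a + d))"
      by (simp add: t tab ext_d_3 J_d_omega_3[OF t(3)] linear_simps[OF t(1)]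
          bilinear_simps[OF t(2)] lin algebra_simps)
    then show "ext_d br (J_d_omega br g J) [y', e, z, x] = 0" using d(2) by simp
  qed
qed

text \<open>Modulo the centre \<open>e\<close> acts as the complex number \<open>p + q i\<close>, so
  \<open>J\<close> can rotate the plane of \<open>x\<close>, \<open>y\<close> and pair the centre
  with a multiple of \<open>e\<close>. The algebra \<open>d4 (1/2)\<close> is the case
  \<open>p = 1/2\<close>, \<open>q = 0\<close>.\<close>

lemma skt_heisenberg_ext_rotation:
  assumes A: "heisenberg_ext br e x y z p q (- q) p"
  shows "\<exists>g J. skt br g J"
proof -
  \<comment> \<open>For \<open>p \<noteq> 0\<close> this scaling makes the fundamental form closed.\<close>
  define k where "k = (if p = 0 then 1 else - (1 / (2 * p)))"
  have k: "k \<noteq> 0" "p * (2 * k * p + 1) = 0" by (simp_all add: k_def)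
  have B: "basis4 x y z (k *\<^sub>R e)"
    using basis4_perm(3)[OF basis4_perm(2)[OF basis4_perm(1)[OF
       basis4_block[OF heisenberg_ext_basis[OF A], of k 1 0 0 1 1 0 0 0 0 0 0]]]] k by simp
  have t1: "br (k *\<^sub>R e) x = (k * p) *\<^sub>R x + (k * q) *\<^sub>R y"
    "br (k *\<^sub>R e) y = (- (k * q)) *\<^sub>R x + (k * p) *\<^sub>R y" "br (k *\<^sub>R e) z = (2 * k * p) *\<^sub>R z"
    by (simp_all add: lin heisenberg_ext_table[OF A] algebra_simps)
  define E where "E = k *\<^sub>R e"
  note t1 = t1[folded E_def]
  have t2: "br x E = - ((k * p) *\<^sub>R x + (k * q) *\<^sub>R y)"
    "br y E = - ((- (k * q)) *\<^sub>R x + (k * p) *\<^sub>R y)" "br z E = - ((2 * k * p) *\<^sub>R z)"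
    using swap[of x E] swap[of y E] swap[of z E] t1 by simp_all
  note tab = t1 t2 heisenberg_ext_table(4-6,10-12)[OF A]
  show ?thesis
    using B unfolding E_def[symmetric]
  proof (rule skt_exists)
    fix g J assume f: "unitary_frame g J x y z E"
    note t = unitary_frame_table[OF f]
    show "nijenhuis br J x z = 0"
      by (simp add: nijenhuis_def t tab linear_simps[OF t(1)] lin algebra_simps)
    have "ext_d br (J_d_omega br g J) [x, y, z, E] = 4 * k * (p * (2 * k * p + 1))"
      by (simp add: t tab ext_d_3 J_d_omega_3[OF t(3)] linear_simps[OF t(1)] bilinear_simps[OF
        t(2)] lin
          algebra_simps)
    then show "ext_d br (J_d_omega br g J) [x, y, z, E] = 0" using k by simp
  qed
qed

text \<open>\<open>e + k e'\<close> and \<open>e - k e'\<close> act as twice two complementary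
  idempotents. The algebra is a product of two-dimensional factors, each preserved by
  \<open>J\<close>, so the fundamental form is even closed.\<close>

lemma skt_plane_ext:
  assumes A: "plane_ext br e e' w w' \<delta>" and \<delta>: "\<delta> > 0"
  shows "\<exists>g J. skt br g J"
proof -
  define k where "k = 1 / sqrt \<delta>"
  have k: "k > 0" "\<delta> = 1 / (k * k)" using \<delta> by (simp_all add: k_def)
  define a b c d where "a = e + k *\<^sub>R e'" and "b = w + k *\<^sub>R w'"
    and "c = e + (- k) *\<^sub>R e'" and "d = w + (- k) *\<^sub>R w'"
  note defs = a_def b_def c_def d_def
  have B: "basis4 a b c d"
    using basis4_perm(2)[OF basis4_block[OF plane_ext_basis[OF A],
      of 1 "- k" k 1 1 "- k" k 1 0 0 0 0]] k by (simp add: defs)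
  have kk: "(2 * k) *\<^sub>R w' = k *\<^sub>R w' + k *\<^sub>R w'" by (metis mult_2 scaleR_left_distrib)
  have tab: "br a b = 2 *\<^sub>R b" "br c d = 2 *\<^sub>R d" "br a c = 0" "br a d = 0" "br b c = 0"
    "br b d = 0"
    unfolding defs using k by (simp_all add: plane_ext_table[OF A] lin scaleR_2 kk
      scaleR_right_distrib
        scaleR_right_diff_distrib)
  have tab': "br b a = - (2 *\<^sub>R b)" "br d c = - (2 *\<^sub>R d)" "br c a = 0" "br d a = 0" "br c b = 0"
    "br d b = 0"
    using tab swap[of b a] swap[of d c] swap[of c a] swap[of d a] swap[of c b] swap[of d b]
    by simp_all
  show ?thesis
    using B
  proof (rule skt_exists)
    fix g J assume f: "unitary_frame g J a b c d"
    note t = unitary_frame_table[OF f]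
    show "nijenhuis br J a c = 0"
      by (simp add: nijenhuis_def t tab tab' linear_simps[OF t(1)] lin algebra_simps)
    show "ext_d br (J_d_omega br g J) [a, b, c, d] = 0"
      by (simp add: t tab tab' ext_d_3 J_d_omega_3[OF t(3)] linear_simps[OF t(1)]
          bilinear_simps[OF t(2)] lin algebra_simps)
  qed
qed


section \<open>Structure of solvable algebras\<close>

text \<open>The ideal is the kernel of \<epsilon>. The quotient by an ideal of codimension one is
  abelian, so \<epsilon> kills all brackets. With a functional, membership of \<open>J v\<close> in
  the ideal is the linear equation \<open>\<epsilon> (J v) = 0\<close>.\<close>

definition abelian_ideal :: "('a \<Rightarrow> real) \<Rightarrow> bool" where
  "abelian_ideal \<epsilon> \<longleftrightarrow> linear \<epsilon> \<and> (\<exists>x. \<epsilon> x \<noteq> 0) \<and> (\<forall>x y. \<epsilon> (br x y) = 0) \<and>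
     (\<forall>x y. \<epsilon> x = 0 \<longrightarrow> \<epsilon> y = 0 \<longrightarrow> br x y = 0)"

lemma derived_series_ideal:
  "x \<in> derived_series br k \<Longrightarrow> br y x \<in> derived_series br k"
proof (induction k arbitrary: x y)
  case (Suc k)
  let ?B = "{br x y |x y. x \<in> derived_series br k \<and> y \<in> derived_series br k}"
  have x: "x \<in> span ?B" using Suc.prems by simp
  have "br y x \<in> span ?B"
    using x
  proof (induction rule: span_induct_alt)
    case base
    show ?case by (simp add: lin span_zero)
  next
    case (step c b x)
    then obtain u v where b: "b = br u v" and uv: "u \<in> derived_series br k"
      "v \<in> derived_series br k"
      by blast
    have "br (br y u) v \<in> span ?B" "br u (br y v) \<in> span ?B"
      using Suc.IH uv by (blast intro: span_base)+
    then have "br y b \<in> span ?B" unfolding b derivation[of y u v] by (rule span_add)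
    then show ?case using step by (simp add: lin span_add span_scale)
  qed
  then show ?case by simp
qed simp

lemma derived_algebra_induct:
  assumes "linear f" "\<And>x y. f (br x y) = 0" "v \<in> derived_series br 1"
  shows "f v = 0"
proof -
  have "v \<in> span {br x y |x y. True}" using assms(3) by simp
  then show ?thesis
    by (induction rule: span_induct_alt)
      (use assms(1,2) in \<open>auto simp: linear_0 linear_add linear_scale\<close>)
qed

lemma second_derived_algebra_induct:
  assumes "linear f" "\<And>x y. x \<in> derived_series br 1 \<Longrightarrow> y \<in> derived_series br 1 \<Longrightarrow> f (br x y) = 0"
    "v \<in> derived_series br 2"
  shows "f v = 0"
proof -
  have "v \<in> span {br x y |x y. x \<in> derived_series br 1 \<and> y \<in> derived_series br 1}"
    using assms(3) by (simp add: numeral_2_eq_2)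
  then show ?thesis
    by (induction rule: span_induct_alt)
      (use assms(1,2) in \<open>auto simp: linear_0 linear_add linear_scale\<close>)
qed

text \<open>The scalars by which elements act on the line commute.\<close>

lemma derived_centralizes_line:
  assumes "\<And>x. br x z \<in> span {z}" "v \<in> derived_series br 1"
  shows "br v z = 0"
proof (rule derived_algebra_induct[OF _ _ assms(2)])
  show "linear (\<lambda>v. br v z)" by (rule linearI) (simp_all add: lin)
  fix x y
  obtain a b where "br x z = a *\<^sub>R z" "br y z = b *\<^sub>R z"
    using assms(1)[of x] assms(1)[of y] unfolding span_singleton by blast
  then show "br (br x y) z = 0"
    using derivation[of x y z] by (simp add: lin mult.commute)
qed

text \<open>This stands in for nilpotency of the derived algebra. Every operator scales
  \<open>z = [w1, w2]\<close> by its trace on the plane, so the derived algebra annihilates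
  \<open>z\<close>. But \<open>z\<close> is a combination of \<open>w1\<close> and \<open>w2\<close>
  whose coefficients are, up to sign, the scalars by which \<open>w2\<close> and \<open>w1\<close>
  act on \<open>z\<close>.\<close>

lemma plane_ideal_abelian:
  assumes w: "w1 \<in> derived_series br 1" "w2 \<in> derived_series br 1"
    and i: "\<And>x. br x w1 \<in> span {w1, w2}" "\<And>x. br x w2 \<in> span {w1, w2}"
  shows "br w1 w2 = 0"
proof (rule ccontr)
  define z where "z = br w1 w2"
  assume "br w1 w2 \<noteq> 0"
  then have z0: "z \<noteq> 0" by (simp add: z_def)
  have sw: "br w2 w1 = - z" using swap[of w2 w1] by (simp add: z_def)
  have "br x z \<in> span {z}" for x
  proof -
    obtain p q where 1: "br x w1 = p *\<^sub>R w1 + q *\<^sub>R w2" using i(1)[of x] unfolding span_pair_iff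
      by blast
    obtain r s where 2: "br x w2 = r *\<^sub>R w1 + s *\<^sub>R w2" using i(2)[of x] unfolding span_pair_iff
      by blast
    have "br x z = (p + s) *\<^sub>R z"
      using derivation[of x w1 w2] unfolding 1 2 by (simp add: lin z_def algebra_simps)
    then show ?thesis by (simp add: span_base span_scale)
  qed
  from derived_centralizes_line[OF this] w have c: "br w1 z = 0" "br w2 z = 0" by simp_all
  obtain p q where z: "z = p *\<^sub>R w1 + q *\<^sub>R w2" using i(1)[of w1] i(2)[of w1]
    unfolding span_pair_iff z_def by blast
  have "br w1 z = q *\<^sub>R z" "br w2 z = - p *\<^sub>R z"
    by (subst (1) z, simp add: lin sw z_def[symmetric])+
  with c z0 have "p = 0" "q = 0" by auto
  with z z0 show False by simp
qed

lemma abelian_idealI: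
  assumes B: "basis4 e a b c" and c: "br a b = 0" "br a c = 0" "br b c = 0"
    and D: "\<And>x y. br x y \<in> span {a, b, c}"
  shows "\<exists>\<epsilon>. abelian_ideal \<epsilon>"
proof -
  obtain k1 k2 k3 k4 where k: "linear k1" "linear k2" "linear k3" "linear k4"
    and x: "\<And>v. v = k1 v *\<^sub>R e + k2 v *\<^sub>R a + k3 v *\<^sub>R b + k4 v *\<^sub>R c"
    and t: "k1 e = 1" "k1 a = 0" "k1 b = 0" "k1 c = (0::real)"
    using basis4_coords[OF B] by metis
  have "br b a = 0" "br c a = 0" "br c b = 0" using c swap[of b a] swap[of c a] swap[of c b]
    by simp_all
  note c' = this c
  have "abelian_ideal k1"
    unfolding abelian_ideal_def
  proof (intro conjI allI impI)
    show "\<exists>x. k1 x \<noteq> 0" using t(1) by (metis zero_neq_one)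
    fix v w
    show "k1 (br v w) = 0"
    proof -
      obtain p q r where "br v w = p *\<^sub>R a + q *\<^sub>R b + r *\<^sub>R c"
        using D[of v w] unfolding span_triple_iff by blast
      then show ?thesis by (simp add: linear_simps[OF k(1)] t)
    qed
    assume "k1 v = 0" "k1 w = 0"
    then have v: "v = k2 v *\<^sub>R a + k3 v *\<^sub>R b + k4 v *\<^sub>R c"
      "w = k2 w *\<^sub>R a + k3 w *\<^sub>R b + k4 w *\<^sub>R c"
      using x[of v] x[of w] by simp_all
    show "br v w = 0"
      by (subst v(1), subst v(2)) (simp add: lin c')
  qed (rule k)
  then show ?thesis by blast
qed

text \<open>The traceless operator of \<open>f\<close> squares to the scalar
  \<open>a a + b c\<close>, so only a cyclic vector is missing; a nonzero traceless operator has one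
  among \<open>w1\<close>, \<open>w2\<close>, \<open>w1 + w2\<close>.\<close>

lemma plane_ext_of_homothety:
  assumes B: "basis4 e f w1 w2" and e: "br e w1 = w1" "br e w2 = w2" "br e f = m *\<^sub>R w1 + n *\<^sub>R w2"
    and f: "br f w1 = a *\<^sub>R w1 + b *\<^sub>R w2" "br f w2 = c *\<^sub>R w1 + (- a) *\<^sub>R w2"
    and w: "br w1 w2 = 0" and nz: "a \<noteq> 0 \<or> b \<noteq> 0 \<or> c \<noteq> 0"
  shows "\<exists>e e' w w' \<delta>. plane_ext br e e' w w' \<delta>"
proof -
  \<comment> \<open>\<open>e\<close> fixes the plane pointwise under the bracket, so subtracting
    \<open>[e, f]\<close> from \<open>f\<close> makes the two generators commute.\<close>
  define f' where "f' = f - m *\<^sub>R w1 - n *\<^sub>R w2"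
  have w': "br w2 w1 = 0" using w swap[of w2 w1] by simp
  have t: "br f' w1 = a *\<^sub>R w1 + b *\<^sub>R w2" "br f' w2 = c *\<^sub>R w1 + (- a) *\<^sub>R w2" "br e f' = 0"
    unfolding f'_def by (simp_all add: lin e f w w')
  have ext: "plane_ext br e f' (p *\<^sub>R w1 + q *\<^sub>R w2) ((p * a + q * c) *\<^sub>R w1 + (p * b
    - q * a) *\<^sub>R w2)
      (a * a + b * c)"
    if "p * (p * b - q * a) - q * (p * a + q * c) \<noteq> 0" for p q
  proof (rule plane_extI)
    show "basis4 e f' (p *\<^sub>R w1 + q *\<^sub>R w2) ((p * a + q * c) *\<^sub>R w1 + (p * b - q * a) *\<^sub>R w2)"
      using basis4_block[OF B, of 1 1 0 0 p "p * b - q * a" q "p * a + q * c" 0 0 "- m" "- n"] that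
      by (simp add: f'_def algebra_simps)
  qed (simp_all add: lin t e w w' algebra_simps)
  show ?thesis
  proof (cases "b \<noteq> 0")
    case True
    then show ?thesis using ext[of 1 0] by fastforce
  next
    case b: False
    show ?thesis
    proof (cases "c \<noteq> 0")
      case True
      then show ?thesis using ext[of 0 1] by fastforce
    next
      case False
      then show ?thesis using ext[of 1 1] b nz by fastforce
    qed
  qed
qed

text \<open>\<open>[e1, e2]\<close> lies in the abelian plane, so \<open>e1\<close> and
  \<open>e2\<close> act there by commuting matrices. Commuting 2x2 matrices have proportional
  traceless parts, hence some nonzero combination of \<open>e1\<close> and \<open>e2\<close> acts as
  a scalar.\<close>

lemma abelian_ideal_or_plane_ext:
  assumes B: "basis4 e1 e2 w1 w2" and D: "\<And>x y. br x y \<in> span {w1, w2}" and w: "br w1 w2 = 0"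
  shows "(\<exists>\<epsilon>. abelian_ideal \<epsilon>) \<or> (\<exists>e e' w w' \<delta>. plane_ext br e e' w w' \<delta>)"
proof -
  have w': "br w2 w1 = 0" using w swap[of w2 w1] by simp
  have D3: "br x y \<in> span {v, w1, w2}" for x y v
    using D[of x y] span_mono[of "{w1, w2}" "{v, w1, w2}"] by blast
  have ex: "\<exists>p q. br x y = p *\<^sub>R w1 + q *\<^sub>R w2" for x y using D[of x y] unfolding span_pair_iff .
  \<comment> \<open>For \<open>k = 0\<close> the vector \<open>f\<close> enlarges the plane to an
    abelian ideal; otherwise \<open>f\<close> is scaled to the identity and used to remove the trace
    of \<open>g\<close>.\<close>
  have hom: ?thesis
    if B': "basis4 f g w1 w2" and f: "br f w1 = k *\<^sub>R w1" "br f w2 = k *\<^sub>R w2" for f g k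
  proof (cases "k = 0")
    case True
    have "basis4 g f w1 w2" by (rule basis4_perm[OF B'])
    from abelian_idealI[OF this _ _ w D3] f True show ?thesis by simp
  next
    case False
    define f' where "f' = (1 / k) *\<^sub>R f"
    have f': "br f' w1 = w1" "br f' w2 = w2" using f False by (simp_all add: f'_def lin)
    obtain a b where g1: "br g w1 = a *\<^sub>R w1 + b *\<^sub>R w2" using ex by blast
    obtain c d where g2: "br g w2 = c *\<^sub>R w1 + d *\<^sub>R w2" using ex by blast
    define \<alpha> where "\<alpha> = (a - d) / 2"
    have \<alpha>: "a - (a + d) / 2 = \<alpha>" "d - (a + d) / 2 = - \<alpha>" by (simp_all add: \<alpha>_def field_simps)
    define g' where "g' = g - ((a + d) / 2) *\<^sub>R f'"
    have "br g' w1 = (a - (a + d) / 2) *\<^sub>R w1 + b *\<^sub>R w2"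
      "br g' w2 = c *\<^sub>R w1 + (d - (a + d) / 2) *\<^sub>R w2"
      by (simp_all add: g'_def lin f' g1 g2 scaleR_left_diff_distrib)
    then have g': "br g' w1 = \<alpha> *\<^sub>R w1 + b *\<^sub>R w2" "br g' w2 = c *\<^sub>R w1 + (- \<alpha>) *\<^sub>R w2"
      unfolding \<alpha> .
    have B2: "basis4 f' g' w1 w2"
      using basis4_block[OF B', of "1 / k" 1 0 "- ((a + d) / 2 * (1 / k))" 1 1 0 0 0 0 0 0] False
      by (simp add: f'_def g'_def)
    show ?thesis
    proof (cases "\<alpha> = 0 \<and> b = 0 \<and> c = 0")
      case True
      from abelian_idealI[OF B2 _ _ w D3] g' True show ?thesis by simp
    next
      case False
      obtain m n where "br f' g' = m *\<^sub>R w1 + n *\<^sub>R w2" using ex by blast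
      from plane_ext_of_homothety[OF B2 f' this g' w] False show ?thesis by blast
    qed
  qed
  obtain a b where e1: "br e1 w1 = a *\<^sub>R w1 + b *\<^sub>R w2" using ex by blast
  obtain c d where e2: "br e1 w2 = c *\<^sub>R w1 + d *\<^sub>R w2" using ex by blast
  obtain a' b' where e3: "br e2 w1 = a' *\<^sub>R w1 + b' *\<^sub>R w2" using ex by blast
  obtain c' d' where e4: "br e2 w2 = c' *\<^sub>R w1 + d' *\<^sub>R w2" using ex by blast
  obtain m n where e5: "br e1 e2 = m *\<^sub>R w1 + n *\<^sub>R w2" using ex by blast
  note t = e1 e2 e3 e4 e5 w w'
  have "0 *\<^sub>R e1 + 0 *\<^sub>R e2 + (a' * a + b' * c) *\<^sub>R w1 + (a' * b + b' * d) *\<^sub>R w2 =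
      0 *\<^sub>R e1 + 0 *\<^sub>R e2 + (a * a' + b * c') *\<^sub>R w1 + (a * b' + b * d') *\<^sub>R w2"
    using derivation[of e1 e2 w1] by (simp add: lin t algebra_simps)
  note c1 = basis4_eqD(3,4)[OF B this]
  have "0 *\<^sub>R e1 + 0 *\<^sub>R e2 + (c' * a + d' * c) *\<^sub>R w1 + (c' * b + d' * d) *\<^sub>R w2 =
      0 *\<^sub>R e1 + 0 *\<^sub>R e2 + (c * a' + d * c') *\<^sub>R w1 + (c * b' + d * d') *\<^sub>R w2"
    using derivation[of e1 e2 w2] by (simp add: lin t algebra_simps)
  note c2 = basis4_eqD(3,4)[OF B this]
  have par: "b * c' = b' * c" "b * (a' - d') = b' * (a - d)" "c * (a' - d') = c' * (a - d)"
    using c1 c2 by (simp_all add: algebra_simps)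
  obtain s t where st: "s \<noteq> 0 \<or> t \<noteq> 0" "s * b + t * b' = 0" "s * c + t * c' = 0"
    "s * (a - d) + t * (a' - d') = 0"
  proof -
    consider "b = 0" "c = 0" "a - d = 0" | "b \<noteq> 0" | "c \<noteq> 0" | "a - d \<noteq> 0" by blast
    then show thesis
    proof cases
      case 1 then show ?thesis using that[of 1 0] by simp
    next
      case 2 then show ?thesis using that[of b' "- b"] par by (simp add: algebra_simps)
    next
      case 3 then show ?thesis using that[of c' "- c"] par by (simp add: algebra_simps)
    next
      case 4 then show ?thesis using that[of "a' - d'" "- (a - d)"] par by (simp add: algebra_simps)
    qed
  qed
  define f where "f = s *\<^sub>R e1 + t *\<^sub>R e2"
  have "br f w1 = (s * a + t * a') *\<^sub>R w1 + (s * b + t * b') *\<^sub>R w2"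
    "br f w2 = (s * c + t * c') *\<^sub>R w1 + (s * d + t * d') *\<^sub>R w2"
    by (simp_all add: f_def lin e1 e2 e3 e4 algebra_simps)
  moreover have "s * d + t * d' = s * a + t * a'" using st(4) by (simp add: algebra_simps)
  ultimately have f: "br f w1 = (s * a + t * a') *\<^sub>R w1" "br f w2 = (s * a + t * a') *\<^sub>R w2"
    using st(2,3) by simp_all
  show ?thesis
  proof (cases "s = 0")
    case True
    have "basis4 f e1 w1 w2"
      using basis4_block[OF B, of s 0 t 1 1 1 0 0 0 0 0 0] st(1) True by (simp add: f_def)
    then show ?thesis using f by (rule hom)
  next
    case False
    have "basis4 f e2 w1 w2"
      using basis4_block[OF B, of s 1 t 0 1 1 0 0 0 0 0 0] False by (simp add: f_def)
    then show ?thesis using f by (rule hom)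
  qed
qed


text \<open>A functional that kills the image of a singular matrix would kill the whole derived
  algebra, in particular \<open>x\<close> and \<open>y\<close>.\<close>

lemma heisenberg_ext_nonsingular:
  assumes A: "heisenberg_ext br e x y z a b c d"
    and D: "x \<in> derived_series br 1" "y \<in> derived_series br 1"
  shows "a * d - b * c \<noteq> 0"
proof
  assume 0: "a * d - b * c = 0"
  obtain s t where st: "s \<noteq> 0 \<or> t \<noteq> 0" "s * a + t * b = 0" "s * c + t * d = 0"
  proof -
    consider "a = 0" "b = 0" "c = 0" "d = 0" | "a \<noteq> 0 \<or> b \<noteq> 0" | "c \<noteq> 0 \<or> d \<noteq> 0" by blast
    then show thesis
    proof cases
      case 1 then show ?thesis using that[of 1 0] by simp
    next
      case 2 then show ?thesis using that[of b "- a"] 0 by (auto simp: algebra_simps)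
    next
      case 3 then show ?thesis using that[of d "- c"] 0 by (auto simp: algebra_simps)
    qed
  qed
  note B = heisenberg_ext_basis[OF A]
  obtain k1 k2 k3 k4 where k: "linear k1" "linear k2" "linear k3" "linear k4"
    and e: "\<And>v. v = k1 v *\<^sub>R e + k2 v *\<^sub>R x + k3 v *\<^sub>R y + k4 v *\<^sub>R z"
    and k2: "k2 e = 0" "k2 x = 1" "k2 y = 0" "k2 z = 0"
    and k3: "k3 e = 0" "k3 x = 0" "k3 y = 1" "k3 z = (0::real)"
    using basis4_coords[OF B] by metis
  define f where "f v = s * k2 v + t * k3 v" for v
  have f: "linear f"
    unfolding f_def by (rule linearI) (simp_all add: linear_simps[OF k(2)] linear_simps[OF k(3)]
      algebra_simps)
  have fv: "f e = 0" "f x = s" "f y = t" "f z = 0" by (simp_all add: f_def k2 k3)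
  have "f (br u v) = 0" for u v
  proof -
    obtain p q r m where u: "u = p *\<^sub>R e + q *\<^sub>R x + r *\<^sub>R y + m *\<^sub>R z" using e by blast
    obtain p' q' r' m' where v: "v = p' *\<^sub>R e + q' *\<^sub>R x + r' *\<^sub>R y + m' *\<^sub>R z" using e by blast
    have "f (br u v) = (p * q' - q * p') * (s * a + t * b) + (p * r' - r * p') * (s * c + t * d)"
      unfolding u v
      by (simp add: lin heisenberg_ext_table[OF A] linear_simps[OF f] fv algebra_simps)
    then show ?thesis using st by simp
  qed
  from derived_algebra_induct[OF f this] D fv st(1) show False by auto
qed

lemma abelian_ideal_or_heisenberg_ext:
  assumes B: "basis4 e x y w" and D1: "derived_series br 1 = span {x, y, w}"
    and D2: "derived_series br 2 = span {w}"
  shows "(\<exists>\<epsilon>. abelian_ideal \<epsilon>) \<or>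
    (\<exists>e x y z a b c d. heisenberg_ext br e x y z a b c d \<and> a * d - b * c \<noteq> 0)"
proof -
  have in1: "x \<in> derived_series br 1" "y \<in> derived_series br 1" "w \<in> derived_series br 1"
    unfolding D1 by (simp_all add: span_base)
  have br1: "br u v \<in> span {x, y, w}" for u v
    unfolding D1[symmetric] by (simp, rule span_base, blast)
  have "br v w \<in> span {w}" for v
    using derived_series_ideal[of w 2 v] unfolding D2 by (simp add: span_base)
  note cw = derived_centralizes_line[OF this]
  have w: "br x w = 0" "br y w = 0" using cw in1 by simp_all
  have w': "br w x = 0" "br w y = 0" using w swap[of w x] swap[of w y] by simp_all
  have "br x y \<in> derived_series br 2" using in1 by (auto simp: numeral_2_eq_2 intro!: span_base)
  then obtain k where k: "br x y = k *\<^sub>R w" unfolding D2 span_singleton by blast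
  show ?thesis
  proof (cases "k = 0")
    case True
    from abelian_idealI[OF B _ w br1] k True show ?thesis by simp
  next
    case False
    define z where "z = k *\<^sub>R w"
    have xy: "br x y = z" "br y x = - z" using k swap[of y x] by (simp_all add: z_def)
    have cz: "br x z = 0" "br y z = 0" "br z x = 0" "br z y = 0" by (simp_all add: z_def lin w w')
    have comb: "\<exists>p q r. br u v = p *\<^sub>R x + q *\<^sub>R y + r *\<^sub>R z" for u v
    proof -
      obtain p q r where "br u v = p *\<^sub>R x + q *\<^sub>R y + r *\<^sub>R w"
        using br1[of u v] unfolding span_triple_iff by blast
      then have "br u v = p *\<^sub>R x + q *\<^sub>R y + (r / k) *\<^sub>R z" using False by (simp add: z_def)
      then show ?thesis by blast
    qed
    obtain a b f where ex: "br e x = a *\<^sub>R x + b *\<^sub>R y + f *\<^sub>R z" using comb by blast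
    obtain c d g where ey: "br e y = c *\<^sub>R x + d *\<^sub>R y + g *\<^sub>R z" using comb by blast
    have ez: "br e z = (a + d) *\<^sub>R z"
      using derivation[of e x y] by (simp add: xy ex ey lin cz algebra_simps)
    \<comment> \<open>The brackets of the added multiples of \<open>x\<close> and \<open>y\<close>
      cancel the central components \<open>f\<close> and \<open>g\<close>.\<close>
    define e' where "e' = e - g *\<^sub>R x + f *\<^sub>R y"
    have "heisenberg_ext br e' x y z a b c d"
    proof (rule heisenberg_extI)
      show "basis4 e' x y z"
        using basis4_block[OF B, of 1 1 "- g" 0 1 k 0 0 "f" 0 0 0] False
        by (simp add: e'_def z_def)
    qed (simp_all add: e'_def lin ex ey ez xy cz algebra_simps)
    with heisenberg_ext_nonsingular[OF this in1(1,2)] show ?thesis by blast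
  qed
qed

text \<open>
  Otherwise \<open>[E, X] = k X\<close> with \<open>k \<noteq> 0\<close> for the actions \<open>E\<close>, \<open>X\<close> of \<open>e\<close>, \<open>x\<close> on the plane, so \<open>X\<close> is
  nilpotent, although its image is the whole plane.
\<close>

lemma derived_plane_impossible:
  assumes B: "basis4 e x v w" and D1: "derived_series br 1 = span {x, v, w}"
    and D2: "derived_series br 2 = span {v, w}"
  shows False
proof -
  have in1: "x \<in> derived_series br 1" "v \<in> derived_series br 1" "w \<in> derived_series br 1"
    unfolding D1 by (simp_all add: span_base)
  have in2: "v \<in> derived_series br 2" "w \<in> derived_series br 2"
    unfolding D2 by (simp_all add: span_base)
  have I: "br u v \<in> span {v, w}" "br u w \<in> span {v, w}" for u
    using in2 derived_series_ideal unfolding D2[symmetric] by blast+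
  have vw: "br v w = 0" by (rule plane_ideal_abelian[OF in1(2,3) I])
  then have wv: "br w v = 0" using swap[of w v] by simp
  obtain p q where xv: "br x v = p *\<^sub>R v + q *\<^sub>R w" using I unfolding span_pair_iff by blast
  obtain r s where xw: "br x w = r *\<^sub>R v + s *\<^sub>R w" using I unfolding span_pair_iff by blast
  obtain a b where ev: "br e v = a *\<^sub>R v + b *\<^sub>R w" using I unfolding span_pair_iff by blast
  obtain c d where ew: "br e w = c *\<^sub>R v + d *\<^sub>R w" using I unfolding span_pair_iff by blast
  have "br e x \<in> span {x, v, w}" using in1 derived_series_ideal unfolding D1[symmetric] by blast
  then obtain k m n where ex: "br e x = k *\<^sub>R x + m *\<^sub>R v + n *\<^sub>R w" unfolding span_triple_iff
    by blast
  have sw: "br v x = - (p *\<^sub>R v + q *\<^sub>R w)" "br w x = - (r *\<^sub>R v + s *\<^sub>R w)"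
    "br v e = - (a *\<^sub>R v + b *\<^sub>R w)" "br w e = - (c *\<^sub>R v + d *\<^sub>R w)"
    "br x e = - (k *\<^sub>R x + m *\<^sub>R v + n *\<^sub>R w)"
    using swap[of v x] swap[of w x] swap[of v e] swap[of w e] swap[of x e] xv xw ev ew ex
      by simp_all
  note t = xv xw ev ew ex vw wv sw
  obtain k1 k2 k3 k4 where k: "linear k1" "linear k2" "linear k3" "linear k4"
    and e: "\<And>u. u = k1 u *\<^sub>R e + k2 u *\<^sub>R x + k3 u *\<^sub>R v + k4 u *\<^sub>R w"
    and kv: "k2 e = 0" "k2 x = 1" "k2 v = 0" "k2 w = 0" "k3 v = 1" "k3 w = 0" "k4 v = 0"
      "k4 w = (1::real)"
    using basis4_coords[OF B] by metis
  have "k \<noteq> 0"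
  proof
    assume 0: "k = 0"
    have "k2 (br u u') = 0" for u u'
      by (subst e[of u], subst e[of u'])
        (simp add: lin t 0 linear_simps[OF k(2)] kv)
    from derived_algebra_induct[OF k(2) this in1(1)] show False by (simp add: kv)
  qed
  have "0 *\<^sub>R e + 0 *\<^sub>R x + (p * a + q * c) *\<^sub>R v + (p * b + q * d) *\<^sub>R w =
      0 *\<^sub>R e + 0 *\<^sub>R x + (k * p + a * p + b * r) *\<^sub>R v + (k * q + a * q + b * s) *\<^sub>R w"
    using derivation[of e x v] by (simp add: lin t algebra_simps)
  note c1 = basis4_eqD(3,4)[OF B this]
  have "0 *\<^sub>R e + 0 *\<^sub>R x + (r * a + s * c) *\<^sub>R v + (r * b + s * d) *\<^sub>R w =
      0 *\<^sub>R e + 0 *\<^sub>R x + (k * r + c * p + d * r) *\<^sub>R v + (k * s + c * q + d * s) *\<^sub>R w"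
    using derivation[of e x w] by (simp add: lin t algebra_simps)
  note c2 = basis4_eqD(3,4)[OF B this]
  have kp: "k * p = q * c - b * r" "k * q = p * b + q * d - a * q - b * s"
    "k * r = r * a + s * c - c * p - d * r" "k * s = r * b - c * q"
    using c1 c2 by (simp_all add: algebra_simps)
  have tr: "s = - p"
  proof -
    have "k * (p + s) = 0" using kp by (simp add: algebra_simps)
    then show ?thesis using \<open>k \<noteq> 0\<close> by simp
  qed
  \<comment> \<open>From \<open>[E, X] = k X\<close> follows
    \<open>k tr (X X) = tr ([E, X] X) = 0\<close>, and since \<open>X\<close> has trace 0,
    \<open>tr (X X) = 2 (p p + q r)\<close>.\<close>
  have "k * (p * p + q * r) = 0"
  proof -
    have "2 * (k * (p * p + q * r)) = 2 * p * (k * p) + (k * q) * r + q * (k * r)"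
      by (simp add: algebra_simps)
    also have "\<dots> = 0" unfolding kp tr by (simp add: algebra_simps)
    finally show ?thesis by simp
  qed
  then have det: "p * s - q * r = 0" using \<open>k \<noteq> 0\<close> tr by simp
  obtain \<alpha> \<beta> where \<alpha>: "\<alpha> \<noteq> 0 \<or> \<beta> \<noteq> 0" "\<alpha> * p + \<beta> * q = 0" "\<alpha> * r + \<beta> * s = 0"
  proof -
    consider "p = 0" "q = 0" "r = 0" "s = 0" | "p \<noteq> 0 \<or> q \<noteq> 0" | "r \<noteq> 0 \<or> s \<noteq> 0" by blast
    then show thesis
    proof cases
      case 1 then show ?thesis using that[of 1 0] by simp
    next
      case 2 then show ?thesis using that[of q "- p"] det by (auto simp: algebra_simps)
    next
      case 3 then show ?thesis using that[of s "- r"] det by (auto simp: algebra_simps)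
    qed
  qed
  define f where "f u = \<alpha> * k3 u + \<beta> * k4 u" for u
  have f: "linear f"
    unfolding f_def by (rule linearI) (simp_all add: linear_simps[OF k(3)] linear_simps[OF k(4)]
      algebra_simps)
  have fv: "f v = \<alpha>" "f w = \<beta>" by (simp_all add: f_def kv)
  have "f (br y y') = 0" if D: "y \<in> derived_series br 1" "y' \<in> derived_series br 1" for y y'
  proof -
    obtain x1 x2 x3 where y: "y = x1 *\<^sub>R x + x2 *\<^sub>R v + x3 *\<^sub>R w"
      using D(1) unfolding D1 span_triple_iff by blast
    obtain y1 y2 y3 where y': "y' = y1 *\<^sub>R x + y2 *\<^sub>R v + y3 *\<^sub>R w"
      using D(2) unfolding D1 span_triple_iff by blast
    have "f (br y y') = (x1 * y2 - x2 * y1) * (\<alpha> * p + \<beta> * q) + (x1 * y3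
      - x3 * y1) * (\<alpha> * r + \<beta> * s)"
      unfolding y y' by (simp add: lin t linear_simps[OF f] fv algebra_simps)
    then show ?thesis using \<alpha> by simp
  qed
  from second_derived_algebra_induct[OF f this] in2 \<alpha>(1) fv show False by auto
qed

lemma solvable_structure:
  assumes dim: "dim (UNIV :: 'a set) = 4" and sol: "solvable_lie br"
  shows "(\<exists>\<epsilon>. abelian_ideal \<epsilon>) \<or> (\<exists>e e' w w' \<delta>. plane_ext br e e' w w' \<delta>) \<or>
    (\<exists>e x y z a b c d. heisenberg_ext br e x y z a b c d \<and> a * d - b * c \<noteq> 0)"
proof -
  have br1: "br u v \<in> derived_series br 1" for u v by (simp, rule span_base, blast)
  have sub: "subspace (derived_series br 1)" "subspace (derived_series br 2)"
    by (simp_all add: numeral_2_eq_2 subspace_span)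
  have mono: "derived_series br 2 \<subseteq> derived_series br 1"
    using br1 by (simp add: numeral_2_eq_2, intro span_mono) auto
  \<comment> \<open>A derived series that repeats is constant from there on, and solvability makes
    it zero.\<close>
  have stable: "derived_series br 1 = {0}" if eq: "derived_series br 2 = derived_series br 1"
  proof -
    have s: "derived_series br (Suc k) = derived_series br 1" for k
    proof (induction k)
      case (Suc k)
      have "derived_series br (Suc (Suc k)) = derived_series br 2"
        by (simp only: derived_series.simps(2)[of br "Suc k"] derived_series.simps(2)[of br "Suc 0"]
            Suc numeral_2_eq_2 One_nat_def)
      then show ?case using eq by simp
    qed simp
    obtain k where k: "derived_series br k = {0}" using sol unfolding solvable_lie_def by blast
    have "derived_series br (Suc k) = {0}" by (simp add: k lin)
    with s[of k] show ?thesis by simp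
  qed
  obtain bs m n where bs: "length bs = 4" "basis4 (bs ! 0) (bs ! 1) (bs ! 2) (bs ! 3)"
    and mn: "m \<le> n" "n \<le> 4" and D1: "derived_series br 1 = span (set (drop m bs))"
    and D2: "derived_series br 2 = span (set (drop n bs))"
    by (rule subspace_flag_basis[OF dim sub mono])
  obtain b1 b2 b3 b4 where b: "bs = [b1, b2, b3, b4]"
    using bs(1) by (auto simp: length_Suc_conv numeral_eq_Suc)
  have B: "basis4 b1 b2 b3 b4" using bs(2) b by simp
  have nz: "b4 \<noteq> 0" "b3 \<noteq> 0"
    using basis4_zeroD(4)[OF B, of 0 0 0 1] basis4_zeroD(3)[OF B, of 0 0 1 0] by auto
  have mn4: "m < n" if "m < 4"
  proof (rule ccontr)
    assume "\<not> m < n"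
    then have "derived_series br 1 = {0}" using mn D1 D2 by (intro stable) simp
    moreover have "b4 \<in> set (drop m bs)" using that b by (auto simp: numeral_eq_Suc less_Suc_eq)
    then have "b4 \<in> derived_series br 1" unfolding D1 by (rule span_base)
    ultimately show False using nz by simp
  qed
  \<comment> \<open>The first and second derived algebras have dimensions \<open>4 - m\<close> and
    \<open>4 - n\<close>.\<close>
  consider "m = 0" | "m = 1" | "m = 2" | "m = 3" | "m = 4" using mn by linarith
  then show ?thesis
  proof cases
    case 1
    have "span (set bs) = UNIV" using B unfolding b basis4_def by (auto simp: span_quadruple_iff)
    then have "derived_series br 1 = UNIV" using D1 1 by simp
    then have "derived_series br 2 = derived_series br 1" by (simp add: numeral_2_eq_2)
    then have "derived_series br 1 = {0}" by (rule stable)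
    with \<open>derived_series br 1 = UNIV\<close> nz show ?thesis by blast
  next
    case 2
    then have D1': "derived_series br 1 = span {b2, b3, b4}" using D1 b by simp
    have br': "br u v \<in> span {b2, b3, b4}" for u v using br1[of u v] D1' by simp
    consider "n = 2" | "n = 3" | "n = 4" using mn mn4 2 by linarith
    then show ?thesis
    proof cases
      case 1
      then have "derived_series br 2 = span {b3, b4}" using D2 b by simp
      from derived_plane_impossible[OF B D1' this] show ?thesis ..
    next
      case 2
      then have "derived_series br 2 = span {b4}" using D2 b by simp
      from abelian_ideal_or_heisenberg_ext[OF B D1' this] show ?thesis by blast
    next
      case 3
      then have "derived_series br 2 = {0}" using D2 b by simp
      then have z: "br u v = 0" if "u \<in> span {b2, b3, b4}" "v \<in> span {b2, b3, b4}" for u v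
      proof -
        have "br u v \<in> span {br x y |x y. x \<in> derived_series br 1 \<and> y \<in> derived_series br 1}"
          by (rule span_base) (use that D1' in blast)
        also have "\<dots> = derived_series br 2" by (simp add: numeral_2_eq_2)
        finally show ?thesis using \<open>derived_series br 2 = {0}\<close> by simp
      qed
      have "b2 \<in> span {b2, b3, b4}" "b3 \<in> span {b2, b3, b4}" "b4 \<in> span {b2, b3, b4}"
        by (simp_all add: span_base)
      with abelian_idealI[OF B _ _ _ br'] z show ?thesis by blast
    qed
  next
    case 3
    then have D1': "derived_series br 1 = span {b3, b4}" using D1 b by (simp add: numeral_2_eq_2)
    have br': "br u v \<in> span {b3, b4}" for u v using br1[of u v] D1' by simp
    have "br b3 b4 = 0"
      by (rule plane_ideal_abelian) (simp_all only: br', simp_all only: D1', simp_all add: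
        span_base)
    from abelian_ideal_or_plane_ext[OF B br' this] show ?thesis by blast
  next
    case 4
    then have D1': "derived_series br 1 = span {b4}" using D1 b by (simp add: numeral_3_eq_3)
    have "\<exists>k. br u v = k *\<^sub>R b4" for u v using br1[of u v] unfolding D1' span_singleton by blast
    then obtain c where c: "\<And>u v. br u v = c u v *\<^sub>R b4" by metis
    \<comment> \<open>A derived algebra of dimension one is enlarged to an abelian plane by a vector
      commuting with \<open>b4\<close>, which exists among the combinations of \<open>b2\<close> and
      \<open>b3\<close>.\<close>
    have pl: ?thesis if "basis4 x y z b4" "br z b4 = 0" for x y z
    proof -
      have "br u v \<in> span {z, b4}" for u v
        unfolding c[of u v] by (simp add: span_scale span_base)
      from abelian_ideal_or_plane_ext[OF that(1) this that(2)] show ?thesis by blast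
    qed
    show ?thesis
    proof (cases "c b3 b4 = 0")
      case True
      show ?thesis by (rule pl[OF B]) (simp add: c[of b3 b4] True)
    next
      case False
      define y where "y = b2 - (c b2 b4 / c b3 b4) *\<^sub>R b3"
      have "basis4 b1 b3 y b4"
      proof (rule basis4_perm(2))
        show "basis4 b1 y b3 b4"
          using basis4_block[OF B, of 1 1 0 0 1 1 0 0 0 0 "- (c b2 b4 / c b3 b4)" 0]
          by (simp add: y_def)
      qed
      moreover have "br y b4 = 0" using False by (simp add: y_def lin c[of b2 b4] c[of b3 b4])
      ultimately show ?thesis by (rule pl)
    qed
  next
    case 5
    then have "derived_series br 1 = {0}" using D1 b by simp
    then have z: "br u v = 0" for u v using br1[of u v] by simp
    have "br u v \<in> span {b3, b4}" for u v unfolding z[of u v] by (rule span_zero)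
    from abelian_ideal_or_plane_ext[OF B this z] show ?thesis by blast
  qed
qed


section \<open>Identification with the listed algebras\<close>

text \<open>Rescaling \<open>e'\<close> leaves only the sign of \<delta>. For \<delta> = 0 the
  operator \<open>e'\<close> is nilpotent and \<open>w\<close>, \<open>- e'\<close>,
  \<open>w'\<close> span a Heisenberg algebra. This is the source of \<open>d4 1\<close>, whose
  derived algebra is only a plane.\<close>

lemma plane_ext_listed:
  assumes A: "plane_ext br e e' w w' \<delta>"
  shows "(\<exists>g J. skt br g J) \<or> lie_isomorphic br aff_C \<or>
    (\<exists>l. l \<ge> 1/2 \<and> l \<noteq> 1/2 \<and> l \<noteq> 2 \<and> lie_isomorphic br (d4 l))"
proof -
  consider "\<delta> > 0" | "\<delta> < 0" | "\<delta> = 0" by linarith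
  then show ?thesis
  proof cases
    case 1
    from skt_plane_ext[OF A 1] show ?thesis ..
  next
    case 2
    define k where "k = 1 / sqrt (- \<delta>)"
    have k: "k > 0" "k * k * \<delta> = - 1" using 2 by (simp_all add: k_def)
    have "plane_ext br e (k *\<^sub>R e') w (k *\<^sub>R w') (- 1)"
    proof (rule plane_extI)
      show "basis4 e (k *\<^sub>R e') w (k *\<^sub>R w')"
        using basis4_block[OF plane_ext_basis[OF A], of 1 k 0 0 1 k 0 0 0 0 0 0] k by simp
      show "br (k *\<^sub>R e') (k *\<^sub>R w') = - 1 *\<^sub>R w"
        unfolding k(2)[symmetric] by (simp add: lin plane_ext_table[OF A])
    qed (simp_all add: lin plane_ext_table[OF A])
    then have "lie_isomorphic br aff_C"
      unfolding plane_ext_def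
      by (rule lie_isomorphic_brackets[OF lie lie_algebra_aff_C _ plane_ext_aff_C[unfolded
        plane_ext_def]])
    then show ?thesis by blast
  next
    case 3
    have "heisenberg_ext br e w (- e') w' 1 0 0 (1 - 1)"
    proof (rule heisenberg_extI)
      have "basis4 e (- e') w w'"
        using basis4_block[OF plane_ext_basis[OF A], of 1 "- 1" 0 0 1 1 0 0 0 0 0 0] by simp
      then show "basis4 e w (- e') w'" by (rule basis4_perm(2))
    qed (simp_all add: lin plane_ext_table[OF A] 3)
    then have "lie_isomorphic br (d4 1)"
      unfolding heisenberg_ext_def
      by (rule lie_isomorphic_brackets[OF lie lie_algebra_d4 _ heisenberg_ext_d4[unfolded
        heisenberg_ext_def]])
    then show ?thesis by (intro disjI2 exI[of _ 1]) simp
  qed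
qed

section \<open>Normal forms of extensions of the Heisenberg algebra\<close>

lemma heisenberg_ext_scale:
  assumes A: "heisenberg_ext br e x y z a b c d" and k: "k \<noteq> 0"
  shows "heisenberg_ext br (k *\<^sub>R e) x y z (k * a) (k * b) (k * c) (k * d)"
proof (rule heisenberg_extI)
  show "basis4 (k *\<^sub>R e) x y z"
    using basis4_block[OF heisenberg_ext_basis[OF A], of k 1 0 0 1 1 0 0 0 0 0 0] k by simp
qed (simp_all add: lin heisenberg_ext_table[OF A] algebra_simps)

text \<open>With \<open>P\<close> the matrix of the new vectors, the hypotheses \<open>m\<close> say
  \<open>P M = M' P\<close>; the centre vector is multiplied by the determinant of
  \<open>P\<close>.\<close>

lemma heisenberg_ext_change:
  assumes A: "heisenberg_ext br e x y z a b c d" and nz: "\<alpha> * \<delta> - \<beta> * \<gamma> \<noteq> 0"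
    and m: "\<alpha> * a + \<beta> * c = a' * \<alpha> + b' * \<gamma>" "\<alpha> * b + \<beta> * d = a' * \<beta> + b' * \<delta>"
      "\<gamma> * a + \<delta> * c = c' * \<alpha> + d' * \<gamma>" "\<gamma> * b + \<delta> * d = c' * \<beta> + d' * \<delta>"
    and tr: "a' + d' = a + d"
  shows "heisenberg_ext br e (\<alpha> *\<^sub>R x + \<beta> *\<^sub>R y) (\<gamma> *\<^sub>R x + \<delta> *\<^sub>R y) ((\<alpha> * \<delta> - \<beta> * \<gamma>) *\<^sub>R z) a' b'
    c' d'"
proof (rule heisenberg_extI)
  have "basis4 e z x y"
    by (rule basis4_perm(2)[OF basis4_perm(3)[OF heisenberg_ext_basis[OF A]]])
  from basis4_block[OF this, of 1 "\<alpha> * \<delta> - \<beta> * \<gamma>" 0 0 \<alpha> \<delta> \<beta> \<gamma> 0 0 0 0] nz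
  have "basis4 e ((\<alpha> * \<delta> - \<beta> * \<gamma>) *\<^sub>R z) (\<alpha> *\<^sub>R x + \<beta> *\<^sub>R y) (\<gamma> *\<^sub>R x + \<delta> *\<^sub>R y)" by simp
  then show "basis4 e (\<alpha> *\<^sub>R x + \<beta> *\<^sub>R y) (\<gamma> *\<^sub>R x + \<delta> *\<^sub>R y) ((\<alpha> * \<delta> - \<beta> * \<gamma>) *\<^sub>R z)"
    by (rule basis4_perm(3)[OF basis4_perm(2)])
  have "br e (\<alpha> *\<^sub>R x + \<beta> *\<^sub>R y) = (\<alpha> * a + \<beta> * c) *\<^sub>R x + (\<alpha> * b + \<beta> * d) *\<^sub>R y"
    by (simp add: lin heisenberg_ext_table[OF A] algebra_simps)
  then show "br e (\<alpha> *\<^sub>R x + \<beta> *\<^sub>R y) = a' *\<^sub>R (\<alpha> *\<^sub>R x + \<beta> *\<^sub>R y) + b' *\<^sub>R (\<gamma> *\<^sub>R x + \<delta> *\<^sub>R y)"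
    unfolding m by (simp add: algebra_simps)
  have "br e (\<gamma> *\<^sub>R x + \<delta> *\<^sub>R y) = (\<gamma> * a + \<delta> * c) *\<^sub>R x + (\<gamma> * b + \<delta> * d) *\<^sub>R y"
    by (simp add: lin heisenberg_ext_table[OF A] algebra_simps)
  then show "br e (\<gamma> *\<^sub>R x + \<delta> *\<^sub>R y) = c' *\<^sub>R (\<alpha> *\<^sub>R x + \<beta> *\<^sub>R y) + d' *\<^sub>R (\<gamma> *\<^sub>R x + \<delta> *\<^sub>R y)"
    unfolding m by (simp add: algebra_simps)
qed (simp_all add: lin heisenberg_ext_table[OF A] tr algebra_simps)

text \<open>Scaling the trace to 1 leaves one parameter \<open>l\<close>, and exchanging
  \<open>x\<close> and \<open>y\<close> replaces it by \<open>1 - l\<close>, so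
  \<open>l > 1 / 2\<close> may be assumed. At \<open>l = 2\<close> the exchanged table has
  eigenvalues -1 and 2, for which \<open>2 a + d\<close> vanishes.\<close>

lemma heisenberg_ext_diagonal_listed:
  assumes A: "heisenberg_ext br e x y z a 0 0 d" and ad: "a \<noteq> 0" "d \<noteq> 0" "a \<noteq> d"
  shows "(\<exists>g J. skt br g J) \<or>
    (\<exists>l. l \<ge> 1/2 \<and> l \<noteq> 1/2 \<and> l \<noteq> 2 \<and> lie_isomorphic br (d4 l))"
proof (cases "a + d = 0")
  case True
  from skt_heisenberg_ext[OF A ad(2)] True show ?thesis by simp
next
  case False
  define l where "l = a / (a + d)"
  have A1: "heisenberg_ext br ((1 / (a + d)) *\<^sub>R e) x y z l 0 0 (d / (a + d))"
    using heisenberg_ext_scale[OF A, of "1 / (a + d)"] False by (simp add: l_def)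
  have "d / (a + d) = 1 - l" using False by (simp add: l_def field_simps)
  note A1 = A1[unfolded this]
  have l: "l \<noteq> 0" "l \<noteq> 1" "l \<noteq> 1 / 2" using ad False by (auto simp: l_def field_simps)
  have A2: "heisenberg_ext br ((1 / (a + d)) *\<^sub>R e) y (- x) z (1 - l) 0 0 l"
    using heisenberg_ext_swap[OF A1] by simp
  have main: ?thesis if H: "heisenberg_ext br e x y z l 0 0 (1 - l)" and "l > 1 / 2"
    "l \<noteq> 1" for e x y z l
  proof (cases "l = 2")
    case True
    have "heisenberg_ext br e y (- x) z (- 1) 0 0 2"
      using heisenberg_ext_swap[OF H] True by simp
    from skt_heisenberg_ext[OF this] show ?thesis by simp
  next
    case False
    have "lie_isomorphic br (d4 l)"
      by (rule lie_isomorphic_brackets[OF lie lie_algebra_d4 H[unfolded heisenberg_ext_def]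
            heisenberg_ext_d4[unfolded heisenberg_ext_def]])
    with that False show ?thesis by (intro disjI2 exI[of _ l]) simp
  qed
  show ?thesis
  proof (cases "l > 1 / 2")
    case True
    from main[OF A1 True l(2)] show ?thesis .
  next
    case False
    have "1 - l > 1 / 2" "1 - l \<noteq> 1" using False l by linarith+
    from main[OF _ this] A2 show ?thesis by simp
  qed
qed

lemma heisenberg_ext_triangular_listed:
  assumes A: "heisenberg_ext br e x y z a 0 c d" and ad: "a \<noteq> 0" "d \<noteq> 0"
  shows "(\<exists>g J. skt br g J) \<or>
    (\<exists>l. l \<ge> 1/2 \<and> l \<noteq> 1/2 \<and> l \<noteq> 2 \<and> lie_isomorphic br (d4 l)) \<or> lie_isomorphic br h4"
proof (cases "a = d")
  case False
  \<comment> \<open>The factor \<open>c / (d - a)\<close> makes the second vector an eigenvector for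
    \<open>d\<close>.\<close>
  then have "heisenberg_ext br e (1 *\<^sub>R x + 0 *\<^sub>R y) ((c / (d - a)) *\<^sub>R x + 1 *\<^sub>R y)
      ((1 * 1 - 0 * (c / (d - a))) *\<^sub>R z) a 0 0 d"
    by (intro heisenberg_ext_change[OF A]) (simp_all add: field_simps)
  from heisenberg_ext_diagonal_listed[OF this ad False] show ?thesis by blast
next
  case True
  show ?thesis
  proof (cases "c = 0")
    case True
    have "heisenberg_ext br e x y z d 0 (- 0) d" using A True \<open>a = d\<close> by simp
    from skt_heisenberg_ext_rotation[OF this] show ?thesis ..
  next
    case False
    have A1: "heisenberg_ext br ((1 / d) *\<^sub>R e) x y z 1 0 (c / d) 1"
      using heisenberg_ext_scale[OF A, of "1 / d"] True ad by simp
    have "heisenberg_ext br ((1 / d) *\<^sub>R e) ((c / d) *\<^sub>R x + 0 *\<^sub>R y) (0 *\<^sub>R x + 1 *\<^sub>R y)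
        (((c / d) * 1 - 0 * 0) *\<^sub>R z) 1 0 1 1"
      by (rule heisenberg_ext_change[OF A1]) (use False ad in simp_all)
    then have "lie_isomorphic br h4"
      unfolding heisenberg_ext_def
      by (rule lie_isomorphic_brackets[OF lie lie_algebra_h4 _ heisenberg_ext_h4[unfolded
        heisenberg_ext_def]])
    then show ?thesis by blast
  qed
qed

lemma heisenberg_ext_listed:
  assumes A: "heisenberg_ext br e x y z a b c d" and det: "a * d - b * c \<noteq> 0"
  shows "(\<exists>g J. skt br g J) \<or>
    (\<exists>l. l \<ge> 1/2 \<and> l \<noteq> 1/2 \<and> l \<noteq> 2 \<and> lie_isomorphic br (d4 l)) \<or> lie_isomorphic br h4"
proof (cases "b = 0")
  case True
  from heisenberg_ext_triangular_listed[OF A[unfolded True]] det True show ?thesis by simp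
next
  case b: False
  define \<Delta> where "\<Delta> = (a - d)\<^sup>2 + 4 * b * c"
  show ?thesis
  proof (cases "\<Delta> \<ge> 0")
    case True
    define \<mu> where "\<mu> = (a + d + sqrt \<Delta>) / 2"
    define \<nu> where "\<nu> = a + d - \<mu>"
    have 2: "2 * \<mu> = a + d + sqrt \<Delta>" "2 * \<nu> = a + d - sqrt \<Delta>"
      by (simp_all add: \<nu>_def \<mu>_def field_simps)
    have "4 * (\<mu> * \<nu>) = (2 * \<mu>) * (2 * \<nu>)" by simp
    also have "\<dots> = (a + d)\<^sup>2 - (sqrt \<Delta>)\<^sup>2"
      unfolding 2 by (simp only: power2_eq_square algebra_simps)
    also have "\<dots> = 4 * (a * d - b * c)"
      using True by (simp add: \<Delta>_def power2_eq_square algebra_simps)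
    finally have prod: "\<mu> * \<nu> = a * d - b * c" by simp
    with det have nz: "\<mu> \<noteq> 0" "\<nu> \<noteq> 0" by auto
    \<comment> \<open>By the characteristic equation the first vector is an eigenvector for \<mu>;
      completing it by \<open>x\<close> makes the matrix triangular.\<close>
    have "heisenberg_ext br e ((\<mu> - d) *\<^sub>R x + b *\<^sub>R y) (1 *\<^sub>R x + 0 *\<^sub>R y)
        (((\<mu> - d) * 0 - b * 1) *\<^sub>R z) \<mu> 0 1 \<nu>"
    proof (rule heisenberg_ext_change[OF A])
      show "(\<mu> - d) * a + b * c = \<mu> * (\<mu> - d) + 0 * 1"
        using prod by (simp add: \<nu>_def algebra_simps)
    qed (use b in \<open>simp_all add: \<nu>_def algebra_simps\<close>)
    from heisenberg_ext_triangular_listed[OF this nz] show ?thesis .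
  next
    case False
    define p q where "p = (a + d) / 2" and "q = sqrt (- \<Delta>) / 2"
    have q: "q \<noteq> 0" using False by (simp add: q_def)
    have d: "d = 2 * p - a" by (simp add: p_def field_simps)
    have "4 * (q * q) = - \<Delta>" using False by (simp add: q_def)
    also have "\<dots> = - 4 * ((a - p) * (a - p) + b * c)"
      by (simp add: \<Delta>_def d power2_eq_square algebra_simps)
    finally have qq: "q * q = - ((a - p) * (a - p) + b * c)" by simp
    \<comment> \<open>The second vector is defined by \<open>[e, x] = p x + q y'\<close>; the other
      row is then the characteristic equation.\<close>
    have "heisenberg_ext br e (1 *\<^sub>R x + 0 *\<^sub>R y) (((a - p) / q) *\<^sub>R x + (b / q) *\<^sub>R y)
        ((1 * (b / q) - 0 * ((a - p) / q)) *\<^sub>R z) p q (- q) p"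
      by (rule heisenberg_ext_change[OF A])
        (use b q qq in \<open>simp_all add: d field_simps power2_eq_square\<close>)
    from skt_heisenberg_ext_rotation[OF this] show ?thesis ..
  qed
qed

section \<open>Bases adapted to a hyperplane and a complex structure\<close>

lemma complex_hyperplane_transversal:
  fixes \<epsilon> :: "'a \<Rightarrow> real"
  assumes lJ: "linear J" and JJ: "\<And>v. J (J v) = - v" and l\<epsilon>: "linear \<epsilon>" and y: "\<epsilon> y \<noteq> 0"
  obtains x where "\<epsilon> x = 0" "\<epsilon> (J x) = 1"
proof -
  note ls = linear_simps[OF lJ] linear_simps[OF l\<epsilon>] JJ
  \<comment> \<open>The combination lies in the kernel of \<epsilon>, and
    \<open>\<epsilon> (J x0)\<close> is a sum of two squares.\<close>
  define x0 where "x0 = \<epsilon> (J y) *\<^sub>R y - \<epsilon> y *\<^sub>R J y"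
  define n where "n = \<epsilon> (J x0)"
  have x0: "\<epsilon> x0 = 0" by (simp add: x0_def ls)
  have "n = \<epsilon> (J y) * \<epsilon> (J y) + \<epsilon> y * \<epsilon> y" by (simp add: n_def x0_def ls)
  then have n: "n \<noteq> 0" using y by (metis add.commute sum_squares_eq_zero_iff)
  have "\<epsilon> ((1 / n) *\<^sub>R x0) = 0" "\<epsilon> (J ((1 / n) *\<^sub>R x0)) = 1" using n x0 by (simp_all add: ls n_def)
  then show thesis by (rule that)
qed

lemma complex_hyperplane_basis:
  fixes \<epsilon> :: "'a \<Rightarrow> real"
  assumes dim: "dim (UNIV :: 'a set) = 4" and lJ: "linear J" and JJ: "\<And>v. J (J v) = - v"
    and l\<epsilon>: "linear \<epsilon>" and x: "\<epsilon> x = 0" "\<epsilon> (J x) = 1"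
    and u: "u \<noteq> 0" "\<epsilon> u = 0" "\<epsilon> (J u) = 0"
  shows "basis4 (J x) x u (J u)"
proof (rule basis4I_dim[OF dim])
  note ls = linear_simps[OF lJ] linear_simps[OF l\<epsilon>] JJ
  fix p q r s assume *: "p *\<^sub>R J x + q *\<^sub>R x + r *\<^sub>R u + s *\<^sub>R J u = 0"
  have "\<epsilon> (p *\<^sub>R J x + q *\<^sub>R x + r *\<^sub>R u + s *\<^sub>R J u) = 0"
    "\<epsilon> (J (p *\<^sub>R J x + q *\<^sub>R x + r *\<^sub>R u + s *\<^sub>R J u)) = 0" unfolding * by (simp_all add: ls)
  then have pq: "p = 0" "q = 0" by (simp_all add: ls x u)
  with * have e: "r *\<^sub>R u + s *\<^sub>R J u = 0" by simp
  have "J (r *\<^sub>R u + s *\<^sub>R J u) = 0" unfolding e by (simp add: ls)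
  then have e': "r *\<^sub>R J u - s *\<^sub>R u = 0" by (simp add: ls)
  have "(r * r + s * s) *\<^sub>R u = r *\<^sub>R (r *\<^sub>R u + s *\<^sub>R J u) - s *\<^sub>R (r *\<^sub>R J u - s *\<^sub>R u)"
    by (simp add: algebra_simps)
  also have "\<dots> = 0" unfolding e e' by simp
  finally have "r * r + s * s = 0" using u by simp
  then show "p = 0 \<and> q = 0 \<and> r = 0 \<and> s = 0" using pq by (simp add: sum_squares_eq_zero_iff)
qed

lemma complex_hyperplane_line:
  fixes \<epsilon> :: "'a \<Rightarrow> real"
  assumes dim: "dim (UNIV :: 'a set) = 4" and lJ: "linear J" and JJ: "\<And>v. J (J v) = - v"
    and l\<epsilon>: "linear \<epsilon>" and x: "\<epsilon> x = 0" "\<epsilon> (J x) = 1"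
  obtains u where "u \<noteq> 0" "\<epsilon> u = 0" "\<epsilon> (J u) = 0"
proof -
  note ls = linear_simps[OF lJ] linear_simps[OF l\<epsilon>] JJ
  \<comment> \<open>The projection along \<open>x\<close>, \<open>J x\<close> onto the vectors
    killed by \<epsilon> and by \<epsilon> after \<open>J\<close>; it could vanish only in dimension
    at most two.\<close>
  define \<pi> where "\<pi> v = v - \<epsilon> v *\<^sub>R J x - \<epsilon> (J v) *\<^sub>R x" for v
  have \<pi>: "\<epsilon> (\<pi> v) = 0" "\<epsilon> (J (\<pi> v)) = 0" for v by (simp_all add: \<pi>_def ls x)
  have "\<exists>v. \<pi> v \<noteq> 0"
  proof (rule ccontr)
    assume "\<not> (\<exists>v. \<pi> v \<noteq> 0)"
    then have "v = \<epsilon> v *\<^sub>R J x + \<epsilon> (J v) *\<^sub>R x" for v by (auto simp: \<pi>_def algebra_simps)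
    then have "UNIV \<subseteq> span {J x, x}" unfolding subset_iff span_pair_iff by blast
    then have "dim (UNIV :: 'a set) \<le> card {J x, x}" by (rule dim_le_card) simp
    also have "\<dots> \<le> 2" by (simp add: card_insert_le_m1)
    finally show False using dim by simp
  qed
  then show thesis using that \<pi> by blast
qed

lemma abelian_ext_of_complex_structure:
  assumes dim: "dim (UNIV :: 'a set) = 4" and \<epsilon>: "abelian_ideal \<epsilon>" and J:
    "invariant_complex_structure br J"
  obtains x u p q r s t where "abelian_ext br (J x) x u (J u) p q r s t" "\<epsilon> x = 0" "\<epsilon> (J x) = 1"
    "\<epsilon> u = 0" "\<epsilon> (J u) = 0"
proof -
  have lJ: "linear J" and JJ: "J (J v) = - v" and N: "nijenhuis br J v w = 0" for v w
    using J unfolding invariant_complex_structure_def by auto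
  have l\<epsilon>: "linear \<epsilon>" and ideal: "\<epsilon> (br v w) = 0"
    and ab: "\<epsilon> v = 0 \<Longrightarrow> \<epsilon> w = 0 \<Longrightarrow> br v w = 0" for v w
    using \<epsilon> unfolding abelian_ideal_def by auto
  obtain y where y: "\<epsilon> y \<noteq> 0" using \<epsilon> unfolding abelian_ideal_def by blast
  note ls = linear_simps[OF lJ] linear_simps[OF l\<epsilon>] JJ
  obtain x where x: "\<epsilon> x = 0" "\<epsilon> (J x) = 1"
    by (rule complex_hyperplane_transversal[OF lJ JJ l\<epsilon> y])
  obtain u where u0: "u \<noteq> 0" and u: "\<epsilon> u = 0" "\<epsilon> (J u) = 0"
    by (rule complex_hyperplane_line[OF dim lJ JJ l\<epsilon> x])
  have B: "basis4 (J x) x u (J u)"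
    by (rule complex_hyperplane_basis[OF dim lJ JJ l\<epsilon> x u0 u])
  have comp: "\<exists>q r s. br y z = q *\<^sub>R x + r *\<^sub>R u + s *\<^sub>R J u" for y z
  proof -
    obtain p q r s where e: "br y z = p *\<^sub>R J x + q *\<^sub>R x + r *\<^sub>R u + s *\<^sub>R J u"
      using basis4_obtain[OF B] .
    have "p = 0" using ideal[of y z] unfolding e by (simp add: ls x u)
    with e show ?thesis by auto
  qed
  have N': "br (J x) (J u) = J (br (J x) u)"
    using N[of x u] ab[OF x(1) u(2)] ab[OF x(1) u(1)] by (simp add: nijenhuis_def ls)
  obtain m p q where e: "br (J x) u = m *\<^sub>R x + p *\<^sub>R u + q *\<^sub>R J u" using comp by blast
  \<comment> \<open>Both \<open>[J x, u]\<close> and its image under \<open>J\<close> lie in the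
    ideal, so \<open>[J x, u]\<close> has no \<open>x\<close> component.\<close>
  have "m = 0" using ideal[of "J x" "J u"] unfolding N' e by (simp add: ls x u)
  with e have eu: "br (J x) u = p *\<^sub>R u + q *\<^sub>R J u" by simp
  obtain r s t where ex: "br (J x) x = r *\<^sub>R x + s *\<^sub>R u + t *\<^sub>R J u" using comp by blast
  have "abelian_ext br (J x) x u (J u) p q r s t"
    by (rule abelian_extI[OF B ex eu]) (simp_all add: N' eu ls ab x u)
  then show thesis using x u by (rule that)
qed

lemma no_skt_listed:
  assumes dim: "dim (UNIV :: 'a set) = 4" and sol: "solvable_lie br"
    and J: "invariant_complex_structure br J" and no: "\<not> (\<exists>g J. skt br g J)"
  shows "lie_isomorphic br (lie_prod lie_R (r3 1)) \<or>
          (\<exists>l. l \<ge> 0 \<and> l > 0 \<and> lie_isomorphic br (lie_prod lie_R (r3' l))) \<or>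
          lie_isomorphic br aff_C \<or>
          lie_isomorphic br (r4 1) \<or>
          (\<exists>m l. r4_diag_params m l \<and> ((m = l \<and> l \<noteq> - (1/2)) \<or> (m \<le> l \<and> l = 1)) \<and>
             lie_isomorphic br (r4_diag m l)) \<or>
          (\<exists>m l. m > 0 \<and> l \<noteq> 0 \<and> l \<noteq> - m / 2 \<and> lie_isomorphic br (r4' m l)) \<or>
          (\<exists>l. l \<ge> 1/2 \<and> l \<noteq> 1/2 \<and> l \<noteq> 2 \<and> lie_isomorphic br (d4 l)) \<or>
          lie_isomorphic br h4"
  using solvable_structure[OF dim sol]
proof (elim disjE exE conjE)
  fix \<epsilon> assume "abelian_ideal \<epsilon>"
  then obtain x u p q r s t where A: "abelian_ext br (J x) x u (J u) p q r s t"
    by (rule abelian_ext_of_complex_structure[OF dim _ J])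
  have "p \<noteq> 0" "2 * p + r \<noteq> 0" using skt_abelian_ext[OF A] no by blast+
  from abelian_ext_listed[OF A this] show ?thesis by blast
next
  fix e e' w w' \<delta> assume "plane_ext br e e' w w' \<delta>"
  from plane_ext_listed[OF this] no show ?thesis by blast
next
  fix e x y z a b c d assume "heisenberg_ext br e x y z a b c d" "a * d - b * c \<noteq> 0"
  from heisenberg_ext_listed[OF this] no show ?thesis by blast
qed

end

section \<open>Non-existence of SKT metrics\<close>

lemma hermitian_simps:
  assumes "compatible g J" "inner_product g" "\<And>v. J (J v) = - v"
  shows "g (J x) (J y) = g x y" "g (J x) y = - g x (J y)" "g x (J x) = 0"
proof -
  have b: "bilinear g" using assms(2) by (simp add: inner_product_def)
  have s: "g x y = g y x" for x y using assms(2) unfolding inner_product_def by blast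
  have c: "g (J x) (J y) = g x y" for x y using assms(1) by (simp add: compatible_def)
  show "g (J x) (J y) = g x y" by (rule c)
  show *: "g (J x) y = - g x (J y)" for x y
    using c[of "J x" y] by (simp add: assms(3) bilinear_simps[OF b])
  show "g x (J x) = 0" using *[of x x] s[of "J x" x] by simp
qed

lemma sktD:
  assumes "skt br g J"
  shows "linear J" "J (J v) = - v" "nijenhuis br J v w = 0" "bilinear g" "compatible g J"
    "inner_product g" "g v w = g w v" "v \<noteq> 0 \<Longrightarrow> g v v > 0"
    "ext_d br (J_d_omega br g J) [v, w, y, z] = 0"
proof -
  have c: "invariant_complex_structure br J" and i: "inner_product g" and "compatible g J"
    and T: "\<forall>X Y Z W. ext_d br (J_d_omega br g J) [X, Y, Z, W] = 0"
    using assms unfolding skt_def by - (elim conjE, assumption)+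
  then show "compatible g J" "inner_product g" by simp_all
  show "ext_d br (J_d_omega br g J) [v, w, y, z] = 0" using T by simp
  show "linear J" "J (J v) = - v" "nijenhuis br J v w = 0"
    using c by (simp_all add: invariant_complex_structure_def)
  have i': "bilinear g" "\<forall>X Y. g X Y = g Y X" "\<forall>X. X \<noteq> 0 \<longrightarrow> g X X > 0"
    using i unfolding inner_product_def by - (elim conjE, assumption)+
  show "bilinear g" by (rule i'(1))
  show "g v w = g w v" by (rule i'(2)[rule_format])
  show "v \<noteq> 0 \<Longrightarrow> g v v > 0" by (rule i'(3)[rule_format])
qed

text \<open>Without orthogonality of \<open>x\<close> and \<open>u\<close>, the products listed
  reduce to \<open>g x x\<close>, \<open>g u u\<close>, \<open>g x u\<close> and
  \<open>g x (J u)\<close>; the two mixed ones cancel in the evaluations of the four-form.\<close>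

lemma hermitian_table:
  assumes "skt br g J"
  shows "g (J x) x = 0 \<and> g x (J x) = 0 \<and> g (J x) (J x) = g x x \<and>
    g (J u) u = 0 \<and> g u (J u) = 0 \<and> g (J u) (J u) = g u u \<and>
    g u x = g x u \<and> g (J x) (J u) = g x u \<and> g (J u) (J x) = g x u \<and>
    g (J x) u = - g x (J u) \<and> g u (J x) = - g x (J u) \<and> g (J u) x = g x (J u)"
proof -
  note h = hermitian_simps[OF sktD(5,6,2)[OF assms]] and s = sktD(7)[OF assms]
  have "g (J x) x = 0" "g (J u) u = 0" using h(2)[of x x] h(2)[of u u] h(3) by simp_all
  moreover have "g (J x) u = - g x (J u)" by (rule h(2))
  ultimately show ?thesis
    using h(3)[of x] h(3)[of u] h(1)[of x x] h(1)[of u u] h(1)[of x u] s[of u x]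
      s[of "J u" x] s[of "J u" "J x"] s[of u "J x"] by simp
qed

context lie_bracket
begin

lemma skt_abelian_ext_adapted:
  assumes S: "skt br g J" and A: "abelian_ext br (J x) x u (J u) p q r s t"
  shows "p * (2 * p + r) = 0"
proof -
  note T = sktD(9)[OF S, of x "J x" u "J u"]
  have "ext_d br (J_d_omega br g J) [x, J x, u, J u] = 2 * (p * (2 * p + r)) * g u u"
    by (simp add: ext_d_3 J_d_omega_3[OF sktD(5)[OF S]] abelian_ext_table[OF A] linear_simps[OF
      sktD(1)[OF S]] lin
      sktD(2)[OF S] bilinear_simps[OF sktD(4)[OF S]] hermitian_table[OF S, of x u] algebra_simps)
  moreover have "u \<noteq> 0" using basis4_zeroD(3)[OF abelian_ext_basis[OF A], of 0 0 1 0] by auto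
  then have "g u u > 0" by (rule sktD(8)[OF S])
  ultimately show ?thesis using T by simp
qed

text \<open>The ideal is abelian, so \<open>e\<close> and \<open>e'\<close> induce the same operator
  on it. If the invariant planes agree, \<open>p\<close> and \<open>r\<close> are read off the plane
  and the quotient by it. If they differ, both rotation parts vanish and all eigenvalues
  coincide.\<close>

lemma abelian_ext_unique:
  assumes A: "abelian_ext br e X U W p0 q0 r0 s0 t0" and A': "abelian_ext br e' x u v p q r s t"
    and k: "linear k1" "linear k2" "linear k3" "linear k4"
    and k1: "k1 e = 1" "k1 X = 0" "k1 U = 0" "k1 W = 0"
    and k2: "k2 e = 0" "k2 X = 1" "k2 U = 0" "k2 W = 0"
    and k3: "k3 e = 0" "k3 X = 0" "k3 U = 1" "k3 W = 0"
    and k4: "k4 e = 0" "k4 X = 0" "k4 U = 0" "k4 W = (1::real)"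
    and ex: "\<And>v. v = k1 v *\<^sub>R e + k2 v *\<^sub>R X + k3 v *\<^sub>R U + k4 v *\<^sub>R W"
    and e': "k1 e' = 1" "k1 x = 0" "k1 u = 0" "k1 v = 0"
  shows "p = p0" "r = r0"
proof -
  note kl = linear_simps[OF k(1)] linear_simps[OF k(2)] linear_simps[OF k(3)] linear_simps[OF k(4)]
  have act: "k2 (br e' y) = r0 * k2 y" "k3 (br e' y) = s0 * k2 y + p0 * k3 y - q0 * k4 y"
    "k4 (br e' y) = t0 * k2 y + q0 * k3 y + p0 * k4 y" if "k1 y = 0" for y
  proof -
    have *: "y = k2 y *\<^sub>R X + k3 y *\<^sub>R U + k4 y *\<^sub>R W" using ex[of y] that by simp
    have **: "e' = e + k2 e' *\<^sub>R X + k3 e' *\<^sub>R U + k4 e' *\<^sub>R W" using ex[of e'] e' by simp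
    show "k2 (br e' y) = r0 * k2 y" "k3 (br e' y) = s0 * k2 y + p0 * k3 y - q0 * k4 y"
      "k4 (br e' y) = t0 * k2 y + q0 * k3 y + p0 * k4 y"
      by (subst *, subst **, simp add: lin abelian_ext_table[OF A] kl k2 k3 k4)+
  qed
  note t' = abelian_ext_table[OF A'] and B' = abelian_ext_basis[OF A']
  have E: "p * k2 u + q * k2 v = r0 * k2 u" "p * k2 v - q * k2 u = r0 * k2 v"
    "p * k3 u + q * k3 v = s0 * k2 u + p0 * k3 u - q0 * k4 u"
    "p * k3 v - q * k3 u = s0 * k2 v + p0 * k3 v - q0 * k4 v"
    "p * k4 u + q * k4 v = t0 * k2 u + q0 * k3 u + p0 * k4 u"
    "p * k4 v - q * k4 u = t0 * k2 v + q0 * k3 v + p0 * k4 v"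
    using act[OF e'(3)] act[OF e'(4)] by (simp_all add: t' kl)
  have X: "r * k2 x + s * k2 u + t * k2 v = r0 * k2 x"
    "r * k3 x + s * k3 u + t * k3 v = s0 * k2 x + p0 * k3 x - q0 * k4 x"
    "r * k4 x + s * k4 u + t * k4 v = t0 * k2 x + q0 * k3 x + p0 * k4 x"
    using act[OF e'(2)] by (simp_all add: t' kl)
  have zero: "y = 0" if "k1 y = 0" "k2 y = 0" "k3 y = 0" "k4 y = 0" for y using ex[of y] that
    by simp
  have "p = p0 \<and> r = r0"
  \<comment> \<open>Whether the planes spanned by \<open>u\<close>, \<open>v\<close> and by \<open>U\<close>, \<open>W\<close> coincide.\<close>
  proof (cases "k2 u = 0 \<and> k2 v = 0")
    case True
    define D where "D = k3 u * k4 v - k4 u * k3 v"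
    have "D \<noteq> 0"
    proof
      assume D: "D = 0"
      have 1: "k4 v *\<^sub>R u - k4 u *\<^sub>R v = 0" "k3 v *\<^sub>R u - k3 u *\<^sub>R v = 0"
        by (rule zero; use D True e' in \<open>simp add: kl D_def algebra_simps\<close>)+
      have "k4 u = 0" using basis4_zeroD(4)[OF B', of 0 0 "k4 v" "- k4 u"] 1 by simp
      moreover have "k3 u = 0" using basis4_zeroD(4)[OF B', of 0 0 "k3 v" "- k3 u"] 1 by simp
      ultimately have "u = 0" using zero e' True by simp
      then show False using basis4_zeroD(3)[OF B', of 0 0 1 0] by simp
    qed
    \<comment> \<open>The traces of the operator on the common plane are compared, multiplied by the
      determinant \<open>D\<close> of the change of basis.\<close>
    have "2 * (p - p0) * D = (p * k3 u + q * k3 v - (s0 * k2 u + p0 * k3 u - q0 * k4 u)) * k4 v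
      - (p * k4 u + q * k4 v - (t0 * k2 u + q0 * k3 u + p0 * k4 u)) * k3 v
      + (p * k4 v - q * k4 u - (t0 * k2 v + q0 * k3 v + p0 * k4 v)) * k3 u
      - (p * k3 v - q * k3 u - (s0 * k2 v + p0 * k3 v - q0 * k4 v)) * k4 u"
      unfolding D_def using True by (simp add: algebra_simps)
    also have "\<dots> = 0" unfolding E by simp
    finally have "p = p0" using \<open>D \<noteq> 0\<close> by simp
    moreover have "k2 x \<noteq> 0"
    proof
      assume 0: "k2 x = 0"
      obtain a b c d where "X = a *\<^sub>R e' + b *\<^sub>R x + c *\<^sub>R u + d *\<^sub>R v" using basis4_obtain[OF B'] .
      then have "k1 X = a" "k2 X = a * k2 e'" using e' True 0 by (simp_all add: kl)
      then show False using k1 k2 by simp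
    qed
    then have "r = r0" using X(1) True by simp
    ultimately show ?thesis by simp
  next
    case False
    \<comment> \<open>\<open>y\<close> spans the intersection of the two planes. On the plane of
      \<open>u\<close>, \<open>v\<close> the functional \<open>k2\<close> is a nonzero eigenvector
      of the transposed operator, which leaves no rotation there.\<close>
    define y where "y = k2 v *\<^sub>R u - k2 u *\<^sub>R v"
    have ss: "k2 u * k2 u + k2 v * k2 v \<noteq> 0" using False by (simp add: sum_squares_eq_zero_iff)
    have "q * (k2 u * k2 u + k2 v * k2 v) = (p * k2 u + q * k2 v) * k2 v - (p * k2 v
      - q * k2 u) * k2 u"
      by (simp add: algebra_simps)
    also have "\<dots> = 0" unfolding E by simp
    finally have q: "q = 0" using ss by (metis mult_eq_0_iff)
    have p: "p = r0" using E(1,2) False q by auto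
    have y0: "y \<noteq> 0"
    proof
      assume "y = 0"
      then show False using basis4_zeroD(3,4)[OF B', of 0 0 "k2 v" "- k2 u"] False
        by (simp add: y_def)
    qed
    have y: "k1 y = 0" "k2 y = 0" using e' by (simp_all add: y_def kl)
    have "br e' y = p *\<^sub>R y" by (simp add: y_def lin t' q algebra_simps)
    then have "p * k3 y = p0 * k3 y - q0 * k4 y" "p * k4 y = q0 * k3 y + p0 * k4 y"
      using act[OF y(1)] y(2) by (simp_all add: kl)
    then have eq: "(p - p0) * k3 y = - q0 * k4 y" "(p - p0) * k4 y = q0 * k3 y"
      by (simp_all add: algebra_simps)
    have nz: "k3 y * k3 y + k4 y * k4 y \<noteq> 0"
      using y0 zero[OF y] by (auto simp: sum_squares_eq_zero_iff)
    have "(p - p0) * (k3 y * k3 y + k4 y * k4 y) = ((p - p0) * k3 y) * k3 y + ((p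
      - p0) * k4 y) * k4 y"
      by (simp add: algebra_simps)
    also have "\<dots> = 0" unfolding eq by (simp add: algebra_simps)
    finally have pp: "p = p0" using nz by (metis mult_eq_0_iff eq_iff_diff_eq_0)
    have "q0 * k4 y = 0" "q0 * k3 y = 0" using eq pp by simp_all
    then have q0: "q0 = 0" using nz by auto
    \<comment> \<open>\<open>z\<close> lies in the plane of \<open>U\<close>, \<open>W\<close>,
      where the operator is now the scalar \<open>p\<close>. So applying \<open>ad e' - p\<close>
      twice kills \<open>x\<close>, and the \<open>x\<close> coefficient of the result is the square
      of \<open>r - p\<close>.\<close>
    define z where "z = br e' x - p *\<^sub>R x"
    have z: "z = (r - p) *\<^sub>R x + s *\<^sub>R u + t *\<^sub>R v" by (simp add: z_def t' algebra_simps)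
    have kz: "k1 z = 0" by (simp add: z kl e')
    have kz2: "k2 z = 0" by (simp add: z_def kl act[OF e'(2)] p)
    have kb: "k1 (br e' z) = 0" by (simp add: z lin t' kl e')
    have "br e' z - p *\<^sub>R z = 0"
      by (rule zero) (simp_all add: kl kb kz kz2 act[OF kz] pp q0)
    moreover define \<rho> where "\<rho> = r - p"
    then have \<rho>: "r = \<rho> + p" by simp
    have "br e' z - p *\<^sub>R z = 0 *\<^sub>R e' + (\<rho> * \<rho>) *\<^sub>R x + (\<rho> * s) *\<^sub>R u + (\<rho> * t) *\<^sub>R v"
      by (simp add: z lin t' q \<rho> algebra_simps)
    ultimately have "\<rho> * \<rho> = 0" using basis4_zeroD(2)[OF B'] by metis
    then show ?thesis using pp p \<rho> by simp
  qed
  then show "p = p0" "r = r0" by simp_all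
qed

lemma no_skt_abelian_ext:
  assumes A: "abelian_ext br e X U W p0 q0 r0 s0 t0" and nz: "p0 \<noteq> 0" "2 * p0 + r0 \<noteq> 0"
  shows "\<not> skt br g J"
proof
  assume S: "skt br g J"
  note B = abelian_ext_basis[OF A]
  obtain k1 k2 k3 k4 where k: "linear k1" "linear k2" "linear k3" "linear k4"
    "\<And>v. v = k1 v *\<^sub>R e + k2 v *\<^sub>R X + k3 v *\<^sub>R U + k4 v *\<^sub>R W"
    "k1 e = 1" "k1 X = 0" "k1 U = 0" "k1 W = 0"
    "k2 e = 0" "k2 X = 1" "k2 U = 0" "k2 W = 0"
    "k3 e = 0" "k3 X = 0" "k3 U = 1" "k3 W = 0"
    "k4 e = 0" "k4 X = 0" "k4 U = 0" "k4 W = (1::real)"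
    using basis4_coords[OF B] by metis
  have "abelian_ideal k1"
    unfolding abelian_ideal_def
  proof (intro conjI allI impI)
    show "\<exists>x. k1 x \<noteq> 0" using k(6) by (metis zero_neq_one)
    fix v w
    show "k1 (br v w) = 0"
      by (subst k(5)[of v], subst k(5)[of w])
        (simp add: lin abelian_ext_table[OF A] linear_simps[OF k(1)] k(7-9))
    assume "k1 v = 0" "k1 w = 0"
    then show "br v w = 0"
      by (subst k(5)[of v], subst k(5)[of w]) (simp add: lin abelian_ext_table[OF A])
  qed (rule k)
  moreover have "invariant_complex_structure br J" using S by (simp add: skt_def)
  ultimately obtain x u p q r s t where A': "abelian_ext br (J x) x u (J u) p q r s t"
    and e: "k1 x = 0" "k1 (J x) = 1" "k1 u = 0" "k1 (J u) = 0"
    by (rule abelian_ext_of_complex_structure[OF basis4_dim[OF B]])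
  have "p = p0" "r = r0" by (rule abelian_ext_unique[OF A A' k(1-4,6-21,5) e(2,1,3,4)])+
  with skt_abelian_ext_adapted[OF S A'] nz show False by simp
qed


text \<open>The first alternative is a complex linear action modulo the centre, written on
  \<open>u\<close> and \<open>J u\<close>. The others are the two factors of the value: \<alpha> +
  \<beta> = 0, and 2 \<alpha> + \<beta> = 0 in the form that \<alpha> = - (\<open>a + d\<close>) is
  an eigenvalue. All are conditions on the matrix, free of \<open>g\<close> and
  \<open>J\<close>.\<close>

lemma skt_heisenberg_ext_cases:
  assumes A: "heisenberg_ext br e x y z a b c d" and S: "skt br g J"
  shows "(\<exists>p q s t s' t'. s * t' - s' * t \<noteq> 0 \<and>
      s * a + t * c = p * s + q * s' \<and> s * b + t * d = p * t + q * t' \<and>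
      s' * a + t' * c = p * s' - q * s \<and> s' * b + t' * d = p * t' - q * t) \<or>
    a + d = 0 \<or>
    (\<exists>s t. (s, t) \<noteq> (0, 0) \<and> s * a + t * c = - (a + d) * s \<and> s * b + t * d = - (a + d) * t)"
proof -
  note B = heisenberg_ext_basis[OF A] and tab = heisenberg_ext_table[OF A]
  note dim = basis4_dim[OF B]
  note lJ = sktD(1)[OF S] and JJ = sktD(2)[OF S] and N = sktD(3)[OF S]
  obtain k1 k2 k3 k4 where k: "linear k1" "linear k2" "linear k3" "linear k4"
    and ex: "\<And>v. v = k1 v *\<^sub>R e + k2 v *\<^sub>R x + k3 v *\<^sub>R y + k4 v *\<^sub>R z"
    and k1: "k1 e = 1" "k1 x = 0" "k1 y = 0" "k1 z = 0"
    and k2: "k2 e = 0" "k2 x = 1" "k2 y = 0" "k2 z = 0"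
    and k3: "k3 e = 0" "k3 x = 0" "k3 y = 1" "k3 z = 0"
    and k4: "k4 e = 0" "k4 x = 0" "k4 y = 0" "k4 z = (1::real)"
    using basis4_coords[OF B] by metis
  note kl = linear_simps[OF k(1)] linear_simps[OF k(2)] linear_simps[OF k(3)] linear_simps[OF k(4)]
  note Jl = linear_simps[OF lJ] JJ
  have e0: "k1 e \<noteq> 0" using k1 by simp
  have ker: "v = k2 v *\<^sub>R x + k3 v *\<^sub>R y + k4 v *\<^sub>R z" if "k1 v = 0" for v using ex[of v] that
    by simp
  have ideal: "k1 (br v w) = 0" for v w
    by (subst ex[of v], subst ex[of w]) (simp add: lin tab kl k1)
  have heis: "br v w = (k2 v * k3 w - k3 v * k2 w) *\<^sub>R z" if "k1 v = 0" "k1 w = 0" for v w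
    by (subst ker[OF that(1)], subst ker[OF that(2)]) (simp add: lin tab algebra_simps)
  have one: "f = e + k2 f *\<^sub>R x + k3 f *\<^sub>R y + k4 f *\<^sub>R z" if "k1 f = 1" for f
    using ex[of f] that by simp
  have actz: "br f z = (a + d) *\<^sub>R z" if "k1 f = 1" for f
    by (subst one[OF that]) (simp add: lin tab)
  have act: "k2 (br f v) = k2 v * a + k3 v * c" "k3 (br f v) = k2 v * b + k3 v * d"
    if "k1 f = 1" "k1 v = 0" for f v
    by (subst one[OF that(1)], subst ker[OF that(2)], simp add: lin tab kl k2 k3 algebra_simps)+
  have z0: "z \<noteq> 0" using basis4_zeroD(4)[OF B, of 0 0 0 1] by auto
  show ?thesis
  proof (cases "k1 (J z) = 0")
    case False
    define X where "X = (1 / k1 (J z)) *\<^sub>R z"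
    have X: "k1 X = 0" "k1 (J X) = 1" using False by (simp_all add: X_def kl Jl k1)
    have zX: "z = k1 (J z) *\<^sub>R X" using False by (simp add: X_def)
    obtain u where u0: "u \<noteq> 0" and u: "k1 u = 0" "k1 (J u) = 0"
      by (rule complex_hyperplane_line[OF dim lJ JJ k(1) X])
    have B': "basis4 (J X) X u (J u)"
      by (rule complex_hyperplane_basis[OF dim lJ JJ k(1) X u0 u])
    have cX: "br X v = 0" if "k1 v = 0" for v
      using heis[OF X(1) that] by (simp add: X_def kl k2 k3)
    have N': "br (J X) (J u) = J (br (J X) u)"
      using N[of X u] cX u by (simp add: nijenhuis_def Jl)
    obtain n m p q where e1: "br (J X) u = n *\<^sub>R J X + m *\<^sub>R X + p *\<^sub>R u + q *\<^sub>R J u"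
      using basis4_obtain[OF B'] .
    have "n = 0" using ideal[of "J X" u] unfolding e1 by (simp add: kl X u)
    moreover have "m = 0" using ideal[of "J X" "J u"] unfolding N' e1 by (simp add: kl Jl X u)
    ultimately have eu: "br (J X) u = p *\<^sub>R u + q *\<^sub>R J u" using e1 by simp
    have eJu: "br (J X) (J u) = p *\<^sub>R J u - q *\<^sub>R u" unfolding N' eu by (simp add: Jl)
    \<comment> \<open>The centre is spanned by \<open>X\<close>, so it meets the plane of
      \<open>u\<close>, \<open>J u\<close> only in zero.\<close>
    have dep: "v = 0" if "v = \<alpha> *\<^sub>R u + \<beta> *\<^sub>R J u" "k2 v = 0" "k3 v = 0" for v \<alpha> \<beta>
    proof -
      have "k1 v = 0" using that(1) u by (simp add: kl)
      then have "v = k4 v *\<^sub>R z" using ker[of v] that by simp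
      then have "v = (k4 v * k1 (J z)) *\<^sub>R X" by (subst (asm) zX) simp
      then have "0 *\<^sub>R J X + (k4 v * k1 (J z)) *\<^sub>R X + (- \<alpha>) *\<^sub>R u + (- \<beta>) *\<^sub>R J u = 0"
        using that(1) by simp
      from basis4_zeroD(3,4)[OF B' this] that(1) show ?thesis by simp
    qed
    have "k2 u * k3 (J u) - k2 (J u) * k3 u \<noteq> 0"
    proof
      assume D: "k2 u * k3 (J u) - k2 (J u) * k3 u = 0"
      have 1: "k3 (J u) *\<^sub>R u + (- k3 u) *\<^sub>R J u = 0"
        by (rule dep[OF refl]) (use D in \<open>simp_all add: kl algebra_simps\<close>)
      have 2: "k2 (J u) *\<^sub>R u + (- k2 u) *\<^sub>R J u = 0"
        by (rule dep[OF refl]) (use D in \<open>simp_all add: kl algebra_simps\<close>)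
      have "k3 u = 0" using basis4_zeroD(4)[OF B', of 0 0 "k3 (J u)" "- k3 u"] 1 by simp
      moreover have "k2 u = 0" using basis4_zeroD(4)[OF B', of 0 0 "k2 (J u)" "- k2 u"] 2 by simp
      ultimately have "u = 0" using dep[of u 1 0] by simp
      with u0 show False ..
    qed
    moreover have "k2 u * a + k3 u * c = p * k2 u + q * k2 (J u)"
      "k2 u * b + k3 u * d = p * k3 u + q * k3 (J u)"
      "k2 (J u) * a + k3 (J u) * c = p * k2 (J u) - q * k2 u"
      "k2 (J u) * b + k3 (J u) * d = p * k3 (J u) - q * k3 u"
      using act[OF X(2) u(1)] act[OF X(2) u(2)] unfolding eu eJu by (simp_all add: kl)
    ultimately show ?thesis by blast
  next
    case True
    obtain X where X: "k1 X = 0" "k1 (J X) = 1"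
      by (rule complex_hyperplane_transversal[OF lJ JJ k(1) e0])
    have B': "basis4 (J X) X z (J z)"
      by (rule complex_hyperplane_basis[OF dim lJ JJ k(1) X z0 k1(4) True])
    define \<tau> \<kappa> where "\<tau> = a + d" and "\<kappa> = k2 X * k3 (J z) - k3 X * k2 (J z)"
    have t1: "br (J X) z = \<tau> *\<^sub>R z" using actz[OF X(2)] by (simp add: \<tau>_def)
    have t2: "br X (J z) = \<kappa> *\<^sub>R z" using heis[OF X(1) True] by (simp add: \<kappa>_def)
    have t3: "br X z = 0" "br z (J z) = 0" using heis[OF X(1) k1(4)] heis[OF k1(4) True]
      by (simp_all add: k2 k3)
    \<comment> \<open>Integrability at \<open>X\<close>, \<open>z\<close> makes \<open>J z\<close>
      an eigenvector; \<tau> + \<kappa> is the eigenvalue \<alpha>.\<close>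
    have t4: "br (J X) (J z) = (\<tau> + \<kappa>) *\<^sub>R J z"
      using N[of X z] t1 t2 t3 by (simp add: nijenhuis_def Jl algebra_simps)
    obtain n m l i where e1: "br (J X) X = n *\<^sub>R J X + m *\<^sub>R X + l *\<^sub>R z + i *\<^sub>R J z"
      using basis4_obtain[OF B'] .
    have "n = 0" using ideal[of "J X" X] unfolding e1 by (simp add: kl X k1 True)
    with e1 have t5: "br (J X) X = m *\<^sub>R X + l *\<^sub>R z + i *\<^sub>R J z" by simp
    have sw: "br z (J X) = - (\<tau> *\<^sub>R z)" "br (J z) X = - (\<kappa> *\<^sub>R z)" "br z X = 0" "br (J z) z = 0"
      "br (J z) (J X) = - ((\<tau> + \<kappa>) *\<^sub>R J z)" "br X (J X) = - (m *\<^sub>R X + l *\<^sub>R z + i *\<^sub>R J z)"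
      using swap[of z "J X"] swap[of "J z" X] swap[of z X] swap[of "J z" z] swap[of "J z"
        "J X"] swap[of X "J X"]
        t1 t2 t3 t4 t5 by simp_all
    note t = t1 t2 t3 t4 t5 sw
    \<comment> \<open>\<open>X\<close>, \<open>z\<close> and \<open>J z\<close> span the Heisenberg
      ideal, which would be abelian for \<kappa> = 0.\<close>
    have \<kappa>: "\<kappa> \<noteq> 0"
    proof
      assume 0: "\<kappa> = 0"
      obtain p1 p2 p3 p4 where px: "x = p1 *\<^sub>R J X + p2 *\<^sub>R X + p3 *\<^sub>R z + p4 *\<^sub>R J z"
        using basis4_obtain[OF B'] .
      obtain q1 q2 q3 q4 where qy: "y = q1 *\<^sub>R J X + q2 *\<^sub>R X + q3 *\<^sub>R z + q4 *\<^sub>R J z"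
        using basis4_obtain[OF B'] .
      have "p1 = 0" using arg_cong[OF px, of k1] by (simp add: kl X k1 True)
      moreover have "q1 = 0" using arg_cong[OF qy, of k1] by (simp add: kl X k1 True)
      ultimately have "br x y = 0" by (subst px, subst qy) (simp add: lin t 0)
      then show False using tab(4) z0 by simp
    qed
    \<comment> \<open>The other eigenvalue \<beta> results from applying \<open>ad (J X)\<close> to
      \<open>[X, J z] = \<kappa> z\<close>.\<close>
    have "m = - \<kappa>"
    proof -
      have "(\<kappa> * \<tau>) *\<^sub>R z = (m * \<kappa> + (\<tau> + \<kappa>) * \<kappa>) *\<^sub>R z"
        using derivation[of "J X" X "J z"] by (simp add: t lin algebra_simps)
      then have "\<kappa> * \<tau> = m * \<kappa> + (\<tau> + \<kappa>) * \<kappa>" using z0 by (simp only: scaleR_cancel_right simp_thms)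
      then have "\<kappa> * (m + \<kappa>) = 0" by (simp add: algebra_simps)
      then show ?thesis using \<kappa> by simp
    qed
    note t = t[unfolded this]
    have "ext_d br (J_d_omega br g J) [X, J X, z, J z] = 2 * (\<tau> * (2 * \<tau> + \<kappa>)) * g z z"
      by (simp add: ext_d_3 J_d_omega_3[OF sktD(5)[OF S]] t Jl lin
        bilinear_simps[OF sktD(4)[OF S]] hermitian_table[OF S, of X z] algebra_simps)
    then have "\<tau> = 0 \<or> \<kappa> = - 2 * \<tau>"
      using sktD(9)[OF S, of X "J X" z "J z"] sktD(8)[OF S z0] by auto
    then show ?thesis
    proof
      assume "\<tau> = 0"
      then show ?thesis by (simp add: \<tau>_def)
    next
      assume "\<kappa> = - 2 * \<tau>"
      then have "br (J X) (J z) = (- \<tau>) *\<^sub>R J z" using t4 by simp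
      then have "k2 (J z) * a + k3 (J z) * c = - (a + d) * k2 (J z)"
        "k2 (J z) * b + k3 (J z) * d = - (a + d) * k3 (J z)"
        using act[OF X(2) True] by (simp_all add: kl \<tau>_def)
      moreover have "(k2 (J z), k3 (J z)) \<noteq> (0, 0)"
      proof
        assume "(k2 (J z), k3 (J z)) = (0, 0)"
        then have "J z = k4 (J z) *\<^sub>R z" using ker[OF True] by simp
        then have "0 *\<^sub>R J X + 0 *\<^sub>R X + k4 (J z) *\<^sub>R z + (- 1) *\<^sub>R J z = 0" by simp
        from basis4_zeroD(4)[OF B' this] show False by simp
      qed
      ultimately show ?thesis by blast
    qed
  qed
qed

text \<open>A complex linear action would force \<open>l = 1 - l\<close>; the trace is 1; and -1 is
  an eigenvalue only for \<open>l = - 1\<close> or \<open>l = 2\<close>.\<close>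

lemma no_skt_d4:
  assumes A: "heisenberg_ext br e x y z l 0 0 (1 - l)" and l: "l > 1 / 2" "l \<noteq> 2"
  shows "\<not> skt br g J"
proof
  assume "skt br g J"
  from skt_heisenberg_ext_cases[OF A this] show False
  proof (elim disjE exE conjE)
    fix p q s t s' t' :: real
    assume D: "s * t' - s' * t \<noteq> 0" and e: "s * l + t * 0 = p * s + q * s'"
      "s * 0 + t * (1 - l) = p * t + q * t'" "s' * l + t' * 0 = p * s' - q * s"
      "s' * 0 + t' * (1 - l) = p * t' - q * t"
    have "(l - p) * s = q * s'" "(l - p) * s' = - q * s" using e by (simp_all add: algebra_simps)
    then have "(l - p) * (s * s + s' * s') = 0" by (simp add: distrib_left flip: mult.assoc)
    moreover have "s * s + s' * s' \<noteq> 0" using D by (auto simp: sum_squares_eq_zero_iff)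
    ultimately have 1: "l = p" by (metis mult_eq_0_iff eq_iff_diff_eq_0)
    have "(1 - l - p) * t = q * t'" "(1 - l - p) * t' = - q * t" using e
      by (simp_all add: algebra_simps)
    then have "(1 - l - p) * (t * t + t' * t') = 0" by (simp add: distrib_left flip: mult.assoc)
    moreover have "t * t + t' * t' \<noteq> 0" using D by (auto simp: sum_squares_eq_zero_iff)
    ultimately have "1 - l - p = 0" by (metis mult_eq_0_iff)
    with 1 l show False by simp
  next
    fix s t assume nz: "(s, t) \<noteq> (0, 0)"
      and e: "s * l + t * 0 = - (l + (1 - l)) * s" "s * 0 + t * (1 - l) = - (l + (1 - l)) * t"
    have "s * (l + 1) = 0" "t * (2 - l) = 0" using e by (simp_all add: algebra_simps)
    with nz l show False by auto
  qed simp
qed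

text \<open>A Jordan block is not complex linear, its trace is 2, and its only eigenvalue is 1
  rather than -2.\<close>

lemma no_skt_h4:
  assumes A: "heisenberg_ext br e x y z 1 0 1 1"
  shows "\<not> skt br g J"
proof
  assume "skt br g J"
  from skt_heisenberg_ext_cases[OF A this] show False
  proof (elim disjE exE conjE)
    fix p q s t s' t' :: real
    assume D: "s * t' - s' * t \<noteq> 0" and e: "s * 1 + t * 1 = p * s + q * s'"
      "s * 0 + t * 1 = p * t + q * t'" "s' * 1 + t' * 1 = p * s' - q * s"
      "s' * 0 + t' * 1 = p * t' - q * t"
    have *: "(1 - p) * t = q * t'" "(1 - p) * t' = - q * t" using e by (simp_all add: algebra_simps)
    then have "(1 - p) * (t * t + t' * t') = 0" by (simp add: distrib_left flip: mult.assoc)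
    moreover have nz: "t * t + t' * t' \<noteq> 0" using D by (auto simp: sum_squares_eq_zero_iff)
    ultimately have p: "p = 1" by (metis mult_eq_0_iff eq_iff_diff_eq_0)
    then have "q * t = 0" "q * t' = 0" using * by simp_all
    then have "q = 0" using nz by auto
    with e p D show False by simp
  next
    fix s t :: real assume "(s, t) \<noteq> (0, 0)" and "s * 1 + t * 1 = - (1 + 1) * s"
      "s * 0 + t * 1 = - (1 + 1) * t"
    then show False by simp
  qed simp
qed

text \<open>If \<open>J\<close> preserves the plane, integrability makes it commute there with
  \<open>ad e'\<close>, so it is plus or minus \<open>ad e'\<close>, and the four-form becomes a
  positive multiple of \<open>g w w\<close>.\<close>

lemma no_skt_plane_invariant:
  assumes A: "plane_ext br e e' w w' (- 1)" and S: "skt br g J"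
    and Jw: "J w = \<alpha> *\<^sub>R w + \<beta> *\<^sub>R w'"
  shows False
proof -
  note B = plane_ext_basis[OF A] and tab = plane_ext_table[OF A]
  note lJ = sktD(1)[OF S] and JJ = sktD(2)[OF S] and N = sktD(3)[OF S]
  note Jl = linear_simps[OF lJ] JJ
  have JJw: "\<alpha> *\<^sub>R J w + \<beta> *\<^sub>R J w' = - w" using JJ[of w] by (simp add: Jw Jl)
  have "\<beta> \<noteq> 0"
  proof
    assume 0: "\<beta> = 0"
    then have "0 *\<^sub>R e + 0 *\<^sub>R e' + (\<alpha> * \<alpha> + 1) *\<^sub>R w + 0 *\<^sub>R w' = 0"
      using JJw by (simp add: Jw algebra_simps)
    from basis4_zeroD(3)[OF B this] show False
      by (metis add.commute le_add_same_cancel1 not_one_le_zero zero_le_square)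
  qed
  define \<gamma> \<delta> where "\<gamma> = - (1 + \<alpha> * \<alpha>) / \<beta>" and "\<delta> = - \<alpha>"
  have Jw': "J w' = \<gamma> *\<^sub>R w + \<delta> *\<^sub>R w'"
  proof -
    have "\<beta> *\<^sub>R J w' = - w - \<alpha> *\<^sub>R J w" using JJw by (simp add: algebra_simps)
    also have "\<dots> = (\<beta> * \<gamma>) *\<^sub>R w + (\<beta> * \<delta>) *\<^sub>R w'"
    proof -
      have "\<beta> * \<gamma> = - (1 + \<alpha> * \<alpha>)" using \<open>\<beta> \<noteq> 0\<close> by (simp add: \<gamma>_def)
      then show ?thesis by (simp only: Jw \<delta>_def) (simp add: algebra_simps)
    qed
    also have "\<dots> = \<beta> *\<^sub>R (\<gamma> *\<^sub>R w + \<delta> *\<^sub>R w')" by (simp add: algebra_simps)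
    finally show ?thesis using \<open>\<beta> \<noteq> 0\<close> by simp
  qed
  obtain s t m n where Je: "J e = s *\<^sub>R e + t *\<^sub>R e' + m *\<^sub>R w + n *\<^sub>R w'"
    using basis4_obtain[OF B] .
  \<comment> \<open>\<open>J\<close> induces a complex structure on the quotient by the plane, where
    \<open>e\<close> cannot be a real eigenvector.\<close>
  have t0: "t \<noteq> 0"
  proof
    assume 0: "t = 0"
    have "J (J e) = (s * s) *\<^sub>R e + 0 *\<^sub>R e' + (s * m + m * \<alpha> + n * \<gamma>) *\<^sub>R w + (s * n + m * \<beta>
      + n * \<delta>) *\<^sub>R w'"
      by (subst Je, simp add: linear_simps[OF lJ] 0 Jw Jw', subst Je, simp add: 0 algebra_simps)
    moreover have "(s * s + 1) *\<^sub>R e + 0 *\<^sub>R e' + (s * m + m * \<alpha> + n * \<gamma>) *\<^sub>R w + (s * n + m * \<beta>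
      + n * \<delta>) *\<^sub>R w'
      = ((s * s) *\<^sub>R e + 0 *\<^sub>R e' + (s * m + m * \<alpha> + n * \<gamma>) *\<^sub>R w + (s * n + m * \<beta>
        + n * \<delta>) *\<^sub>R w') + e"
      by (simp add: algebra_simps)
    ultimately have "(s * s + 1) *\<^sub>R e + 0 *\<^sub>R e' + (s * m + m * \<alpha> + n * \<gamma>) *\<^sub>R w + (s * n
      + m * \<beta> + n * \<delta>) *\<^sub>R w' = 0"
      using JJ[of e] by (metis add.left_inverse)
    from basis4_zeroD(1)[OF B this] show False
      by (metis add.commute le_add_same_cancel1 not_one_le_zero zero_le_square)
  qed
  have eJw: "br e (J w) = J w" by (simp add: Jw lin tab)
  have "br (J e) (J w) = J (br (J e) w)"
    using N[of e w] by (simp add: nijenhuis_def eJw JJ tab)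
  moreover have "br (J e) (J w) = s *\<^sub>R J w + t *\<^sub>R (\<alpha> *\<^sub>R w' - \<beta> *\<^sub>R w)"
    by (simp add: Je Jw tab lin algebra_simps)
  moreover have "br (J e) w = s *\<^sub>R w + t *\<^sub>R w'" by (simp add: Je tab lin algebra_simps)
  ultimately have "t *\<^sub>R (\<alpha> *\<^sub>R w' - \<beta> *\<^sub>R w) = t *\<^sub>R J w'" by (simp add: linear_simps[OF lJ])
  then have "\<alpha> *\<^sub>R w' - \<beta> *\<^sub>R w = J w'" using t0 by (simp only: scaleR_cancel_left simp_thms)
  then have "0 *\<^sub>R e + 0 *\<^sub>R e' + (- \<beta>) *\<^sub>R w + \<alpha> *\<^sub>R w' = 0 *\<^sub>R e + 0 *\<^sub>R e' + \<gamma> *\<^sub>R w + \<delta> *\<^sub>R w'"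
    unfolding Jw' by (simp add: algebra_simps)
  note c = basis4_eqD(3,4)[OF B this]
  then have \<alpha>: "\<alpha> = 0" by (simp add: \<delta>_def)
  with c \<open>\<beta> \<noteq> 0\<close> have \<beta>: "\<beta> * \<beta> = 1" by (simp add: \<gamma>_def field_simps)
  have Jw0: "J w = \<beta> *\<^sub>R w'" using Jw \<alpha> by simp
  then have w': "w' = \<beta> *\<^sub>R J w" using \<beta> by simp
  have t1: "br (J e) w = s *\<^sub>R w + (t * \<beta>) *\<^sub>R J w"
    using \<open>br (J e) w = s *\<^sub>R w + t *\<^sub>R w'\<close> w' by simp
  have t2: "br (J e) (J w) = s *\<^sub>R J w - (t * \<beta>) *\<^sub>R w"
    using \<open>br (J e) (J w) = s *\<^sub>R J w + t *\<^sub>R (\<alpha> *\<^sub>R w' - \<beta> *\<^sub>R w)\<close> \<alpha> by simp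
  have t3: "br e w = w" "br e (J w) = J w" "br w (J w) = 0" by (simp_all add: Jw0 lin tab)
  have t4: "br e (J e) = m *\<^sub>R w + (n * \<beta>) *\<^sub>R J w" by (simp add: Je lin tab) (simp add: w')
  have sw: "br w (J e) = - (s *\<^sub>R w + (t * \<beta>) *\<^sub>R J w)"
    "br (J w) (J e) = - (s *\<^sub>R J w - (t * \<beta>) *\<^sub>R w)"
    "br w e = - w" "br (J w) e = - J w" "br (J w) w = 0"
      "br (J e) e = - (m *\<^sub>R w + (n * \<beta>) *\<^sub>R J w)"
    using swap[of w "J e"] swap[of "J w" "J e"] swap[of w e] swap[of "J w" e] swap[of
      "J w" w] swap[of "J e" e]
      t1 t2 t3 t4 by simp_all
  have "ext_d br (J_d_omega br g J) [e, J e, w, J w] = 4 * (1 + s * s) * g w w"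
    by (simp add: ext_d_3 J_d_omega_3[OF sktD(5)[OF S]] t1 t2 t3 t4 sw Jl lin
        bilinear_simps[OF sktD(4)[OF S]] hermitian_table[OF S, of e w] algebra_simps)
  moreover have "w \<noteq> 0" using basis4_zeroD(3)[OF B, of 0 0 1 0] by auto
  then have "g w w > 0" by (rule sktD(8)[OF S])
  moreover have "1 + s * s > 0" by (simp add: add_pos_nonneg)
  ultimately show False using sktD(9)[OF S, of e "J e" w "J w"] by simp
qed

text \<open>\<open>w\<close> is multiplied by the complex number \<open>a + b i\<close>, where
  \<open>i\<close> is the action of \<open>e'\<close>.\<close>

lemma plane_ext_rotate:
  assumes A: "plane_ext br e e' w w' (- 1)" and nz: "a \<noteq> 0 \<or> b \<noteq> 0"
  shows "plane_ext br e e' (a *\<^sub>R w + b *\<^sub>R w') (a *\<^sub>R w' - b *\<^sub>R w) (- 1)"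
proof (rule plane_extI)
  have "a * a - b * (- b) \<noteq> 0" using nz by (simp add: sum_squares_eq_zero_iff)
  then show "basis4 e e' (a *\<^sub>R w + b *\<^sub>R w') (a *\<^sub>R w' - b *\<^sub>R w)"
    using basis4_block[OF plane_ext_basis[OF A], of 1 1 0 0 a a b "- b" 0 0 0 0]
      by (simp add: algebra_simps)
qed (simp_all add: lin plane_ext_table[OF A] algebra_simps)

text \<open>
  By the preceding lemma no nonzero vector of the ideal spanned by \<open>w\<close>, \<open>w'\<close> is mapped into it by
  \<open>J\<close>. Then \<open>ad \<circ> J\<close> is complex linear on this ideal, and rescaling \<open>w\<close> by a complex number makes
  \<open>ad (J w)\<close> the identity there.
\<close>

lemma no_skt_aff_C:
  assumes A: "plane_ext br e e' w w' (- 1)"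
  shows "\<not> skt br g J"
proof
  assume S: "skt br g J"
  note B = plane_ext_basis[OF A] and tab = plane_ext_table[OF A]
  note lJ = sktD(1)[OF S] and JJ = sktD(2)[OF S] and N = sktD(3)[OF S]
  note Jl = linear_simps[OF lJ] JJ
  have inv: "a = 0 \<and> b = 0" if h: "J (a *\<^sub>R w + b *\<^sub>R w') = c *\<^sub>R w + d *\<^sub>R w'" for a b c d
  proof (rule ccontr)
    assume nz: "\<not> (a = 0 \<and> b = 0)"
    define n where "n = a * a + b * b"
    have n: "n \<noteq> 0" using nz by (simp add: n_def sum_squares_eq_zero_iff)
    \<comment> \<open>The coefficients are the real and imaginary parts of
      \<open>(c + d i) / (a + b i)\<close>.\<close>
    have "J (a *\<^sub>R w + b *\<^sub>R w') = ((c * a + d * b) / n) *\<^sub>R (a *\<^sub>R w + b *\<^sub>R w') + ((d * a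
      - c * b) / n) *\<^sub>R (a *\<^sub>R w' - b *\<^sub>R w)"
    proof -
      have "(c * a + d * b) / n * a - (d * a - c * b) / n * b = c"
        "(c * a + d * b) / n * b + (d * a - c * b) / n * a = d"
        using n by (simp_all add: field_simps) (simp_all add: n_def algebra_simps)
      then have "c *\<^sub>R w + d *\<^sub>R w' = ((c * a + d * b) / n * a - (d * a - c * b) / n * b) *\<^sub>R w
        + ((c * a + d * b) / n * b + (d * a - c * b) / n * a) *\<^sub>R w'" by simp
      then show ?thesis unfolding h by (simp add: algebra_simps)
    qed
    from no_skt_plane_invariant[OF plane_ext_rotate[OF A] S this] nz show False by blast
  qed
  obtain a1 a2 m1 m2 where Jw: "J w = a1 *\<^sub>R e + a2 *\<^sub>R e' + m1 *\<^sub>R w + m2 *\<^sub>R w'"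
    using basis4_obtain[OF B] .
  obtain b1 b2 n1 n2 where Jw': "J w' = b1 *\<^sub>R e + b2 *\<^sub>R e' + n1 *\<^sub>R w + n2 *\<^sub>R w'"
    using basis4_obtain[OF B] .
  have 1: "br (J w) w' = (- a2) *\<^sub>R w + a1 *\<^sub>R w'" "br w (J w') = (- b1) *\<^sub>R w + (- b2) *\<^sub>R w'"
    "br (J w) w = a1 *\<^sub>R w + a2 *\<^sub>R w'" "br (J w') w = b1 *\<^sub>R w + b2 *\<^sub>R w'"
    "br (J w') w' = (- b2) *\<^sub>R w + b1 *\<^sub>R w'"
    unfolding Jw Jw' by (simp_all add: lin tab algebra_simps)
  \<comment> \<open>Integrability at \<open>w\<close>, \<open>w'\<close> says that \<open>J\<close>
    maps \<open>[J w, w'] + [w, J w']\<close> to \<open>[J w, J w']\<close>. Both lie in the plane,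
    so both vanish by \<open>inv\<close>.\<close>
  have "J ((- a2 - b1) *\<^sub>R w + (a1 - b2) *\<^sub>R w') = br (J w) (J w')"
    using N[of w w'] by (simp add: nijenhuis_def 1 linear_simps[OF lJ] tab algebra_simps)
  moreover obtain c d where cd: "br (J w) (J w') = c *\<^sub>R w + d *\<^sub>R w'"
  proof (rule that)
    show "br (J w) (J w') = (a1 * n1 - a2 * n2 - b1 * m1 + b2 * m2) *\<^sub>R w
       + (a1 * n2 + a2 * n1 - b1 * m2 - b2 * m1) *\<^sub>R w'"
      unfolding Jw Jw' by (simp add: lin tab algebra_simps)
  qed
  ultimately have M: "J ((- a2 - b1) *\<^sub>R w + (a1 - b2) *\<^sub>R w') = c *\<^sub>R w + d *\<^sub>R w'" by simp
  from inv[OF M] have b: "b1 = - a2" "b2 = a1" by auto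
  then have cd0: "br (J w) (J w') = 0" using M cd by (simp add: Jl)
  define n where "n = a1 * a1 + a2 * a2"
  have n: "n \<noteq> 0"
  proof
    assume "n = 0"
    then have "a1 = 0" "a2 = 0" by (simp_all add: n_def sum_squares_eq_zero_iff)
    with inv[of 1 0 m1 m2] Jw show False by simp
  qed
  \<comment> \<open>\<open>p - q i\<close> is the inverse of \<open>a1 + a2 i\<close>, by which
    \<open>J w\<close> acts; accordingly \<open>w1 = (p - q i) w\<close> and
    \<open>w2 = i w1\<close>.\<close>
  define p q where "p = a1 / n" and "q = a2 / n"
  have pq: "a1 * p + a2 * q = 1" "a2 * p = a1 * q"
    using n by (simp_all add: p_def q_def add_divide_distrib[symmetric]) (simp_all add: n_def)
  define w1 w2 where "w1 = p *\<^sub>R w - q *\<^sub>R w'" and "w2 = p *\<^sub>R w' + q *\<^sub>R w"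
  note defs = w1_def w2_def
  have pq': "p * a1 + q * a2 = 1" "q * a1 = p * a2" using pq by (simp_all add: mult.commute)
  have "br (J w1) w = (p * a1 + q * a2) *\<^sub>R w + (p * a2 - q * a1) *\<^sub>R w'"
    "br (J w1) w' = (q * a1 - p * a2) *\<^sub>R w + (p * a1 + q * a2) *\<^sub>R w'"
    "br (J w2) w = (q * a1 - p * a2) *\<^sub>R w + (p * a1 + q * a2) *\<^sub>R w'"
    "br (J w2) w' = (- (p * a1 + q * a2)) *\<^sub>R w + (q * a1 - p * a2) *\<^sub>R w'"
    unfolding defs by (simp_all add: linear_simps[OF lJ] lin 1 b algebra_simps)
  then have "br (J w1) w = w" "br (J w1) w' = w'" "br (J w2) w = w'" "br (J w2) w' = - w"
    using pq' by simp_all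
  moreover have w12: "br v w1 = p *\<^sub>R br v w - q *\<^sub>R br v w'"
    "br v w2 = p *\<^sub>R br v w' + q *\<^sub>R br v w" for v
    unfolding defs by (simp_all add: lin)
  ultimately have t1: "br (J w1) w1 = w1" "br (J w1) w2 = w2" "br (J w2) w1 = w2"
    "br (J w2) w2 = - w1"
    by (simp_all add: w12) (simp_all add: defs)
  have t2: "br w1 w2 = 0" "br w2 w1 = 0" unfolding defs by (simp_all add: lin tab)
  have "br (J w') (J w) = 0" using cd0 swap[of "J w'" "J w"] by simp
  then have t3: "br (J w1) (J w2) = 0" "br (J w2) (J w1) = 0"
    unfolding defs by (simp_all add: linear_simps[OF lJ] lin cd0)
  have sw: "br w1 (J w1) = - w1" "br w2 (J w1) = - w2" "br w1 (J w2) = - w2" "br w2 (J w2) = w1"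
    using swap[of w1 "J w1"] swap[of w2 "J w1"] swap[of w1 "J w2"] swap[of w2 "J w2"] t1 by simp_all
  have "ext_d br (J_d_omega br g J) [w1, J w1, w2, J w2] = 2 * (g w1 w1 + g w2 w2)"
    by (simp add: ext_d_3 J_d_omega_3[OF sktD(5)[OF S]] t1 t2 t3 sw Jl lin
        bilinear_simps[OF sktD(4)[OF S]] hermitian_table[OF S, of w1 w2] algebra_simps)
  moreover have "w1 \<noteq> 0"
  proof
    assume "w1 = 0"
    then have "0 *\<^sub>R e + 0 *\<^sub>R e' + p *\<^sub>R w + (- q) *\<^sub>R w' = 0" by (simp add: w1_def)
    from basis4_zeroD(3,4)[OF B this] pq show False by simp
  qed
  then have "g w1 w1 > 0" by (rule sktD(8)[OF S])
  moreover have "g w2 w2 \<ge> 0"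
    using sktD(8)[OF S, of w2] bilinear_simps(9)[OF sktD(4)[OF S], of w2] by (cases "w2 = 0") auto
  ultimately show False using sktD(9)[OF S, of w1 "J w1" w2 "J w2"] by simp
qed

end

section \<open>The listed algebras: complex structures without SKT metrics\<close>

lemma complex_without_skt_of_abelian_ext:
  assumes i: "lie_isomorphic br br'" and l: "lie_algebra br'"
    and A: "abelian_ext br' e x u v p q r s t" and nz: "p \<noteq> 0" "2 * p + r \<noteq> 0"
  shows "lie_algebra br \<and> dim (UNIV :: 'a::real_vector set) = 4
    \<and> solvable_lie (br :: 'a \<Rightarrow> 'a \<Rightarrow> 'a) \<and>
    (\<exists>J. invariant_complex_structure br J) \<and> \<not> (\<exists>g J. skt br g J)"
proof -
  interpret lie_bracket br by unfold_locales (rule lie_algebra_iso[OF i l])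
  obtain e x u v where A: "abelian_ext br e x u v p q r s t"
    using brackets_iso[OF i A[unfolded abelian_ext_def]] unfolding abelian_ext_def by blast
  show ?thesis
    using lie basis4_dim[OF abelian_ext_basis[OF A]] solvable_abelian_ext[OF A]
      complex_structure_abelian_ext[OF A] no_skt_abelian_ext[OF A nz] by blast
qed

lemma complex_without_skt_of_d4:
  assumes i: "lie_isomorphic (br :: 'a::real_vector \<Rightarrow> 'a \<Rightarrow> 'a) (d4 l)" and l: "l \<ge> 1/2" "l \<noteq> 1/2"
    "l \<noteq> 2"
  shows "lie_algebra br \<and> dim (UNIV :: 'a set) = 4 \<and> solvable_lie br \<and>
    (\<exists>J. invariant_complex_structure br J) \<and> \<not> (\<exists>g J. skt br g J)"
proof -
  interpret lie_bracket br by unfold_locales (rule lie_algebra_iso[OF i lie_algebra_d4])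
  obtain e x y z where A: "heisenberg_ext br e x y z l 0 0 (1 - l)"
    using brackets_iso[OF i heisenberg_ext_d4[unfolded heisenberg_ext_def]]
    unfolding heisenberg_ext_def by blast
  \<comment> \<open>The construction of \<open>J\<close> divides the roles so that the last entry
    must be nonzero; after the exchange it is \<open>l\<close>, which covers \<open>l = 1\<close>
    too.\<close>
  have "heisenberg_ext br e y (- x) z (1 - l) 0 0 l" using heisenberg_ext_swap[OF A] by simp
  moreover have "l > 1 / 2" using l by simp
  moreover from this have "l \<noteq> 0" by simp
  ultimately show ?thesis
    using lie basis4_dim[OF heisenberg_ext_basis[OF A]] solvable_heisenberg_ext[OF A]
      complex_structure_heisenberg_ext no_skt_d4[OF A _ l(3)] by blast
qed

lemma complex_without_skt_of_h4:
  assumes i: "lie_isomorphic (br :: 'a::real_vector \<Rightarrow> 'a \<Rightarrow> 'a) h4"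
  shows "lie_algebra br \<and> dim (UNIV :: 'a set) = 4 \<and> solvable_lie br \<and>
    (\<exists>J. invariant_complex_structure br J) \<and> \<not> (\<exists>g J. skt br g J)"
proof -
  interpret lie_bracket br by unfold_locales (rule lie_algebra_iso[OF i lie_algebra_h4])
  obtain e x y z where A: "heisenberg_ext br e x y z 1 0 1 1"
    using brackets_iso[OF i heisenberg_ext_h4[unfolded heisenberg_ext_def]]
    unfolding heisenberg_ext_def by blast
  show ?thesis
    using lie basis4_dim[OF heisenberg_ext_basis[OF A]] solvable_heisenberg_ext[OF A]
      complex_structure_heisenberg_ext[OF A one_neq_zero] no_skt_h4[OF A] by blast
qed

lemma complex_without_skt_of_aff_C:
  assumes i: "lie_isomorphic (br :: 'a::real_vector \<Rightarrow> 'a \<Rightarrow> 'a) aff_C"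
  shows "lie_algebra br \<and> dim (UNIV :: 'a set) = 4 \<and> solvable_lie br \<and>
    (\<exists>J. invariant_complex_structure br J) \<and> \<not> (\<exists>g J. skt br g J)"
proof -
  interpret lie_bracket br by unfold_locales (rule lie_algebra_iso[OF i lie_algebra_aff_C])
  obtain e e' w w' where A: "plane_ext br e e' w w' (- 1)"
    using brackets_iso[OF i plane_ext_aff_C[unfolded plane_ext_def]]
    unfolding plane_ext_def by blast
  \<comment> \<open>\<open>J e = e'\<close>, \<open>J w = w'\<close> is multiplication by
    \<open>i\<close>, for which the bracket is complex bilinear.\<close>
  have "\<exists>J. invariant_complex_structure br J"
    using plane_ext_basis[OF A]
  proof (rule complex_structure_exists)
    fix g J assume f: "unitary_frame g J e e' w w'"
    note t = unitary_frame_table[OF f]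
    show "nijenhuis br J e w = 0"
      by (simp add: nijenhuis_def t plane_ext_table[OF A])
  qed
  then show ?thesis
    using lie basis4_dim[OF plane_ext_basis[OF A]] solvable_plane_ext[OF A] no_skt_aff_C[OF A]
      by blast
qed

theorem corollary6p2:
  fixes br :: "'a::real_vector \<Rightarrow> 'a \<Rightarrow> 'a"
  shows "(lie_algebra br \<and> dim (UNIV :: 'a set) = 4 \<and> solvable_lie br \<and>
          (\<exists>J. invariant_complex_structure br J) \<and> \<not> (\<exists>g J. skt br g J))
     \<longleftrightarrow>
         (lie_isomorphic br (lie_prod lie_R (r3 1)) \<or>
          (\<exists>l. l \<ge> 0 \<and> l > 0 \<and> lie_isomorphic br (lie_prod lie_R (r3' l))) \<or>
          lie_isomorphic br aff_C \<or>
          lie_isomorphic br (r4 1) \<or>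
          (\<exists>m l. r4_diag_params m l \<and> ((m = l \<and> l \<noteq> - (1/2)) \<or> (m \<le> l \<and> l = 1)) \<and>
             lie_isomorphic br (r4_diag m l)) \<or>
          (\<exists>m l. m > 0 \<and> l \<noteq> 0 \<and> l \<noteq> - m / 2 \<and> lie_isomorphic br (r4' m l)) \<or>
          (\<exists>l. l \<ge> 1/2 \<and> l \<noteq> 1/2 \<and> l \<noteq> 2 \<and> lie_isomorphic br (d4 l)) \<or>
          lie_isomorphic br h4)"
    (is "?no_skt \<longleftrightarrow> ?listed")
proof
  assume *: ?no_skt
  then interpret lie_bracket br by unfold_locales simp
  obtain J where "invariant_complex_structure br J" using * by blast
  then show ?listed using * by (intro no_skt_listed) simp_all
next
  assume ?listed
  then consider "lie_isomorphic br (lie_prod lie_R (r3 1))"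
    | l where "l > 0" "lie_isomorphic br (lie_prod lie_R (r3' l))"
    | "lie_isomorphic br aff_C"
    | "lie_isomorphic br (r4 1)"
    | l where "r4_diag_params l l" "l \<noteq> - (1/2)" "lie_isomorphic br (r4_diag l l)"
    | m where "r4_diag_params m 1" "lie_isomorphic br (r4_diag m 1)"
    | m l where "m > 0" "l \<noteq> 0" "l \<noteq> - m / 2" "lie_isomorphic br (r4' m l)"
    | l where "l \<ge> 1/2" "l \<noteq> 1/2" "l \<noteq> 2" "lie_isomorphic br (d4 l)"
    | "lie_isomorphic br h4"
    by blast
  then show ?no_skt
  proof cases
    case 1
    from complex_without_skt_of_abelian_ext[OF this lie_algebra_prod_r3 abelian_ext_prod_r3]
    show ?thesis by simp
  next
    case 2
    from complex_without_skt_of_abelian_ext[OF 2(2) lie_algebra_prod_r3' abelian_ext_prod_r3'] 2(1)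
    show ?thesis by simp
  next
    case 3
    then show ?thesis by (rule complex_without_skt_of_aff_C)
  next
    case 4
    from complex_without_skt_of_abelian_ext[OF this lie_algebra_r4 abelian_ext_r4]
    show ?thesis by simp
  next
    case (5 l)
    have "l \<noteq> 0" "2 * l + 1 \<noteq> 0" using 5(1,2) by (auto simp: r4_diag_params_def)
    then show ?thesis
      by (rule complex_without_skt_of_abelian_ext[OF 5(3) lie_algebra_r4_diag
        abelian_ext_r4_diag_eq])
  next
    case (6 m)
    have "(1 :: real) \<noteq> 0" "2 * 1 + m \<noteq> 0" using 6(1) by (auto simp: r4_diag_params_def)
    then show ?thesis
      by (rule complex_without_skt_of_abelian_ext[OF 6(2) lie_algebra_r4_diag
        abelian_ext_r4_diag_1])
  next
    case (7 m l)
    have "2 * l + m \<noteq> 0" using 7(3) by auto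
    with 7(2) show ?thesis
      by (rule complex_without_skt_of_abelian_ext[OF 7(4) lie_algebra_r4' abelian_ext_r4'])
  next
    case (8 l)
    from complex_without_skt_of_d4[OF 8(4,1-3)] show ?thesis .
  next
    case 9
    then show ?thesis by (rule complex_without_skt_of_h4)
  qed
qed

end
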